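(* Let $t$ denote the round, and let $M_i$, $L_{ij}^{c,0}$, $L_{ij}^{c,1}$ be the constants of the loss functions defined in the context. Assume that for each $i\in N$: (A1) $p_i(\theta_i;\zeta)$ is continuous in $\theta_i$ for all $\zeta\in\mathcal{Z}$, $\inf_{\theta_i\in\Theta_i}\int_{\mathcal{Z}}p_i(\theta_i;\zeta)m_i^t(\zeta)\,d\zeta>0$, and $\rho^{\rm bp}$ is a law-invariant convex risk measure whose induced risk functional $\varrho^{\rm bp}$ is continuous in the underlying probability distribution under the total variation metric; (A2) with $C_f(\theta_{-i}):=c_i(a_i,f_{-i}(\theta_{-i}),\theta_i,\theta_{-i})$, there are $\kappa_i^{{\rm bp},0},\kappa_i^{{\rm bp},1}\ge0$ such that for all $f_{-i},f_{-i}'\in\mathcal{F}_{-i}$, $\|\nabla_{a_i}\rho^{\rm bp}_{\nu_i^t(\cdot\mid\theta_i)}(C_f)-\nabla_{a_i}\rho^{\rm bp}_{\nu_i^t(\cdot\mid\theta_i)}(C_{f'})\|\le\kappa_i^{{\rm bp},1}\sup_{\theta_{-i}}\|\nabla_{a_i}C_f-\nabla_{a_i}C_{f'}\|+\kappa_i^{{\rm bp},0}\sup_{\theta_{-i}}|C_f-C_{f'}|$, uniformly for $a_i\in\mathcal{A}_i,\theta_i\in\Theta_i$; and with $K_{ij}^{\rm bp}:=\kappa_i^{{\rm bp},1}L_{ij}^{c,1}+\kappa_i^{{\rm bp},0}L_{ij}^{c,0}$ ($j\ne i$), $K_{ii}^{\rm bp}:=0$, the matrix $\Gamma^{\rm bp}=(K_{ij}^{\rm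 bp}/M_i)_{i,j}$ has spectral radius less than $1$; (A3) there is $\bar g_i$ with $\sup_{a\in\mathcal{A},\theta\in\Theta}\|\nabla_{a_i}c_i(a_i,a_{-i},\theta_i,\theta_{-i})\|\le\bar g_i$; (A4) $\rho^{\rm bp}$ is gradient regular with weights $\omega^{\rm bp}_{i,\nu_i^t(\cdot\mid\theta_i)}(\theta_{-i})\in[0,\bar\omega_i^{\rm bp}]$ for all $\theta_{-i}$, and there is $\lambda_i^{\rm bp}$ with $\mathbb{E}_{\eta(\cdot\mid\theta_i;\zeta^* )}\big[|\omega^{\rm bp}_{i,\nu_i^t(\cdot\mid\theta_i)}(\theta_{-i})-\omega^{\rm bp}_{i,\eta(\cdot\mid\theta_i;\zeta^* )}(\theta_{-i})|\big]\le\lambda_i^{\rm bp}\,d_{TV}(\nu_i^t(\cdot\mid\theta_i),\eta(\cdot\mid\theta_i;\zeta^* ))$. Then the following hold. (i) For each $i\in N$ and $\theta_i\in\Theta_i$ (and all $a_i\in\mathcal{A}_i$, $f_{-i}\in\mathcal{F}_{-i}$), $$\big\|\nabla_{a_i}v^{{\rm bp}}_{i,\nu_i^t(\cdot\mid\theta_i)}(a_i,f_{-i},\theta_i)-\nabla_{a_i}v^{{\rm bp}}_{i,\eta(\cdot\mid\theta_i;\zeta^* )}(a_i,f_{-i},\theta_i)\big\|\le(\bar\omega_i^{\rm bp}\bar g_i+\bar g_i\lambda_i^{\rm bp})\,d_{TV}(\nu_i^t(\cdot\mid\theta_i),\eta(\cdot\mid\theta_i;\zeta^* )).$$ (ii)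 Let $f^\nu$ and $f^{\nu'}$ be two BNE-BPDs corresponding to the posterior profiles $\mu=(\mu_1,\dots,\mu_n)$ and $\mu'=(\mu_1',\dots,\mu_n')$, respectively, with predictive distributions $\nu_i,\nu_i'$. Then $$\|f^\nu-f^{\nu'}\|_\infty\le\max_{i\in N}\sum_{j\in N}[(1-\Gamma^{\rm bp})^{-1}]_{ij}\,\bar d_j^{\rm bp},\qquad \bar d_i^{\rm bp}:=\frac1{M_i}\sup_{\theta_i\in\Theta_i}\big\|\nabla_{a_i}v^{\rm bp}_{i,\nu_i(\cdot\mid\theta_i)}(f_i^\nu(\theta_i),f_{-i}^\nu,\theta_i)-\nabla_{a_i}v^{\rm bp}_{i,\nu_i'(\cdot\mid\theta_i)}(f_i^\nu(\theta_i),f_{-i}^\nu,\theta_i)\big\|.$$ (iii) Let $f^{t*}$ be the BNE-BPD at round $t$ and $f^*$ the BNE under the true distribution $\eta(\cdot;\zeta^* )$. Assume in addition that: (C1) for each $i\in N$ and any $\epsilon\in(0,1)$ there are $c_1>0$, $c_2(\epsilon)>0$, $T(\epsilon)\ge2$ such that for all $t>T(\epsilon)$, $\mathrm{Prob}^{t-1}_{\eta(\cdot;\zeta^* )}\big(\mathbb{E}_{\mu_i^t}\|\zeta-\zeta^*\|_2^2\le c_2(\epsilon)(t-1)^{-c_1}\big)\ge1-\epsilon$; (C2) for each $i$ and $\theta_i\in\Theta_i$ there are $L_{\eta,i}>0$, $r_i\in(0,2]$, $\epsilon_i>0$ with $d_{TV}(\eta(\cdot\mid\theta_i;\zeta),\eta(\cdot\mid\theta_i;\zeta^*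 ))\le L_{\eta,i}\|\zeta-\zeta^*\|^{r_i}$ for all $\zeta\in\mathbb{B}(\zeta^*,\epsilon_i)$; (C3) for each $i$, $p_i(\theta_i;\zeta^* )>0$ for all $\theta_i\in\Theta_i$; there are $L_{p,i},\delta>0$ with $|\log p_i(\theta_i;\zeta)-\log p_i(\theta_i;\zeta^* )|\le L_{p,i}\|\zeta-\zeta^*\|$ for all $\zeta\in\mathbb{B}(\zeta^*,\delta)$, uniformly in $\theta_i\in\Theta_i$; and there is $\bar l<+\infty$ with $p_i(\theta_i;\zeta)/p_i(\theta_i;\zeta^* )<\bar l$ for all $\zeta\in\mathcal{Z}$, $\theta_i\in\Theta_i$. Then for any $\epsilon\in(0,1)$ there exist positive constants $c_1>0$, $c_2(\epsilon)>0$ and $T(\epsilon),\hat T(\delta,\epsilon)\ge2$ such that for all $t>\max\{T(\epsilon),\hat T(\delta,\epsilon)\}$, $$\mathrm{Prob}^{t-1}_{\eta(\cdot;\zeta^* )}\Big(\|f^{t*}-f^*\|_\infty\le\Big(\max_{i\in N}\sum_{j\in N}[(1-\Gamma^{\rm bp})^{-1}]_{ij}D_j^{\rm bp}(\epsilon,\delta)\Big)(t-1)^{-\underline rc_1/2}\Big)\ge1-\epsilon,$$ where $\underline r=\min_{i\in N}r_i$ and $$D_i^{\rm bp}(\epsilon,\delta):=\frac2{M_i}(\bar\omega_i^{\rm bp}+\lambda_i^{\rm bp})\,\bar g_i\exp(L_{p,i}\delta)\Big(L_{\eta,i}\exp(L_{p,i}\delta)+2\frac{\bar l}{\delta^2}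\Big)c_2(\epsilon).$$
   Context: Game. $N=\{1,\dots,n\}$ is the set of players. For each $i\in N$ the type space $\Theta_i\subset\mathbb{R}^{d_i}$ and the action space $\mathcal{A}_i\subset\mathbb{R}^{n_i}$ are nonempty, compact and convex (standing assumption); $\Theta=\prod_j\Theta_j$, $\mathcal{A}=\prod_j\mathcal{A}_j$, and the subscript $-i$ denotes the profile or product over $j\neq i$. The loss $c_i:\mathcal{A}_i\times\mathcal{A}_{-i}\times\Theta_i\times\Theta_{-i}\to\mathbb{R}$ is continuous, hence bounded (standing assumption). $\mathcal{F}_i$ is the set of measurable functions $f_i:\Theta_i\to\mathcal{A}_i$ with $\|f_i\|_\infty=\sup_{\theta_i}\|f_i(\theta_i)\|$; $\mathcal{F}=\prod_j\mathcal{F}_j$, $\mathcal{F}_{-i}=\prod_{j\ne i}\mathcal{F}_j$, $\|f\|_\infty=\max_j\|f_j\|_\infty$. $f_{-i}(\theta_{-i})=(f_j(\theta_j))_{j\neq i}$. Constants of the loss. $M_i>0$ denotes the strong convexity constant of $c_i$ in $a_i$, i.e. $c_i(\lambda a_i+(1-\lambda)a_i',a_{-i},\theta_i,\theta_{-i})\le\lambda c_i(a_i,a_{-i},\theta_i,\theta_{-i})+(1-\lambda)c_i(a_i',a_{-i},\theta_i,\theta_{-i})-\frac{M_i}{2}\lambda(1-\lambda)\|a_i-a_i'\|^2$ for all $a_i,a_i'\in\mathcal{A}_i$, $\lambda\in[0,1]$, uniformly in the other arguments. $L_{ij}^{c,0},L_{ij}^{c,1}\ge0$ ($j\ne i$)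 denote the blockwise Lipschitz constants of $c_i$ and $\nabla_{a_i}c_i$ in the rivals' actions, i.e. $|c_i(a_i,a_{-i}',\theta_i,\theta_{-i})-c_i(a_i,a_{-i},\theta_i,\theta_{-i})|\le\sum_{j\ne i}L_{ij}^{c,0}\|a_j'-a_j\|$ and $\|\nabla_{a_i}c_i(a_i,a_{-i}',\theta_i,\theta_{-i})-\nabla_{a_i}c_i(a_i,a_{-i},\theta_i,\theta_{-i})\|\le\sum_{j\ne i}L_{ij}^{c,1}\|a_j'-a_j\|$ for all $a_{-i},a_{-i}'\in\mathcal{A}_{-i}$. Distributions. $\{\eta(\cdot;\zeta):\zeta\in\mathcal{Z}\}$ is a parametric family of distributions on $\Theta$ with densities $p(\theta;\zeta)$ and true parameter $\zeta^*\in\mathcal{Z}$; $p_i(\theta_i;\zeta)=\int_{\Theta_{-i}}p(\theta_i,\theta_{-i};\zeta)\,d\theta_{-i}$; $\eta(\cdot\mid\theta_i;\zeta)$ is the conditional distribution of $\theta_{-i}$ given $\theta_i$. Type profiles $\theta^1,\theta^2,\dots$ are i.i.d. from $\eta(\cdot;\zeta^* )$. Player $i$ has a prior $\mu_i^1$ with density $m_i^1$ on $\mathcal{Z}$; its posterior at round $t$ is $\mu_i^t$ with density $m_i^t(\zeta)\propto\prod_{\tau=1}^{t-1}p(\theta^\tau;\zeta)\,m_i^1(\zeta)$. For a belief $\mu_i$ on $\mathcal{Z}$, the Bayesian predictive distribution $\nu_i$ is the mixture $\int\eta(\cdot;\zeta)\,\mu_i(d\zeta)$ (density $q_i(\theta)=\int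 p(\theta;\zeta)\mu_i(d\zeta)$), and $\nu_i(\cdot\mid\theta_i)$ is its conditional distribution of $\theta_{-i}$ given $\theta_i$; $\nu_i^t$ corresponds to $\mu_i^t$, and for $\mu_i=\delta_{\zeta^*}$ (Dirac mass) the predictive distribution is $\eta(\cdot;\zeta^* )$. $\mathrm{Prob}^{t-1}_{\eta(\cdot;\zeta^* )}$ is the $(t-1)$-fold product of $\eta(\cdot;\zeta^* )$. $\mathbb{B}(\zeta^*,r)$ is the ball of radius $r$ around $\zeta^*$. Risk measures. A risk measure is a real functional on random losses that is monotone and cash invariant; convex and law invariant have the usual meaning. For law-invariant $\rho$, $\rho_P(X)=\varrho(P\circ X^{-1})$ is its value when the underlying uncertainty has distribution $P$, with $\varrho$ the induced risk functional; its continuity under total variation means that for every $\epsilon>0$ there is $\delta'>0$ with $|\varrho(P)-\varrho(Q)|\le\epsilon$ whenever $d_{TV}(P,Q)\le\delta'$. A risk measure is gradient regular (on bounded differentiable losses) if for any probability measure $P$ and any loss $l(a,\xi)$ differentiable in $a$ there is a measurable weight function $\omega_P$ with $\nabla_a\rho_P(l(a,\xi))=\mathbb{E}_P[\omega_P(\xi)\nabla_al(a,\xi)]$, $\mathbb{E}_P[\omega_P(\xi)]=1$ and $\omega_P(\xi)\in[0,\bar\omega]$ for some $\bar\omega>0$. Objective and equilibria. $v^{\rm bp}_{i,\nu_i(\cdot\mid\theta_i)}(a_i,f_{-i},\theta_i):=\rho^{\rm bp}_{\nu_i(\cdot\mid\theta_i)}(c_i(a_i,f_{-i}(\theta_{-i}),\theta_i,\theta_{-i}))$.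 A BNE-BPD (Bayesian Nash equilibrium based on Bayesian predictive distributions) for a belief profile with predictive distributions $(\nu_i)$ is $f\in\mathcal{F}$ with $f_i(\theta_i)\in\arg\min_{a_i\in\mathcal{A}_i}v^{\rm bp}_{i,\nu_i(\cdot\mid\theta_i)}(a_i,f_{-i},\theta_i)$ for all $i\in N$, $\theta_i\in\Theta_i$. $f^*$ is the equilibrium with $\nu_i(\cdot\mid\theta_i)$ replaced by $\eta(\cdot\mid\theta_i;\zeta^* )$ for all $i$. In $(1-\Gamma^{\rm bp})^{-1}$, $1$ denotes the identity matrix. $d_{TV}(P,Q)=\frac12\sup\{|\mathbb{E}_P[h]-\mathbb{E}_Q[h]|: h\text{ measurable},\ \|h\|_\infty\le1\}$.
   Formalization: In (i) the coefficient is 2ω̄_i ḡ_i + ḡ_i λ_i instead of ω̄_i ḡ_i + ḡ_i λ_i: with d_TV normalised by 1/2 the printed bound fails already for the expectation. λ_i ≥ 0 is assumed, and the constants in (C2) are uniform in θ_i. *)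

theory Defs
  imports "HOL-Probability.Probability"
begin

section \<open>Gradients, total variation, spectral radius\<close>

text \<open>Gradient on a convex set \<open>S\<close> that need not be open: the representing vector of the derivative
  within \<open>S\<close>, taken in the direction space of \<open>S\<close>, where it is unique. If \<open>S\<close> has nonempty
  interior in a subspace (say \<open>R\<^sup>k\<close> embedded in the ambient type), this is the usual gradient there,
  one-sided at boundary points; in particular it does not depend on the embedding.\<close>

definition has_grad_on :: "'a::euclidean_space set \<Rightarrow> ('a \<Rightarrow> real) \<Rightarrow> 'a \<Rightarrow> 'a \<Rightarrow> bool" where
  "has_grad_on S f g x \<longleftrightarrow>
     g \<in> span {y - z |y z. y \<in> S \<and> z \<in> S} \<and> (f has_derivative (\<lambda>h. g \<bullet> h)) (at x within S)"

definition grad_on :: "'a::euclidean_space set \<Rightarrow> ('a \<Rightarrow> real) \<Rightarrow> 'a \<Rightarrow> 'a" where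
  "grad_on S f x = (THE g. has_grad_on S f g x)"

text \<open>With this normalisation \<open>\<bar>E\<^sub>P h - E\<^sub>Q h\<bar> \<le> 2 * B * d_TV P Q\<close> for \<open>\<bar>h\<bar> \<le> B\<close>, and the factor 2 is sharp.
  It is the reason for the coefficient \<open>2 * wbar i * gbar i\<close> in the first conclusion of the
  theorem: with \<open>wbar i * gbar i\<close> the bound fails already for the expectation (weights 1, \<open>lam = 0\<close>),
  when the gradient is close to \<open>gbar\<close> under the one distribution and to \<open>- gbar\<close> under the other.\<close>

definition d_TV :: "'w measure \<Rightarrow> 'w measure \<Rightarrow> real" where
  "d_TV P Q = 1/2 * (SUP h \<in> {h \<in> borel_measurable P. \<forall>x\<in>space P. \<bar>h x\<bar> \<le> 1}.
                        \<bar>(\<integral>x. h x \<partial>P) - (\<integral>x. h x \<partial>Q)\<bar>)"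

definition spectral_radius :: "real^'n^'n \<Rightarrow> real" where
  "spectral_radius A =
     Sup {cmod l |l. \<exists>v::complex^'n. v \<noteq> 0 \<and> (\<chi> i j. complex_of_real (A $ i $ j)) *v v = l *s v}"

text \<open>\<open>Prob(Q) \<ge> c\<close>, read as inner probability because the events below involve suprema over
  uncountable sets; for a measurable event this is the ordinary statement.\<close>

definition prob_at_least :: "'w measure \<Rightarrow> ('w \<Rightarrow> bool) \<Rightarrow> real \<Rightarrow> bool" where
  "prob_at_least P Q c \<longleftrightarrow> (\<exists>E\<in>sets P. (\<forall>w\<in>E. Q w) \<and> c \<le> measure P E)"


section \<open>Risk measures\<close>

definition bounded_loss :: "'w measure \<Rightarrow> ('w \<Rightarrow> real) \<Rightarrow> bool" where
  "bounded_loss P X \<longleftrightarrow> X \<in> borel_measurable P \<and> bounded (X ` space P)"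

definition risk_measure :: "'w measure \<Rightarrow> (('w \<Rightarrow> real) \<Rightarrow> real) \<Rightarrow> bool" where
  "risk_measure P \<rho> \<longleftrightarrow>
     (\<forall>X Y. bounded_loss P X \<and> bounded_loss P Y \<and> (\<forall>w\<in>space P. X w \<le> Y w) \<longrightarrow> \<rho> X \<le> \<rho> Y) \<and>
     (\<forall>X (m::real). bounded_loss P X \<longrightarrow> \<rho> (\<lambda>w. X w + m) = \<rho> X + m)"

definition convex_risk_measure :: "'w measure \<Rightarrow> (('w \<Rightarrow> real) \<Rightarrow> real) \<Rightarrow> bool" where
  "convex_risk_measure P \<rho> \<longleftrightarrow> risk_measure P \<rho> \<and>
     (\<forall>X Y. \<forall>s\<in>{0..1}. bounded_loss P X \<and> bounded_loss P Y \<longrightarrow>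
        \<rho> (\<lambda>w. s * X w + (1 - s) * Y w) \<le> s * \<rho> X + (1 - s) * \<rho> Y)"

text \<open>A law-invariant risk measure is given by its induced functional \<open>\<phi>\<close> on laws;
  \<open>risk \<phi> P\<close> is the risk measure when the underlying uncertainty has distribution \<open>P\<close>.\<close>

definition risk :: "(real measure \<Rightarrow> real) \<Rightarrow> 'w measure \<Rightarrow> ('w \<Rightarrow> real) \<Rightarrow> real" where
  "risk \<phi> P X = \<phi> (distr P borel X)"

definition law_invariant_convex_risk :: "'w measure \<Rightarrow> (real measure \<Rightarrow> real) \<Rightarrow> bool" where
  "law_invariant_convex_risk S \<phi> \<longleftrightarrow>
     (\<forall>P. prob_space P \<and> sets P = sets S \<longrightarrow> convex_risk_measure P (risk \<phi> P))"

text \<open>Only laws on a common bounded interval are compared, as losses are bounded: uniformly over all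
  laws on the real line not even the expectation is continuous in total variation.\<close>

definition tv_continuous :: "(real measure \<Rightarrow> real) \<Rightarrow> bool" where
  "tv_continuous \<phi> \<longleftrightarrow>
     (\<forall>B. \<forall>e>0. \<exists>d>0. \<forall>P Q.
        prob_space P \<and> sets P = sets borel \<and> (AE x in P. \<bar>x\<bar> \<le> B) \<and>
        prob_space Q \<and> sets Q = sets borel \<and> (AE x in Q. \<bar>x\<bar> \<le> B) \<and>
        d_TV P Q \<le> d \<longrightarrow> \<bar>\<phi> P - \<phi> Q\<bar> \<le> e)"

definition bounded_diff_loss ::
    "'a::euclidean_space set \<Rightarrow> 'w measure \<Rightarrow> ('a \<Rightarrow> 'w \<Rightarrow> real) \<Rightarrow> bool" where
  "bounded_diff_loss A S l \<longleftrightarrow>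
     (\<forall>a\<in>A. l a \<in> borel_measurable S) \<and>
     (\<forall>a\<in>A. \<forall>w\<in>space S. \<exists>g. has_grad_on A (\<lambda>y. l y w) g a) \<and>
     (\<exists>B. \<forall>a\<in>A. \<forall>w\<in>space S. \<bar>l a w\<bar> \<le> B \<and> norm (grad_on A (\<lambda>y. l y w) a) \<le> B)"

text \<open>Gradient regularity with weights \<open>W P l a\<close>. The weight may depend on the loss \<open>l\<close> and on the
  action \<open>a\<close>, as it does for the entropic risk measure; weights depending on \<open>P\<close> only are the
  special case of a \<open>W\<close> constant in \<open>l\<close> and \<open>a\<close>.\<close>

definition gradient_regular ::
    "'a::euclidean_space set \<Rightarrow> 'w measure \<Rightarrow> (real measure \<Rightarrow> real) \<Rightarrow>
     ('w measure \<Rightarrow> ('a \<Rightarrow> 'w \<Rightarrow> real) \<Rightarrow> 'a \<Rightarrow> 'w \<Rightarrow> real) \<Rightarrow> bool" where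
  "gradient_regular A S \<phi> W \<longleftrightarrow>
     (\<forall>P l. prob_space P \<and> sets P = sets S \<and> bounded_diff_loss A S l \<longrightarrow>
        (\<exists>wbar>0. \<forall>a\<in>A.
           W P l a \<in> borel_measurable S \<and>
           (\<forall>w\<in>space S. 0 \<le> W P l a w \<and> W P l a w \<le> wbar) \<and>
           (\<integral>w. W P l a w \<partial>P) = 1 \<and>
           has_grad_on A (\<lambda>y. risk \<phi> P (l y))
             (\<integral>w. W P l a w *\<^sub>R grad_on A (\<lambda>y. l y w) a \<partial>P) a))"


section \<open>The game\<close>

text \<open>Players form the finite type \<open>'n\<close>. Different players have type spaces of different dimensions:
  \<open>R^d_i\<close> is the coordinate subspace of \<open>'b\<close> spanned by the basis vectors \<open>type_coords i\<close>, with its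
  own Lebesgue measure. The action spaces \<open>R^n_i\<close> are likewise embedded into \<open>'a\<close>; no reference
  measure is needed there and \<^const>\<open>grad_on\<close> does not depend on the embedding.
  Profiles are functions on \<open>'n\<close>; a rival profile is extensional on \<open>- {i}\<close> and is completed
  to a full profile by \<open>\<xi>(i := x)\<close>.\<close>

record ('n, 'a, 'b, 'z) bgame =
  type_coords :: "'n \<Rightarrow> 'b set"
  type_set :: "'n \<Rightarrow> 'b set"
  act_set :: "'n \<Rightarrow> 'a set"
  cost :: "'n \<Rightarrow> ('n \<Rightarrow> 'a) \<Rightarrow> ('n \<Rightarrow> 'b) \<Rightarrow> real"
  par_set :: "'z set"
  truth :: "'z"
  pdens :: "('n \<Rightarrow> 'b) \<Rightarrow> 'z \<Rightarrow> real"
  prior :: "'n \<Rightarrow> 'z \<Rightarrow> real"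

text \<open>Same construction as \<open>lborel\<close>, which is the case \<open>B = Basis\<close>.\<close>

definition lborel_on :: "'b::euclidean_space set \<Rightarrow> 'b measure" where
  "lborel_on B = distr (\<Pi>\<^sub>M b\<in>B. lborel) borel (\<lambda>x. \<Sum>b\<in>B. x b *\<^sub>R b)"

definition type_ref :: "('n, 'a, 'b::euclidean_space, 'z) bgame \<Rightarrow> 'n \<Rightarrow> 'b measure" where
  "type_ref G j = restrict_space (lborel_on (type_coords G j)) (type_set G j)"

definition rival_ref ::
    "('n, 'a, 'b::euclidean_space, 'z) bgame \<Rightarrow> 'n \<Rightarrow> ('n \<Rightarrow> 'b) measure" where
  "rival_ref G i = (\<Pi>\<^sub>M j\<in>- {i}. type_ref G j)"

definition par_ref :: "('n, 'a, 'b, 'z::euclidean_space) bgame \<Rightarrow> 'z measure" where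
  "par_ref G = restrict_space lborel (par_set G)"

definition act_profiles :: "('n, 'a, 'b, 'z) bgame \<Rightarrow> ('n \<Rightarrow> 'a) set" where
  "act_profiles G = {a. \<forall>j. a j \<in> act_set G j}"

definition type_profiles :: "('n, 'a, 'b, 'z) bgame \<Rightarrow> ('n \<Rightarrow> 'b) set" where
  "type_profiles G = {\<theta>. \<forall>j. \<theta> j \<in> type_set G j}"

definition own_grad ::
    "('n, 'a::euclidean_space, 'b, 'z) bgame \<Rightarrow> 'n \<Rightarrow> ('n \<Rightarrow> 'a) \<Rightarrow> ('n \<Rightarrow> 'b) \<Rightarrow> 'a" where
  "own_grad G i a \<theta> = grad_on (act_set G i) (\<lambda>y. cost G i (a(i := y)) \<theta>) (a i)"

definition bayesian_game ::
    "('n::finite, 'a::euclidean_space, 'b::euclidean_space, 'z::euclidean_space) bgame \<Rightarrow> bool" where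
  "bayesian_game G \<longleftrightarrow>
     (\<forall>i. type_coords G i \<subseteq> Basis \<and> type_set G i \<subseteq> span (type_coords G i) \<and>
          type_set G i \<noteq> {} \<and> compact (type_set G i) \<and> convex (type_set G i) \<and>
          act_set G i \<noteq> {} \<and> compact (act_set G i) \<and> convex (act_set G i) \<and>
          continuous_on (act_profiles G \<times> type_profiles G) (\<lambda>(a, \<theta>). cost G i a \<theta>) \<and>
          (\<forall>a\<in>act_profiles G. \<forall>\<theta>\<in>type_profiles G.
             \<exists>g. has_grad_on (act_set G i) (\<lambda>y. cost G i (a(i := y)) \<theta>) g (a i))) \<and>
     par_set G \<in> sets borel \<and> truth G \<in> par_set G \<and>
     (\<lambda>(\<theta>, \<zeta>). pdens G \<theta> \<zeta>) \<in> borel_measurable (PiM UNIV (type_ref G) \<Otimes>\<^sub>M par_ref G) \<and>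
     (\<forall>\<zeta>\<in>par_set G. (\<forall>\<theta>\<in>type_profiles G. 0 \<le> pdens G \<theta> \<zeta>) \<and>
          (\<integral>\<^sup>+\<theta>. ennreal (pdens G \<theta> \<zeta>) \<partial>PiM UNIV (type_ref G)) = 1) \<and>
     (\<forall>i. prior G i \<in> borel_measurable (par_ref G) \<and> (\<forall>\<zeta>\<in>par_set G. 0 \<le> prior G i \<zeta>) \<and>
          (\<integral>\<^sup>+\<zeta>. ennreal (prior G i \<zeta>) \<partial>par_ref G) = 1)"


section \<open>Distributions and beliefs\<close>

definition eta ::
    "('n, 'a, 'b::euclidean_space, 'z) bgame \<Rightarrow> 'z \<Rightarrow> ('n \<Rightarrow> 'b) measure" where
  "eta G \<zeta> = density (PiM UNIV (type_ref G)) (\<lambda>\<theta>. ennreal (pdens G \<theta> \<zeta>))"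

text \<open>Marginal density of \<open>\<theta>\<^sub>i\<close> and conditional distribution of the rivals' types for a joint
  density \<open>q\<close>; the latter is a probability measure only where the marginal density is positive.\<close>

definition marginal ::
    "('n, 'a, 'b::euclidean_space, 'z) bgame \<Rightarrow> 'n \<Rightarrow> (('n \<Rightarrow> 'b) \<Rightarrow> real) \<Rightarrow> 'b \<Rightarrow> real" where
  "marginal G i q x = (\<integral>\<xi>. q (\<xi>(i := x)) \<partial>rival_ref G i)"

definition conditional ::
    "('n, 'a, 'b::euclidean_space, 'z) bgame \<Rightarrow> 'n \<Rightarrow> (('n \<Rightarrow> 'b) \<Rightarrow> real) \<Rightarrow> 'b \<Rightarrow>
     ('n \<Rightarrow> 'b) measure" where
  "conditional G i q x =
     density (rival_ref G i) (\<lambda>\<xi>. ennreal (q (\<xi>(i := x)) / marginal G i q x))"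

definition pmarg ::
    "('n, 'a, 'b::euclidean_space, 'z) bgame \<Rightarrow> 'n \<Rightarrow> 'b \<Rightarrow> 'z \<Rightarrow> real" where
  "pmarg G i x \<zeta> = marginal G i (\<lambda>\<theta>. pdens G \<theta> \<zeta>) x"

definition eta_cond ::
    "('n, 'a, 'b::euclidean_space, 'z) bgame \<Rightarrow> 'n \<Rightarrow> 'z \<Rightarrow> 'b \<Rightarrow> ('n \<Rightarrow> 'b) measure" where
  "eta_cond G i \<zeta> x = conditional G i (\<lambda>\<theta>. pdens G \<theta> \<zeta>) x"

definition is_belief :: "('n, 'a, 'b, 'z::euclidean_space) bgame \<Rightarrow> 'z measure \<Rightarrow> bool" where
  "is_belief G \<mu> \<longleftrightarrow> prob_space \<mu> \<and> sets \<mu> = sets (par_ref G)"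

definition predictive_density ::
    "('n, 'a, 'b, 'z) bgame \<Rightarrow> 'z measure \<Rightarrow> ('n \<Rightarrow> 'b) \<Rightarrow> real" where
  "predictive_density G \<mu> \<theta> = (\<integral>\<zeta>. pdens G \<theta> \<zeta> \<partial>\<mu>)"

definition nu_cond ::
    "('n, 'a, 'b::euclidean_space, 'z) bgame \<Rightarrow> 'n \<Rightarrow> 'z measure \<Rightarrow> 'b \<Rightarrow> ('n \<Rightarrow> 'b) measure" where
  "nu_cond G i \<mu> x = conditional G i (predictive_density G \<mu>) x"

text \<open>Histories of round \<open>t\<close> are families \<open>\<theta>\<^sup>1, \<dots>, \<theta>\<^sup>t\<^sup>-\<^sup>1\<close> indexed by \<open>{1..<t}\<close>.\<close>

definition history_measure ::
    "('n, 'a, 'b::euclidean_space, 'z) bgame \<Rightarrow> nat \<Rightarrow> (nat \<Rightarrow> 'n \<Rightarrow> 'b) measure" where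
  "history_measure G t = (\<Pi>\<^sub>M \<tau>\<in>{1..<t}. eta G (truth G))"

definition posterior_density ::
    "('n, 'a, 'b, 'z::euclidean_space) bgame \<Rightarrow> 'n \<Rightarrow> nat \<Rightarrow> (nat \<Rightarrow> 'n \<Rightarrow> 'b) \<Rightarrow> 'z \<Rightarrow> real" where
  "posterior_density G i t h \<zeta> =
     (\<Prod>\<tau>\<in>{1..<t}. pdens G (h \<tau>) \<zeta>) * prior G i \<zeta> /
     (\<integral>z. (\<Prod>\<tau>\<in>{1..<t}. pdens G (h \<tau>) z) * prior G i z \<partial>par_ref G)"

definition posterior ::
    "('n, 'a, 'b, 'z::euclidean_space) bgame \<Rightarrow> 'n \<Rightarrow> nat \<Rightarrow> (nat \<Rightarrow> 'n \<Rightarrow> 'b) \<Rightarrow> 'z measure" where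
  "posterior G i t h = density (par_ref G) (\<lambda>\<zeta>. ennreal (posterior_density G i t h \<zeta>))"


section \<open>Strategies, objectives and equilibria\<close>

definition strategies ::
    "('n, 'a::euclidean_space, 'b::euclidean_space, 'z) bgame \<Rightarrow> ('n \<Rightarrow> 'b \<Rightarrow> 'a) set" where
  "strategies G =
     {f. \<forall>j. f j \<in> restrict_space borel (type_set G j) \<rightarrow>\<^sub>M restrict_space borel (act_set G j)}"

definition strat_norm ::
    "('n::finite, 'a::euclidean_space, 'b, 'z) bgame \<Rightarrow> ('n \<Rightarrow> 'b \<Rightarrow> 'a) \<Rightarrow> real" where
  "strat_norm G f = (MAX i. SUP x\<in>type_set G i. norm (f i x))"

text \<open>The loss \<open>C\<^sub>f\<close> of player \<open>i\<close> of type \<open>x\<close> playing \<open>a\<close>, as a function of the rivals' types;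
  the component \<open>f i\<close> is irrelevant, so quantifying over \<open>f\<close> amounts to quantifying over the
  rivals' strategies.\<close>

definition game_loss ::
    "('n, 'a, 'b, 'z) bgame \<Rightarrow> 'n \<Rightarrow> ('n \<Rightarrow> 'b \<Rightarrow> 'a) \<Rightarrow> 'b \<Rightarrow> 'a \<Rightarrow> ('n \<Rightarrow> 'b) \<Rightarrow> real" where
  "game_loss G i f x a \<xi> = cost G i ((\<lambda>j. f j (\<xi> j))(i := a)) (\<xi>(i := x))"

definition vbp ::
    "('n, 'a, 'b, 'z) bgame \<Rightarrow> (real measure \<Rightarrow> real) \<Rightarrow> 'n \<Rightarrow> ('n \<Rightarrow> 'b) measure \<Rightarrow>
     'a \<Rightarrow> ('n \<Rightarrow> 'b \<Rightarrow> 'a) \<Rightarrow> 'b \<Rightarrow> real" where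
  "vbp G \<phi> i P a f x = risk \<phi> P (game_loss G i f x a)"

definition grad_vbp ::
    "('n, 'a::euclidean_space, 'b, 'z) bgame \<Rightarrow> (real measure \<Rightarrow> real) \<Rightarrow> 'n \<Rightarrow>
     ('n \<Rightarrow> 'b) measure \<Rightarrow> 'a \<Rightarrow> ('n \<Rightarrow> 'b \<Rightarrow> 'a) \<Rightarrow> 'b \<Rightarrow> 'a" where
  "grad_vbp G \<phi> i P a f x = grad_on (act_set G i) (\<lambda>y. vbp G \<phi> i P y f x) a"

text \<open>\<open>P i x\<close> is the conditional distribution of the rivals' types used by player \<open>i\<close> of type \<open>x\<close>.\<close>

definition is_bne ::
    "('n, 'a::euclidean_space, 'b::euclidean_space, 'z) bgame \<Rightarrow> (real measure \<Rightarrow> real) \<Rightarrow>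
     ('n \<Rightarrow> 'b \<Rightarrow> ('n \<Rightarrow> 'b) measure) \<Rightarrow> ('n \<Rightarrow> 'b \<Rightarrow> 'a) \<Rightarrow> bool" where
  "is_bne G \<phi> P f \<longleftrightarrow> f \<in> strategies G \<and>
     (\<forall>i. \<forall>x\<in>type_set G i.
        is_arg_min (\<lambda>a. vbp G \<phi> i (P i x) a f x) (\<lambda>a. a \<in> act_set G i) (f i x))"


section \<open>Hypotheses on the loss\<close>

definition strongly_convex_loss ::
    "('n::finite, 'a::euclidean_space, 'b, 'z) bgame \<Rightarrow> ('n \<Rightarrow> real) \<Rightarrow> bool" where
  "strongly_convex_loss G M \<longleftrightarrow>
     (\<forall>i. 0 < M i \<and>
       (\<forall>a\<in>act_profiles G. \<forall>\<theta>\<in>type_profiles G. \<forall>x\<in>act_set G i. \<forall>y\<in>act_set G i. \<forall>s\<in>{0..1}.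
          cost G i (a(i := s *\<^sub>R x + (1 - s) *\<^sub>R y)) \<theta>
            \<le> s * cost G i (a(i := x)) \<theta> + (1 - s) * cost G i (a(i := y)) \<theta>
               - M i / 2 * s * (1 - s) * (norm (x - y))\<^sup>2))"

definition lipschitz_in_rivals ::
    "('n::finite, 'a::euclidean_space, 'b, 'z) bgame \<Rightarrow> ('n \<Rightarrow> 'n \<Rightarrow> real) \<Rightarrow> ('n \<Rightarrow> 'n \<Rightarrow> real) \<Rightarrow>
     bool" where
  "lipschitz_in_rivals G L0 L1 \<longleftrightarrow>
     (\<forall>i. (\<forall>j. j \<noteq> i \<longrightarrow> 0 \<le> L0 i j \<and> 0 \<le> L1 i j) \<and>
       (\<forall>a\<in>act_profiles G. \<forall>a'\<in>act_profiles G. \<forall>\<theta>\<in>type_profiles G. a' i = a i \<longrightarrow>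
          \<bar>cost G i a' \<theta> - cost G i a \<theta>\<bar> \<le> (\<Sum>j\<in>- {i}. L0 i j * norm (a' j - a j)) \<and>
          norm (own_grad G i a' \<theta> - own_grad G i a \<theta>) \<le> (\<Sum>j\<in>- {i}. L1 i j * norm (a' j - a j))))"

definition Gamma_bp ::
    "('n \<Rightarrow> real) \<Rightarrow> ('n \<Rightarrow> 'n \<Rightarrow> real) \<Rightarrow> ('n \<Rightarrow> 'n \<Rightarrow> real) \<Rightarrow> ('n \<Rightarrow> real) \<Rightarrow> ('n \<Rightarrow> real) \<Rightarrow>
     real^'n^'n" where
  "Gamma_bp M L0 L1 \<kappa>0 \<kappa>1 =
     (\<chi> i j. (if j = i then 0 else \<kappa>1 i * L1 i j + \<kappa>0 i * L0 i j) / M i)"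


section \<open>Hypotheses on a player's belief\<close>

definition predictive_positive ::
    "('n, 'a, 'b::euclidean_space, 'z) bgame \<Rightarrow> 'n \<Rightarrow> 'z measure \<Rightarrow> bool" where
  "predictive_positive G i \<mu> \<longleftrightarrow> 0 < (INF x\<in>type_set G i. \<integral>\<zeta>. pmarg G i x \<zeta> \<partial>\<mu>)"

definition risk_gradient_lipschitz ::
    "('n, 'a::euclidean_space, 'b::euclidean_space, 'z) bgame \<Rightarrow> (real measure \<Rightarrow> real) \<Rightarrow>
     real \<Rightarrow> real \<Rightarrow> 'n \<Rightarrow> 'z measure \<Rightarrow> bool" where
  "risk_gradient_lipschitz G \<phi> k0 k1 i \<mu> \<longleftrightarrow>
     (\<forall>f\<in>strategies G. \<forall>f'\<in>strategies G. \<forall>a\<in>act_set G i. \<forall>x\<in>type_set G i.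
        norm (grad_vbp G \<phi> i (nu_cond G i \<mu> x) a f x - grad_vbp G \<phi> i (nu_cond G i \<mu> x) a f' x)
          \<le> k1 * (SUP \<xi>\<in>space (rival_ref G i).
                    norm (grad_on (act_set G i) (\<lambda>y. game_loss G i f x y \<xi>) a
                          - grad_on (act_set G i) (\<lambda>y. game_loss G i f' x y \<xi>) a))
            + k0 * (SUP \<xi>\<in>space (rival_ref G i).
                    \<bar>game_loss G i f x a \<xi> - game_loss G i f' x a \<xi>\<bar>))"

definition weights_controlled ::
    "('n, 'a::euclidean_space, 'b::euclidean_space, 'z) bgame \<Rightarrow>
     (('n \<Rightarrow> 'b) measure \<Rightarrow> ('a \<Rightarrow> ('n \<Rightarrow> 'b) \<Rightarrow> real) \<Rightarrow> 'a \<Rightarrow> ('n \<Rightarrow> 'b) \<Rightarrow> real) \<Rightarrow>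
     real \<Rightarrow> real \<Rightarrow> 'n \<Rightarrow> 'z measure \<Rightarrow> bool" where
  "weights_controlled G W wbar lam i \<mu> \<longleftrightarrow>
     (\<forall>f\<in>strategies G. \<forall>a\<in>act_set G i. \<forall>x\<in>type_set G i.
        (\<forall>\<xi>\<in>space (rival_ref G i).
           0 \<le> W (nu_cond G i \<mu> x) (game_loss G i f x) a \<xi> \<and>
           W (nu_cond G i \<mu> x) (game_loss G i f x) a \<xi> \<le> wbar) \<and>
        (0 < pmarg G i x (truth G) \<longrightarrow>
           (\<integral>\<xi>. \<bar>W (nu_cond G i \<mu> x) (game_loss G i f x) a \<xi>
                 - W (eta_cond G i (truth G) x) (game_loss G i f x) a \<xi>\<bar> \<partial>eta_cond G i (truth G) x)
             \<le> lam * d_TV (nu_cond G i \<mu> x) (eta_cond G i (truth G) x)))"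

text \<open>The three parts of the hypotheses that concern the belief \<open>\<mu>\<close> in the role of the posterior.\<close>

definition regular_belief ::
    "('n, 'a::euclidean_space, 'b::euclidean_space, 'z) bgame \<Rightarrow> (real measure \<Rightarrow> real) \<Rightarrow>
     (('n \<Rightarrow> 'b) measure \<Rightarrow> ('a \<Rightarrow> ('n \<Rightarrow> 'b) \<Rightarrow> real) \<Rightarrow> 'a \<Rightarrow> ('n \<Rightarrow> 'b) \<Rightarrow> real) \<Rightarrow>
     real \<Rightarrow> real \<Rightarrow> real \<Rightarrow> real \<Rightarrow> 'n \<Rightarrow> 'z measure \<Rightarrow> bool" where
  "regular_belief G \<phi> W k0 k1 wbar lam i \<mu> \<longleftrightarrow>
     predictive_positive G i \<mu> \<and> risk_gradient_lipschitz G \<phi> k0 k1 i \<mu> \<and>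
     weights_controlled G W wbar lam i \<mu>"


section \<open>Hypotheses for the convergence rate\<close>

definition posterior_contracts ::
    "('n, 'a, 'b::euclidean_space, 'z::euclidean_space) bgame \<Rightarrow> 'n \<Rightarrow> bool" where
  "posterior_contracts G i \<longleftrightarrow>
     (\<forall>\<epsilon>\<in>{0<..<1}. \<exists>c1>0. \<exists>c2>0. \<exists>T\<ge>2. \<forall>t>T.
        prob_at_least (history_measure G t)
          (\<lambda>h. (\<integral>\<^sup>+\<zeta>. ennreal ((norm (\<zeta> - truth G))\<^sup>2) \<partial>posterior G i t h)
                 \<le> ennreal (c2 * (real t - 1) powr (- c1))) (1 - \<epsilon>))"

definition conditional_lipschitz ::
    "('n, 'a, 'b::euclidean_space, 'z::euclidean_space) bgame \<Rightarrow> real \<Rightarrow> real \<Rightarrow> real \<Rightarrow> 'n \<Rightarrow> bool"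
  where
  "conditional_lipschitz G L r e i \<longleftrightarrow> 0 < L \<and> 0 < r \<and> r \<le> 2 \<and> 0 < e \<and>
     (\<forall>x\<in>type_set G i. \<forall>\<zeta>\<in>ball (truth G) e \<inter> par_set G. 0 < pmarg G i x \<zeta> \<longrightarrow>
        d_TV (eta_cond G i \<zeta> x) (eta_cond G i (truth G) x) \<le> L * norm (\<zeta> - truth G) powr r)"

text \<open>The marginal densities near the truth have to be positive for their logarithm to make sense
  (\<open>ln 0 = 0\<close> in HOL).\<close>

definition marginal_log_lipschitz ::
    "('n, 'a, 'b::euclidean_space, 'z::euclidean_space) bgame \<Rightarrow> real \<Rightarrow> real \<Rightarrow> real \<Rightarrow> 'n \<Rightarrow> bool"
  where
  "marginal_log_lipschitz G L d lbar i \<longleftrightarrow> 0 < L \<and> 0 < d \<and>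
     (\<forall>x\<in>type_set G i. 0 < pmarg G i x (truth G) \<and>
        (\<forall>\<zeta>\<in>ball (truth G) d \<inter> par_set G. 0 < pmarg G i x \<zeta> \<and>
           \<bar>ln (pmarg G i x \<zeta>) - ln (pmarg G i x (truth G))\<bar> \<le> L * norm (\<zeta> - truth G)) \<and>
        (\<forall>\<zeta>\<in>par_set G. pmarg G i x \<zeta> / pmarg G i x (truth G) < lbar))"

end

theory Submission
  imports Defs
begin

text \<open>Gradient regularity turns every gradient of the robust objective into a weighted expectation of
  \<open>\<nabla>c\<close>, so (i) is a total variation estimate. For (ii), convexity, monotonicity and cash invariance
  make the robust objective inherit strong convexity from the loss; comparing the first-order
  conditions of the two equilibria shows that the vector \<open>e\<close> of sup-distances satisfies
  \<open>e \<le> \<Gamma> e + d\<close>. Here \<open>\<Gamma>\<close> is nonnegative of spectral radius below one, which yields a positive vector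
  \<open>x\<close> with \<open>\<Gamma> x < x\<close>, and a maximum principle relative to \<open>x\<close> gives \<open>e \<le> (1 - \<Gamma>)\<^sup>-\<^sup>1 d\<close>. The argument uses
  the gradient Lipschitz condition for only one of the two beliefs; for (iii) this is the posterior,
  the other being the truth. It remains to bound the total variation distance of the predictive
  conditional, a reweighted mixture of the conditionals \<open>\<eta>(\<cdot> | x; \<zeta>)\<close>, by the second moment of the posterior.\<close>

section \<open>Gradients within a convex set\<close>

text \<open>Action sets may have empty interior, so first-order arguments have to run along segments
  inside the set. Several notions have default values that must be excluded before an inequality can
  be read off: real suprema of unbounded families, integrals of non-integrable functions, division
  by zero in the posterior. For the posterior, positivity of the predictive marginal does this. The
  constants of (iii) are fixed after the estimate. With v the bound on the second moment and e the
  radius of the conditional Lipschitz condition, the estimate gives a constant times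
  \<open>4 * L * v powr (r / 2) + 2 * v / e^2\<close>, which does not have the shape of the claimed
  D. All data but t are fixed, so a large enough \<open>c2\<close> absorbs the ratio of the two
  constants, once both terms decay at least as fast as the claimed power of \<open>t - 1\<close>.
  For the term linear in v this follows from \<open>r \<le> 2\<close>.\<close>

lemma convex_segment_point:
  assumes "convex S" "x \<in> S" "y \<in> S" "0 \<le> s" "s \<le> 1"
  shows "x + s *\<^sub>R (y - x) \<in> S"
proof -
  have "x + s *\<^sub>R (y - x) = (1 - s) *\<^sub>R x + s *\<^sub>R y" by (simp add: algebra_simps)
  then show ?thesis using assms by (auto intro!: convexD)
qed

text \<open>The derivative part of \<open>has_grad_on\<close> enters later arguments only through
  this one-sided limit along a segment of S, which also makes sense at boundary points.\<close>

lemma has_grad_on_directional: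
  assumes S: "convex S" "x \<in> S" "y \<in> S" and g: "has_grad_on S f g x"
  shows "((\<lambda>s. (f (x + s *\<^sub>R (y - x)) - f x) / s) \<longlongrightarrow> g \<bullet> (y - x)) (at_right 0)"
proof -
  have seg: "(\<lambda>s. x + s *\<^sub>R (y - x)) ` {0..1} \<subseteq> S"
    using convex_segment_point[OF S] by auto
  have "((\<lambda>s. x + s *\<^sub>R (y - x)) has_derivative (\<lambda>s. s *\<^sub>R (y - x))) (at 0 within {0..1})"
    by (auto intro!: derivative_eq_intros)
  moreover have "(f has_derivative (\<lambda>h. g \<bullet> h))
      (at (x + 0 *\<^sub>R (y - x)) within (\<lambda>s. x + s *\<^sub>R (y - x)) ` {0..1})"
    using g seg by (auto simp: has_grad_on_def intro: has_derivative_subset)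
  ultimately have "((\<lambda>s. f (x + s *\<^sub>R (y - x))) has_derivative (\<lambda>s. g \<bullet> (s *\<^sub>R (y - x))))
      (at 0 within {0..1})"
    by (rule has_derivative_in_compose)
  then have "((\<lambda>s. f (x + s *\<^sub>R (y - x))) has_field_derivative (g \<bullet> (y - x))) (at 0 within {0..1})"
    by (rule has_derivative_imp_has_field_derivative) simp
  then show ?thesis
    by (simp add: has_field_derivative_iff at_within_Icc_at_right)
qed

lemma inner_zero_on_span:
  assumes "\<And>y. y \<in> B \<Longrightarrow> g \<bullet> y = 0" "z \<in> span B"
  shows "g \<bullet> z = 0"
  using assms(2)
  by (induction rule: span_induct_alt) (auto simp: inner_add_right assms(1))

text \<open>Two candidates have the same inner product with each \<open>y - x\<close>, hence with
  each \<open>y - z = (y - x) - (z - x)\<close>. Their difference is thus orthogonal to the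
  direction space, in which it lies itself.\<close>

lemma has_grad_on_unique:
  assumes S: "convex S" "x \<in> S" and g: "has_grad_on S f g x" "has_grad_on S f g' x"
  shows "g = g'"
proof -
  have eq: "(g - g') \<bullet> (y - x) = 0" if "y \<in> S" for y
    using tendsto_unique[OF _ has_grad_on_directional[OF S that g(1)]
        has_grad_on_directional[OF S that g(2)]]
    by (simp add: inner_diff_left)
  have "(g - g') \<bullet> d = 0" if "d \<in> span {y - z |y z. y \<in> S \<and> z \<in> S}" for d
  proof (rule inner_zero_on_span[OF _ that])
    fix d assume "d \<in> {y - z |y z. y \<in> S \<and> z \<in> S}"
    then obtain y z where "d = (y - x) - (z - x)" "y \<in> S" "z \<in> S" by auto
    then show "(g - g') \<bullet> d = 0"
      using eq[of y] eq[of z] by (simp add: inner_diff_right)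
  qed
  moreover have "g - g' \<in> span {y - z |y z. y \<in> S \<and> z \<in> S}"
    using g by (auto simp: has_grad_on_def intro: span_diff)
  ultimately have "(g - g') \<bullet> (g - g') = 0" by blast
  then show ?thesis by simp
qed

lemma grad_on_eq:
  assumes "convex S" "x \<in> S" "has_grad_on S f g x"
  shows "grad_on S f x = g"
  unfolding grad_on_def using assms has_grad_on_unique by (intro the_equality) blast+

lemma has_grad_on_grad_on:
  assumes "convex S" "x \<in> S" "\<exists>g. has_grad_on S f g x"
  shows "has_grad_on S f (grad_on S f x) x"
  using assms(3) grad_on_eq[OF assms(1,2)] by force

lemma eventually_at_right_0I:
  assumes "\<And>s::real. 0 < s \<Longrightarrow> s \<le> 1 \<Longrightarrow> P s"
  shows "eventually P (at_right 0)"
  using assms by (auto simp: eventually_at_right_field intro!: exI[of _ 1])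

text \<open>The minimiser may lie on the boundary, so the first-order condition is a variational
  inequality: difference quotients into S are nonnegative, and so is their limit.\<close>

lemma grad_on_arg_min_ge_0:
  assumes S: "convex S" "x \<in> S" "y \<in> S" and g: "has_grad_on S f g x"
    and min: "is_arg_min f (\<lambda>a. a \<in> S) x"
  shows "0 \<le> g \<bullet> (y - x)"
proof (rule tendsto_lowerbound[OF has_grad_on_directional[OF S g]])
  show "\<forall>\<^sub>F s in at_right 0. 0 \<le> (f (x + s *\<^sub>R (y - x)) - f x) / s"
  proof (rule eventually_at_right_0I)
    fix s :: real assume s: "0 < s" "s \<le> 1"
    have "x + s *\<^sub>R (y - x) \<in> S" using s by (intro convex_segment_point S) auto
    then have "f x \<le> f (x + s *\<^sub>R (y - x))" using min by (force simp: is_arg_min_def)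
    then show "0 \<le> (f (x + s *\<^sub>R (y - x)) - f x) / s" using s by simp
  qed
qed simp

text \<open>Dividing the convexity inequality by s leaves the factor \<open>1 - s\<close> at the
  quadratic term; as s tends to 0 the full modulus \<open>m / 2\<close> remains.\<close>

lemma strongly_convex_first_order:
  assumes S: "convex S" "x \<in> S" "y \<in> S" and g: "has_grad_on S f g x"
    and sc: "\<And>s. s \<in> {0..1} \<Longrightarrow> f (s *\<^sub>R y + (1 - s) *\<^sub>R x)
              \<le> s * f y + (1 - s) * f x - m / 2 * s * (1 - s) * (norm (y - x))\<^sup>2"
  shows "g \<bullet> (y - x) \<le> f y - f x - m / 2 * (norm (y - x))\<^sup>2"
proof (rule tendsto_le[OF _ _ has_grad_on_directional[OF S g]])
  have "((\<lambda>s. f y - f x - m / 2 * (1 - s) * (norm (y - x))\<^sup>2) \<longlongrightarrow>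
      f y - f x - m / 2 * (1 - 0) * (norm (y - x))\<^sup>2) (at_right 0)"
    by (intro tendsto_intros)
  then show "((\<lambda>s. f y - f x - m / 2 * (1 - s) * (norm (y - x))\<^sup>2) \<longlongrightarrow>
      f y - f x - m / 2 * (norm (y - x))\<^sup>2) (at_right 0)" by simp
  show "\<forall>\<^sub>F s in at_right 0. (f (x + s *\<^sub>R (y - x)) - f x) / s
      \<le> f y - f x - m / 2 * (1 - s) * (norm (y - x))\<^sup>2"
  proof (rule eventually_at_right_0I)
    fix s :: real assume s: "0 < s" "s \<le> 1"
    have "x + s *\<^sub>R (y - x) = s *\<^sub>R y + (1 - s) *\<^sub>R x" by (simp add: algebra_simps)
    then have "f (x + s *\<^sub>R (y - x)) - f x
        \<le> s * (f y - f x - m / 2 * (1 - s) * (norm (y - x))\<^sup>2)"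
      using sc[of s] s by (simp add: algebra_simps)
    then show "(f (x + s *\<^sub>R (y - x)) - f x) / s
        \<le> f y - f x - m / 2 * (1 - s) * (norm (y - x))\<^sup>2"
      using s by (simp add: pos_divide_le_eq mult.commute)
  qed
qed simp

text \<open>In the sum of the first-order inequalities at x and at y the values of f cancel, and
  each contributes half of the modulus.\<close>

lemma strongly_convex_imp_strongly_monotone:
  assumes S: "convex S" "x \<in> S" "y \<in> S"
    and g: "has_grad_on S f g x" "has_grad_on S f g' y"
    and sc: "\<And>u v s. u \<in> S \<Longrightarrow> v \<in> S \<Longrightarrow> s \<in> {0..1} \<Longrightarrow> f (s *\<^sub>R u + (1 - s) *\<^sub>R v)
              \<le> s * f u + (1 - s) * f v - m / 2 * s * (1 - s) * (norm (u - v))\<^sup>2"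
  shows "m * (norm (x - y))\<^sup>2 \<le> (g - g') \<bullet> (x - y)"
proof -
  have "g \<bullet> (y - x) \<le> f y - f x - m / 2 * (norm (y - x))\<^sup>2"
    using S sc by (intro strongly_convex_first_order[OF S g(1)]) auto
  moreover have "g' \<bullet> (x - y) \<le> f x - f y - m / 2 * (norm (x - y))\<^sup>2"
    using S sc by (intro strongly_convex_first_order[OF S(1,3,2) g(2)]) auto
  ultimately show ?thesis
    by (simp add: norm_minus_commute inner_diff_left inner_diff_right)
qed

lemma inner_measurable_on_span:
  fixes g :: "'w \<Rightarrow> 'a::euclidean_space"
  assumes "\<And>u. u \<in> B \<Longrightarrow> (\<lambda>w. g w \<bullet> u) \<in> borel_measurable M" "u \<in> span B"
  shows "(\<lambda>w. g w \<bullet> u) \<in> borel_measurable M"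
  using assms(2)
  by (induction rule: span_induct_alt) (auto simp: inner_add_right intro!: borel_measurable_add borel_measurable_times assms(1))

text \<open>The gradient is recovered from its inner products with the directions of \<open>S\<close>, which are
  limits of difference quotients of \<open>l\<close>.\<close>

lemma measurable_grad_on:
  fixes S :: "'a::euclidean_space set"
  assumes S: "convex S" "x \<in> S"
    and l: "\<And>y. y \<in> S \<Longrightarrow> l y \<in> borel_measurable M"
    and g: "\<And>w. w \<in> space M \<Longrightarrow> \<exists>g. has_grad_on S (\<lambda>y. l y w) g x"
  shows "(\<lambda>w. grad_on S (\<lambda>y. l y w) x) \<in> borel_measurable M"
proof -
  let ?g = "\<lambda>w. grad_on S (\<lambda>y. l y w) x"
  define D where "D = {y - z |y z. y \<in> S \<and> z \<in> S}"
  have grad: "has_grad_on S (\<lambda>y. l y w) (?g w) x" if "w \<in> space M" for w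
    by (rule has_grad_on_grad_on[OF S g[OF that]])
  have dir: "(\<lambda>w. ?g w \<bullet> (y - x)) \<in> borel_measurable M" if y: "y \<in> S" for y
  proof (rule borel_measurable_LIMSEQ_metric)
    show "(\<lambda>w. (l (x + (1 / real (Suc n)) *\<^sub>R (y - x)) w - l x w) / (1 / real (Suc n)))
        \<in> borel_measurable M" for n
    proof -
      have "x + (1 / real (Suc n)) *\<^sub>R (y - x) \<in> S"
        by (intro convex_segment_point S y) auto
      then show ?thesis using l S by (intro borel_measurable_divide borel_measurable_diff) auto
    qed
    fix w assume w: "w \<in> space M"
    have "filterlim (\<lambda>n. 1 / real (Suc n)) (at_right 0) sequentially"
      using LIMSEQ_Suc[OF lim_1_over_n] by (auto simp: filterlim_at)
    then show "(\<lambda>n. (l (x + (1 / real (Suc n)) *\<^sub>R (y - x)) w - l x w) / (1 / real (Suc n)))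
        \<longlonglongrightarrow> ?g w \<bullet> (y - x)"
      using filterlim_compose[OF has_grad_on_directional[OF S y grad[OF w]]] by blast
  qed
  have inn: "(\<lambda>w. ?g w \<bullet> u) \<in> borel_measurable M" if "u \<in> span D" for u
  proof (rule inner_measurable_on_span[OF _ that])
    fix u assume "u \<in> D"
    then obtain y z where u: "u = (y - x) - (z - x)" "y \<in> S" "z \<in> S" by (auto simp: D_def)
    then have "(\<lambda>w. ?g w \<bullet> (y - x) - ?g w \<bullet> (z - x)) \<in> borel_measurable M"
      using dir by auto
    then show "(\<lambda>w. ?g w \<bullet> u) \<in> borel_measurable M" by (simp add: u inner_diff_right)
  qed
  \<comment> \<open>An orthonormal basis of the direction space allows the vector to be rebuilt from
    finitely many measurable inner products.\<close>
  obtain B where B: "B \<subseteq> span D" "pairwise orthogonal B" "\<And>b. b \<in> B \<Longrightarrow> norm b = 1"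
      "independent B" "span B = span D"
    using orthonormal_basis_subspace[OF subspace_span, of D] by metis
  have fin: "finite B" using B(4) independent_imp_finite by blast
  have repr: "v = (\<Sum>b\<in>B. (v \<bullet> b) *\<^sub>R b)" if "v \<in> span D" for v
  proof -
    have "(v - (\<Sum>b\<in>B. (v \<bullet> b) *\<^sub>R b)) \<bullet> c = 0" if c: "c \<in> B" for c
    proof -
      have "(\<Sum>b\<in>B. (v \<bullet> b) *\<^sub>R b) \<bullet> c = (\<Sum>b\<in>B. (v \<bullet> b) * (b \<bullet> c))"
        by (simp add: inner_sum_left)
      also have "\<dots> = (\<Sum>b\<in>B. if b = c then v \<bullet> c else 0)"
        using B(2,3) c by (intro sum.cong refl)
          (auto simp: pairwise_def orthogonal_def norm_eq_1)
      also have "\<dots> = v \<bullet> c" using fin c by simp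
      finally show ?thesis by (simp add: inner_diff_left)
    qed
    moreover have "v - (\<Sum>b\<in>B. (v \<bullet> b) *\<^sub>R b) \<in> span B"
      unfolding B(5) using B(1) by (intro span_diff that span_sum span_scale) blast
    ultimately have "(v - (\<Sum>b\<in>B. (v \<bullet> b) *\<^sub>R b)) \<bullet> (v - (\<Sum>b\<in>B. (v \<bullet> b) *\<^sub>R b)) = 0"
      by (rule inner_zero_on_span)
    then show ?thesis by simp
  qed
  have "(\<lambda>w. \<Sum>b\<in>B. (?g w \<bullet> b) *\<^sub>R b) \<in> borel_measurable M"
    using B(1) inn by (intro borel_measurable_sum borel_measurable_scaleR) auto
  moreover have "?g w = (\<Sum>b\<in>B. (?g w \<bullet> b) *\<^sub>R b)" if "w \<in> space M" for w
    using grad[OF that] by (intro repr) (simp add: has_grad_on_def D_def)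
  ultimately show ?thesis by (subst measurable_cong) auto
qed


section \<open>Total variation\<close>

text \<open>Dividing h by B makes it an admissible test function; the 2 undoes the
  \<open>1/2\<close> in \<open>d_TV\<close>. A real \<open>SUP\<close> dominates its members only
  for a bounded family, so the bound 2 on the test values comes before.\<close>

lemma abs_integral_diff_le_d_TV:
  fixes P Q :: "'w measure" and h :: "'w \<Rightarrow> real"
  assumes P: "prob_space P" and Q: "prob_space Q" and sets: "sets P = sets Q"
    and h: "h \<in> borel_measurable P" "\<And>x. x \<in> space P \<Longrightarrow> \<bar>h x\<bar> \<le> B"
  shows "\<bar>(\<integral>x. h x \<partial>P) - (\<integral>x. h x \<partial>Q)\<bar> \<le> 2 * B * d_TV P Q"
proof -
  let ?H = "{h :: 'w \<Rightarrow> real. h \<in> borel_measurable P \<and> (\<forall>x\<in>space P. \<bar>h x\<bar> \<le> 1)}"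
  let ?D = "\<lambda>h::'w \<Rightarrow> real. \<bar>(\<integral>x. h x \<partial>P) - (\<integral>x. h x \<partial>Q)\<bar>"
  have sp: "space P = space Q" using sets by (rule sets_eq_imp_space_eq)
  have le1: "\<bar>\<integral>x. g x \<partial>R\<bar> \<le> 1" if "prob_space R" "\<And>x. x \<in> space R \<Longrightarrow> \<bar>g x\<bar> \<le> 1"
    for g :: "'w \<Rightarrow> real" and R
  proof -
    interpret prob_space R by fact
    have "norm (\<integral>x. g x \<partial>R) \<le> (\<integral>x. norm (g x) \<partial>R)" by (rule integral_norm_bound)
    also have "\<dots> \<le> (\<integral>x. 1 \<partial>R)"
      using that(2) by (intro integral_mono_AE') (auto intro: integrable_const)
    finally show ?thesis by (simp add: prob_space)
  qed
  have bdd: "bdd_above (?D ` ?H)"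
  proof (rule bdd_aboveI2)
    fix g assume "g \<in> ?H"
    then have "\<bar>\<integral>x. g x \<partial>P\<bar> \<le> 1" "\<bar>\<integral>x. g x \<partial>Q\<bar> \<le> 1"
      using le1 P Q sp by auto
    then show "?D g \<le> 2" by linarith
  qed
  have upper: "?D g \<le> 2 * d_TV P Q" if "g \<in> ?H" for g
    using cSUP_upper[OF that bdd] by (simp add: d_TV_def)
  obtain x where x: "x \<in> space P" using prob_space.not_empty[OF P] by blast
  then have "0 \<le> B" using h(2) by force
  then consider "B = 0" | "0 < B" by linarith
  then show ?thesis
  proof cases
    case 1
    then have "(\<integral>x. h x \<partial>P) = 0" "(\<integral>x. h x \<partial>Q) = 0"
      using h(2) sp by (force intro!: integral_eq_zero_AE)+
    then show ?thesis using 1 by simp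
  next
    case 2
    have "?D (\<lambda>x. h x / B) \<le> 2 * d_TV P Q"
      using h 2 by (intro upper) (auto simp: divide_le_eq)
    moreover have "?D (\<lambda>x. h x / B) = ?D h / B"
      using 2 by (simp flip: diff_divide_distrib)
    ultimately show ?thesis using 2 by (simp add: divide_le_eq mult_ac)
  qed
qed

lemma d_TV_nonneg:
  assumes "prob_space P" "prob_space Q" "sets P = sets Q"
  shows "0 \<le> d_TV P Q"
  using abs_integral_diff_le_d_TV[OF assms, of "\<lambda>_. 0" 1] by simp

lemma d_TV_le:
  fixes P Q :: "'w measure"
  assumes "\<And>h::'w \<Rightarrow> real. h \<in> borel_measurable P \<Longrightarrow> (\<And>x. x \<in> space P \<Longrightarrow> \<bar>h x\<bar> \<le> 1) \<Longrightarrow>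
      \<bar>(\<integral>x. h x \<partial>P) - (\<integral>x. h x \<partial>Q)\<bar> \<le> c"
  shows "d_TV P Q \<le> c / 2"
proof -
  have "(SUP h \<in> {h \<in> borel_measurable P. \<forall>x\<in>space P. \<bar>h x\<bar> \<le> 1}.
      \<bar>(\<integral>x. h x \<partial>P) - (\<integral>x. h x \<partial>Q)\<bar>) \<le> c"
    using assms by (intro cSUP_least) (auto intro!: exI[of _ "\<lambda>_. 0"])
  then show ?thesis by (simp add: d_TV_def)
qed

text \<open>The difference v of the two integrals is itself used as the direction: the scalar
  estimate for \<open>g x \<bullet> v\<close> bounds the square of \<open>norm v\<close>, so no
  factor depending on the dimension appears.\<close>

lemma norm_integral_diff_le_d_TV:
  fixes g :: "'w \<Rightarrow> 'a::euclidean_space"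
  assumes P: "prob_space P" and Q: "prob_space Q" and sets: "sets P = sets Q"
    and g: "g \<in> borel_measurable P" "\<And>x. x \<in> space P \<Longrightarrow> norm (g x) \<le> B"
  shows "norm ((\<integral>x. g x \<partial>P) - (\<integral>x. g x \<partial>Q)) \<le> 2 * B * d_TV P Q"
proof -
  interpret P: prob_space P by fact
  interpret Q: prob_space Q by fact
  define v where "v = (\<integral>x. g x \<partial>P) - (\<integral>x. g x \<partial>Q)"
  have sp: "space P = space Q" using sets by (rule sets_eq_imp_space_eq)
  have int: "integrable P g" "integrable Q g"
    using g sp measurable_cong_sets[OF sets refl]
    by (auto intro!: P.integrable_const_bound[of _ B] Q.integrable_const_bound[of _ B])
  have "v \<bullet> v = (\<integral>x. g x \<bullet> v \<partial>P) - (\<integral>x. g x \<bullet> v \<partial>Q)"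
    using int by (simp add: v_def inner_diff_left integral_inner_left)
  also have "\<dots> \<le> 2 * (B * norm v) * d_TV P Q"
  proof -
    have "\<bar>g x \<bullet> v\<bar> \<le> B * norm v" if "x \<in> space P" for x
      using Cauchy_Schwarz_ineq2[of "g x" v] g(2)[OF that]
      by (meson mult_right_mono norm_ge_zero order_trans)
    then show ?thesis
      using abs_integral_diff_le_d_TV[OF P Q sets, of "\<lambda>x. g x \<bullet> v" "B * norm v"] g(1)
      by (auto simp: abs_le_iff)
  qed
  finally have "norm v * norm v \<le> (2 * B * d_TV P Q) * norm v"
    by (simp add: power2_norm_eq_inner[symmetric] power2_eq_square mult_ac)
  moreover have "0 \<le> 2 * B * d_TV P Q"
  proof -
    obtain x where "x \<in> space P" using P.not_empty by blast
    then have "0 \<le> B" using g(2) norm_ge_zero order_trans by blast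
    then show ?thesis using d_TV_nonneg[OF P Q sets] by simp
  qed
  ultimately have "norm v \<le> 2 * B * d_TV P Q"
    by (cases "norm v = 0") (simp_all add: mult_le_cancel_right)
  then show ?thesis by (simp add: v_def)
qed


section \<open>Nonnegative matrices of spectral radius below one\<close>

lemma finite_type_obtain_max:
  fixes f :: "'n::finite \<Rightarrow> 'a::linorder"
  obtains i where "\<And>j. f j \<le> f i"
proof -
  have "Max (range f) \<in> range f" by (rule Max_in) auto
  then obtain i where "f i = Max (range f)" by (metis imageE)
  then have "f j \<le> f i" for j by simp
  then show thesis by (rule that)
qed

text \<open>A real eigenvector is also a complex one, but membership in the set is not enough: its
  supremum is informative only if the moduli are bounded. Reading the eigenvalue equation at a
  component of maximal modulus bounds them by row sums.\<close>

lemma real_eigenvalue_le_spectral_radius: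
  fixes A :: "real^'n^'n"
  assumes v: "v \<noteq> 0" "A *v v = l *s v"
  shows "\<bar>l\<bar> \<le> spectral_radius A"
proof -
  let ?A = "(\<chi> i j. complex_of_real (A $ i $ j)) :: complex^'n^'n"
  let ?S = "{cmod l |l. \<exists>v::complex^'n. v \<noteq> 0 \<and> ?A *v v = l *s v}"
  have "bdd_above ?S"
  proof (rule bdd_aboveI)
    fix x assume "x \<in> ?S"
    then obtain l and w :: "complex^'n" where x: "x = cmod l" and w: "w \<noteq> 0" "?A *v w = l *s w"
      by auto
    obtain i where i: "\<And>j. cmod (w $ j) \<le> cmod (w $ i)"
      using finite_type_obtain_max[of "\<lambda>j. cmod (w $ j)"] by blast
    have pos: "0 < cmod (w $ i)"
    proof -
      obtain k where "w $ k \<noteq> 0" using w(1) by (auto simp: vec_eq_iff)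
      then show ?thesis using i[of k] by (metis less_le_trans zero_less_norm_iff)
    qed
    have "cmod l * cmod (w $ i) = cmod (\<Sum>j\<in>UNIV. complex_of_real (A $ i $ j) * w $ j)"
      using arg_cong[OF w(2), of "\<lambda>u. cmod (u $ i)"] by (simp add: matrix_vector_mult_def norm_mult)
    also have "\<dots> \<le> (\<Sum>j\<in>UNIV. \<bar>A $ i $ j\<bar> * cmod (w $ j))"
      by (rule order_trans[OF norm_sum]) (simp add: norm_mult)
    also have "\<dots> \<le> (\<Sum>j\<in>UNIV. \<bar>A $ i $ j\<bar> * cmod (w $ i))"
      by (intro sum_mono mult_left_mono i) auto
    also have "\<dots> = (\<Sum>j\<in>UNIV. \<bar>A $ i $ j\<bar>) * cmod (w $ i)"
      by (simp add: sum_distrib_right)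
    finally have "cmod l \<le> (\<Sum>j\<in>UNIV. \<bar>A $ i $ j\<bar>)" using pos by simp
    also have "\<dots> \<le> (\<Sum>i\<in>UNIV. \<Sum>j\<in>UNIV. \<bar>A $ i $ j\<bar>)"
      by (rule member_le_sum[where f="\<lambda>i. \<Sum>j\<in>UNIV. \<bar>A $ i $ j\<bar>"]) (auto intro: sum_nonneg)
    finally show "x \<le> (\<Sum>i\<in>UNIV. \<Sum>j\<in>UNIV. \<bar>A $ i $ j\<bar>)" by (simp add: x)
  qed
  moreover have "\<bar>l\<bar> \<in> ?S"
  proof -
    let ?v = "(\<chi> i. complex_of_real (v $ i)) :: complex^'n"
    have "?v \<noteq> 0" using v(1) by (auto simp: vec_eq_iff)
    moreover have "?A *v ?v = complex_of_real l *s ?v"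
    proof (subst vec_eq_iff, rule allI)
      fix i
      have "(\<Sum>j\<in>UNIV. A $ i $ j * v $ j) = l * v $ i"
        using arg_cong[OF v(2), of "\<lambda>u. u $ i"] by (simp add: matrix_vector_mult_def)
      then have "complex_of_real (\<Sum>j\<in>UNIV. A $ i $ j * v $ j) = complex_of_real (l * v $ i)"
        by (rule arg_cong)
      then show "(?A *v ?v) $ i = (complex_of_real l *s ?v) $ i"
        by (simp add: matrix_vector_mult_def)
    qed
    ultimately show ?thesis by (auto intro!: exI[of _ "complex_of_real l"])
  qed
  ultimately show ?thesis unfolding spectral_radius_def by (intro cSup_upper)
qed

lemma matrix_vector_mult_nth:
  "(A *v v) $ i = (\<Sum>j\<in>UNIV. A $ i $ j * v $ j)"
  by (simp add: matrix_vector_mult_def)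

lemma continuous_on_det:
  fixes B :: "'a::topological_space \<Rightarrow> real^'n^'n"
  assumes "\<And>i j. continuous_on S (\<lambda>s. B s $ i $ j)"
  shows "continuous_on S (\<lambda>s. det (B s))"
  unfolding det_def by (intro continuous_on_sum continuous_on_mult continuous_on_prod continuous_on_const assms)

lemma matrix_inv_right:
  assumes "invertible A"
  shows "A ** matrix_inv A = mat 1"
  using someI_ex[OF assms[unfolded invertible_def]] by (simp add: matrix_inv_def)

locale contraction_matrix =
  fixes A :: "real^'n^'n"
  assumes nonneg: "\<And>i j. 0 \<le> A $ i $ j"
    and radius: "spectral_radius A < 1"
begin

text \<open>This is the matrix whose inverse is usually called the resolvent; s joins the identity
  to \<open>1 - A\<close>.\<close>

abbreviation resolvent :: "real \<Rightarrow> real^'n^'n" where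
  "resolvent s \<equiv> mat 1 - s *\<^sub>R A"

lemma resolvent_mult: "(resolvent s *v v) $ i = v $ i - s * (A *v v) $ i"
  by (simp add: matrix_vector_mult_diff_rdistrib scaleR_matrix_vector_assoc[symmetric])

text \<open>A kernel vector would be an eigenvector of A for the real eigenvalue
  \<open>1 / s \<ge> 1\<close>, beyond the spectral radius.\<close>

lemma det_resolvent:
  assumes s: "0 \<le> s" "s \<le> 1"
  shows "det (resolvent s) \<noteq> 0"
proof
  assume "det (resolvent s) = 0"
  then obtain v where v: "v \<noteq> 0" "resolvent s *v v = 0"
    using invertible_det_nz[of "resolvent s"] matrix_left_invertible_ker[of "resolvent s"]
      invertible_left_inverse by blast
  then have eq: "v $ i = s * (A *v v) $ i" for i
    using resolvent_mult[of s v i] by simp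
  then have "s \<noteq> 0" using v(1) by (auto simp: vec_eq_iff)
  then have "A *v v = (1 / s) *s v" using eq by (simp add: vec_eq_iff field_simps)
  then have "\<bar>1 / s\<bar> < 1" using real_eigenvalue_le_spectral_radius[OF v(1)] radius by fastforce
  then show False using s \<open>s \<noteq> 0\<close> by simp
qed

text \<open>The solution of \<open>x = 1 + s A x\<close> is continuous in \<open>s\<close> and positive at \<open>s = 0\<close>; at the first
  \<open>s\<close> where a component vanished this component would be at least \<open>1\<close>.\<close>

lemma ex_positive_subeigenvector:
  obtains x :: "real^'n" where "\<And>i. 0 < x $ i" "\<And>i. (A *v x) $ i < x $ i"
proof -
  \<comment> \<open>Cramer's rule for the right-hand side with all entries 1. The explicit quotient
    reduces continuity in s to that of determinants.\<close>
  define x where "x s = (\<chi> k. det (\<chi> i j. if j = k then (\<chi> i. 1) $ i else resolvent s $ i $ j)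
      / det (resolvent s))" for s :: real
  have sol: "x s $ i = 1 + s * (A *v x s) $ i" if "0 \<le> s" "s \<le> 1" for s i
  proof -
    have "resolvent s *v x s = (\<chi> i. 1)"
      using cramer[OF det_resolvent[OF that], of "x s" "\<chi> i. 1"] by (simp add: x_def)
    then have "(resolvent s *v x s) $ i = 1" by simp
    then show ?thesis unfolding resolvent_mult by simp
  qed
  have cont: "continuous_on {0..1} (\<lambda>s. x s $ i)" for i
  proof -
    have entry: "continuous_on {0..1} (\<lambda>s. (resolvent s) $ k $ l)" for k l
      by (simp add: continuous_intros)
    have "continuous_on {0..1} (\<lambda>s. if l = i then (\<chi> i. 1) $ k else (resolvent s) $ k $ l)" for k l
      using entry by (cases "l = i") auto
    then have "continuous_on {0..1} (\<lambda>s. det (\<chi> k l. if l = i then (\<chi> i. 1) $ k else resolvent s $ k $ l)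
        / det (resolvent s))"
      using det_resolvent by (intro continuous_on_divide continuous_on_det entry) auto
    then show ?thesis by (simp add: x_def)
  qed
  have "0 < x s $ i" if s: "0 \<le> s" "s \<le> 1" for s i
  proof -
    let ?m = "\<lambda>s. Min (range (\<lambda>i. x s $ i))"
    have contm: "continuous_on {0..1} ?m"
    proof -
      have "continuous_on {0..1} (\<lambda>s. Min ((\<lambda>i. x s $ i) ` I))" if "finite I" "I \<noteq> {}" for I
        using that
      proof (induction rule: finite_ne_induct)
        case (insert i I)
        then show ?case by (simp add: Min_insert cont continuous_on_min)
      qed (simp add: cont)
      then show ?thesis by simp
    qed
    have mpos: "?m s \<noteq> 0" if "0 \<le> s" "s \<le> 1" for s
    proof
      assume m: "?m s = 0"
      then have ge: "0 \<le> x s $ j" for j using Min_le[of "range (\<lambda>i. x s $ i)" "x s $ j"] by simp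
      have "?m s \<in> range (\<lambda>i. x s $ i)" by (rule Min_in) auto
      then obtain i where "x s $ i = 0" using m by auto
      moreover have "0 \<le> (A *v x s) $ i"
        unfolding matrix_vector_mult_nth by (intro sum_nonneg mult_nonneg_nonneg nonneg ge)
      ultimately show False using sol[OF that, of i] that by (smt (verit) mult_nonneg_nonneg)
    qed
    \<comment> \<open>The minimum of the components is a single continuous function of s, with value
      1 at 0, so the intermediate value theorem turns a nonpositive value into a zero.\<close>
    have "0 < ?m s"
    proof (rule ccontr)
      assume "\<not> 0 < ?m s"
      then have "?m s \<le> 0" by (rule leI)
      moreover have "0 \<le> ?m 0" using sol[of 0] by simp
      moreover have "continuous_on {0..s} ?m" using contm s by (rule_tac continuous_on_subset) auto
      ultimately have "\<exists>u\<ge>0. u \<le> s \<and> ?m u = 0" by (intro IVT2' s(1))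
      then obtain u where "0 \<le> u" "u \<le> s" "?m u = 0" by (elim exE conjE)
      then show False using mpos[of u] s by simp
    qed
    then show ?thesis using Min_le[of "range (\<lambda>i. x s $ i)" "x s $ i"] by simp
  qed
  then have "0 < x 1 $ i" for i by simp
  moreover have "(A *v x 1) $ i < x 1 $ i" for i using sol[of 1 i] by simp
  ultimately show ?thesis by (rule that)
qed

text \<open>If w had a positive component, the smallest multiple \<open>c * x\<close> above w would
  have \<open>c > 0\<close> and touch w at some k. There
  \<open>w \<le> A w \<le> c A x < c x = w\<close>, a contradiction.\<close>

lemma nonpos_if_le_mult:
  assumes "\<And>i. w $ i \<le> (A *v w) $ i"
  shows "w $ i \<le> 0"
proof (rule ccontr)
  assume neg: "\<not> w $ i \<le> 0"
  obtain x :: "real^'n" where x: "\<And>i. 0 < x $ i" "\<And>i. (A *v x) $ i < x $ i"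
    using ex_positive_subeigenvector by blast
  obtain k where k: "\<And>j. w $ j / x $ j \<le> w $ k / x $ k"
    using finite_type_obtain_max[of "\<lambda>j. w $ j / x $ j"] by blast
  define c where "c = w $ k / x $ k"
  have "0 < w $ i / x $ i" using neg x(1)[of i] by simp
  then have c: "0 < c" using k[of i] by (simp add: c_def)
  have le: "w $ j \<le> c * x $ j" for j
    using k[of j] x(1)[of j] by (simp add: c_def pos_divide_le_eq)
  have "w $ k \<le> (\<Sum>j\<in>UNIV. A $ k $ j * w $ j)"
    using assms[of k] by (simp add: matrix_vector_mult_nth)
  also have "\<dots> \<le> (\<Sum>j\<in>UNIV. A $ k $ j * (c * x $ j))"
    by (intro sum_mono mult_left_mono le nonneg)
  also have "\<dots> = c * (A *v x) $ k"
    by (simp add: matrix_vector_mult_nth sum_distrib_left mult_ac)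
  also have "\<dots> < c * x $ k" using c x(2) by simp
  also have "\<dots> = w $ k" using x(1)[of k] by (simp add: c_def)
  finally show False by simp
qed

lemma matrix_inv_solution:
  fixes d :: "real^'n"
  defines "y \<equiv> matrix_inv (mat 1 - A) *v d"
  shows "y $ i = (A *v y) $ i + d $ i"
proof -
  have "invertible (mat 1 - A)" using det_resolvent[of 1] by (simp add: invertible_det_nz)
  then have "(mat 1 - A) *v y = d"
    by (simp add: y_def matrix_vector_mul_assoc matrix_inv_right)
  then show ?thesis using resolvent_mult[of 1 y i] by simp
qed

text \<open>Subtracting the exact solution of \<open>y = A y + d\<close> cancels d, and the
  difference \<open>e - y\<close> falls under the maximum principle.\<close>

lemma le_matrix_inv_mult:
  assumes "\<And>i. e $ i \<le> (A *v e) $ i + d $ i"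
  shows "e $ i \<le> (\<Sum>j\<in>UNIV. matrix_inv (mat 1 - A) $ i $ j * d $ j)"
proof -
  let ?y = "matrix_inv (mat 1 - A) *v d"
  have "(e - ?y) $ i \<le> (A *v (e - ?y)) $ i" for i
    using assms[of i] matrix_inv_solution[of d i] by (simp add: matrix_vector_mult_diff_distrib)
  from nonpos_if_le_mult[OF this] show ?thesis by (simp add: matrix_vector_mult_nth)
qed

end


section \<open>The game\<close>

lemma measurable_lborel_on:
  assumes "B \<subseteq> (Basis :: 'b::euclidean_space set)"
  shows "(\<lambda>x. \<Sum>b\<in>B. x b *\<^sub>R b) \<in> (\<Pi>\<^sub>M b\<in>B. lborel) \<rightarrow>\<^sub>M borel"
proof -
  have "(\<lambda>x. x b) \<in> (\<Pi>\<^sub>M b\<in>B. lborel) \<rightarrow>\<^sub>M borel" if "b \<in> B" for b :: 'b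
    using measurable_component_singleton[OF that, of "\<lambda>_. lborel"] by simp
  then show ?thesis by (intro borel_measurable_sum borel_measurable_scaleR) auto
qed

text \<open>Coordinates are inner products with basis vectors, so the preimage of a bounded set lies
  in a cube. Compact type sets therefore have finite reference measure, as Fubini for the products
  over rivals requires.\<close>

lemma emeasure_lborel_on_bounded:
  fixes B :: "'b::euclidean_space set"
  assumes B: "B \<subseteq> Basis" and K: "bounded K" "K \<in> sets borel"
  shows "emeasure (lborel_on B) K < \<infinity>"
proof -
  interpret product_sigma_finite "\<lambda>_::'b. lborel :: real measure" by standard
  have fin: "finite B" using B finite_Basis by (rule finite_subset)
  obtain R where R: "\<And>x. x \<in> K \<Longrightarrow> norm x \<le> R" using K(1) by (auto simp: bounded_iff)
  let ?f = "\<lambda>x. \<Sum>b\<in>B. x b *\<^sub>R b" and ?P = "\<Pi>\<^sub>M b\<in>B. lborel :: real measure"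
  have "?f -` K \<inter> space ?P \<subseteq> (\<Pi>\<^sub>E b\<in>B. {-R..R})"
  proof
    fix x assume x: "x \<in> ?f -` K \<inter> space ?P"
    have "x b \<in> {-R..R}" if b: "b \<in> B" for b
    proof -
      have "?f x \<bullet> b = (\<Sum>c\<in>B. x c * (c \<bullet> b))" by (simp add: inner_sum_left)
      also have "\<dots> = (\<Sum>c\<in>B. if c = b then x b else 0)"
        using B b by (intro sum.cong refl) (auto simp: inner_Basis subset_iff)
      also have "\<dots> = x b" using fin b by simp
      finally have "\<bar>x b\<bar> \<le> norm (?f x)"
        using Basis_le_norm[of b "?f x"] B b by auto
      then show ?thesis using R[of "?f x"] x by auto
    qed
    then show "x \<in> (\<Pi>\<^sub>E b\<in>B. {-R..R})" using x by (auto simp: space_PiM PiE_def)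
  qed
  then have "emeasure (lborel_on B) K \<le> emeasure ?P (\<Pi>\<^sub>E b\<in>B. {-R..R})"
    unfolding lborel_on_def using K(2) fin
    by (subst emeasure_distr[OF measurable_lborel_on[OF B]]) (auto intro!: emeasure_mono sets_PiM_I_finite)
  also have "\<dots> = (\<Prod>b\<in>B. emeasure lborel {-R..R})"
    by (rule emeasure_PiM[OF fin]) auto
  also have "\<dots> < \<infinity>"
    by (simp add: emeasure_lborel_Icc_eq power_less_top_ennreal)
  finally show ?thesis .
qed

text \<open>Normalisation of \<open>pdens\<close> makes the section at an own type integrable for
  almost every type only. Conditionals and suprema are formed at every type, hence the pointwise
  condition.\<close>

locale bayes_game =
  fixes G :: "('n::finite, 'a::euclidean_space, 'b::euclidean_space, 'z::euclidean_space) bgame"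
  assumes game: "bayesian_game G"
    and integrable_pdens: "\<And>i \<zeta> x. \<zeta> \<in> par_set G \<Longrightarrow> x \<in> type_set G i \<Longrightarrow>
          integrable (rival_ref G i) (\<lambda>\<xi>. pdens G (\<xi>(i := x)) \<zeta>)"
begin

lemma type_set: "type_set G i \<noteq> {}" "compact (type_set G i)"
  and act_set: "act_set G i \<noteq> {}" "compact (act_set G i)" "convex (act_set G i)"
  and type_coords: "type_coords G i \<subseteq> Basis"
  and cost_continuous: "continuous_on (act_profiles G \<times> type_profiles G) (\<lambda>(a, \<theta>). cost G i a \<theta>)"
  and cost_has_grad: "a \<in> act_profiles G \<Longrightarrow> \<theta> \<in> type_profiles G \<Longrightarrow>
        \<exists>g. has_grad_on (act_set G i) (\<lambda>y. cost G i (a(i := y)) \<theta>) g (a i)"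
  and truth_par: "truth G \<in> par_set G"
  and pdens_measurable: "(\<lambda>(\<theta>, \<zeta>). pdens G \<theta> \<zeta>) \<in> borel_measurable (PiM UNIV (type_ref G) \<Otimes>\<^sub>M par_ref G)"
  and pdens_nonneg: "\<zeta> \<in> par_set G \<Longrightarrow> \<theta> \<in> type_profiles G \<Longrightarrow> 0 \<le> pdens G \<theta> \<zeta>"
  and pdens_total: "\<zeta> \<in> par_set G \<Longrightarrow> (\<integral>\<^sup>+\<theta>. ennreal (pdens G \<theta> \<zeta>) \<partial>PiM UNIV (type_ref G)) = 1"
  and prior_measurable: "prior G i \<in> borel_measurable (par_ref G)"
  and prior_nonneg: "\<zeta> \<in> par_set G \<Longrightarrow> 0 \<le> prior G i \<zeta>"
  using game unfolding bayesian_game_def by blast+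

lemma space_type_ref: "space (type_ref G j) = type_set G j"
  by (simp add: type_ref_def space_restrict_space lborel_on_def)

lemma sets_type_ref: "sets (type_ref G j) = sets (restrict_space borel (type_set G j))"
  unfolding type_ref_def by (rule sets_restrict_space_cong) (simp add: lborel_on_def)

lemma space_par_ref: "space (par_ref G) = par_set G"
  by (simp add: par_ref_def space_restrict_space)

lemma space_rival_ref: "space (rival_ref G i) = (\<Pi>\<^sub>E j\<in>- {i}. type_set G j)"
  by (simp add: rival_ref_def space_PiM space_type_ref)

lemma rival_ref_nonempty: "space (rival_ref G i) \<noteq> {}"
  by (simp add: space_rival_ref PiE_eq_empty_iff type_set)

lemma space_profiles: "space (PiM UNIV (type_ref G)) = type_profiles G"
  by (auto simp: space_PiM space_type_ref type_profiles_def PiE_def)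

lemma finite_measure_type_ref: "finite_measure (type_ref G j)"
proof
  have K: "bounded (type_set G j)" "type_set G j \<in> sets borel"
    using type_set(2) by (auto intro: compact_imp_bounded borel_compact)
  then have "emeasure (type_ref G j) (type_set G j) = emeasure (lborel_on (type_coords G j)) (type_set G j)"
    unfolding type_ref_def by (intro emeasure_restrict_space) (auto simp: lborel_on_def)
  then show "emeasure (type_ref G j) (space (type_ref G j)) \<noteq> \<infinity>"
    using emeasure_lborel_on_bounded[OF type_coords[of j] K] by (simp add: space_type_ref)
qed

lemma product_sigma_finite_type_ref: "product_sigma_finite (type_ref G)"
  using finite_measure_type_ref finite_measure.axioms(1) by (auto intro!: product_sigma_finite.intro)

lemma sigma_finite_rival_ref: "sigma_finite_measure (rival_ref G i)"
  unfolding rival_ref_def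
  by (rule product_sigma_finite.sigma_finite[OF product_sigma_finite_type_ref]) simp

lemma rival_update:
  assumes "x \<in> type_set G i" "\<xi> \<in> space (rival_ref G i)"
  shows "\<xi>(i := x) \<in> type_profiles G"
  using assms by (auto simp: space_rival_ref type_profiles_def)

lemma rival_update_measurable:
  assumes "x \<in> type_set G i"
  shows "(\<lambda>\<xi>. \<xi>(i := x)) \<in> rival_ref G i \<rightarrow>\<^sub>M PiM UNIV (type_ref G)"
  unfolding rival_ref_def
  by (rule measurable_fun_upd[where J="- {i}"]) (auto simp: space_type_ref assms)

lemma pdens_update_measurable:
  assumes x: "x \<in> type_set G i" and \<mu>: "sets \<mu> = sets (par_ref G)"
  shows "(\<lambda>(\<xi>, \<zeta>). pdens G (\<xi>(i := x)) \<zeta>) \<in> borel_measurable (rival_ref G i \<Otimes>\<^sub>M \<mu>)"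
proof -
  have "(\<lambda>p. ((fst p)(i := x), snd p)) \<in>
      rival_ref G i \<Otimes>\<^sub>M \<mu> \<rightarrow>\<^sub>M PiM UNIV (type_ref G) \<Otimes>\<^sub>M par_ref G"
    using measurable_compose[OF measurable_fst rival_update_measurable[OF x]]
      measurable_cong_sets[OF refl \<mu>] by (intro measurable_Pair) auto
  from measurable_compose[OF this pdens_measurable] show ?thesis
    by (simp add: case_prod_beta')
qed

lemma pmarg_nonneg: "x \<in> type_set G i \<Longrightarrow> \<zeta> \<in> par_set G \<Longrightarrow> 0 \<le> pmarg G i x \<zeta>"
  unfolding pmarg_def marginal_def
  by (auto intro!: Bochner_Integration.integral_nonneg pdens_nonneg rival_update)

lemma nn_integral_pdens:
  assumes "x \<in> type_set G i" "\<zeta> \<in> par_set G"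
  shows "(\<integral>\<^sup>+\<xi>. ennreal (pdens G (\<xi>(i := x)) \<zeta>) \<partial>rival_ref G i) = ennreal (pmarg G i x \<zeta>)"
  unfolding pmarg_def marginal_def
  using assms by (auto intro!: nn_integral_eq_integral integrable_pdens pdens_nonneg rival_update)

section \<open>Compactness, and the loss as a function of the rivals' types\<close>

lemma act_profiles_compact: "compact (act_profiles G)"
  and type_profiles_compact: "compact (type_profiles G)"
proof -
  have *: "compact (PiE UNIV S)" if "\<And>i. compact (S i)"
    for S :: "'n \<Rightarrow> 'c::topological_space set"
    using that compactin_PiE[of "\<lambda>_. euclidean" UNIV S]
    by (simp add: euclidean_product_topology)
  have "act_profiles G = PiE UNIV (act_set G)" "type_profiles G = PiE UNIV (type_set G)"
    by (auto simp: act_profiles_def type_profiles_def)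
  then show "compact (act_profiles G)" "compact (type_profiles G)"
    using * act_set type_set by metis+
qed

lemma cost_bounded:
  obtains B where "\<And>a \<theta>. a \<in> act_profiles G \<Longrightarrow> \<theta> \<in> type_profiles G \<Longrightarrow> \<bar>cost G i a \<theta>\<bar> \<le> B"
proof -
  have "bounded ((\<lambda>(a, \<theta>). cost G i a \<theta>) ` (act_profiles G \<times> type_profiles G))"
    using cost_continuous act_profiles_compact type_profiles_compact
    by (intro compact_imp_bounded compact_continuous_image compact_Times)
  then show thesis using that by (auto simp: bounded_iff)
qed

lemma strategy_in_act_set:
  assumes "f \<in> strategies G" "x \<in> type_set G j"
  shows "f j x \<in> act_set G j"
  using assms measurable_space[of "f j" "restrict_space borel (type_set G j)"
      "restrict_space borel (act_set G j)" x]
  by (auto simp: strategies_def space_restrict_space)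

lemma strategy_profile:
  assumes "f \<in> strategies G" "a \<in> act_set G i" "\<xi> \<in> space (rival_ref G i)"
  shows "(\<lambda>j. f j (\<xi> j))(i := a) \<in> act_profiles G"
  using assms strategy_in_act_set by (auto simp: act_profiles_def space_rival_ref)

text \<open>The cost is continuous only on the product of the compact sets. The profile is therefore
  mapped measurably into that set, coordinate by coordinate, before the restricted cost is
  applied.\<close>

lemma game_loss_measurable:
  assumes f: "f \<in> strategies G" and x: "x \<in> type_set G i" and a: "a \<in> act_set G i"
  shows "game_loss G i f x a \<in> borel_measurable (rival_ref G i)"
proof -
  let ?R = "rival_ref G i" and ?S = "act_profiles G \<times> type_profiles G"
  have comp: "(\<lambda>\<xi>. \<xi> j) \<in> ?R \<rightarrow>\<^sub>M restrict_space borel (type_set G j)" if "j \<noteq> i" for j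
    using that measurable_component_singleton[of j "- {i}" "type_ref G"]
      measurable_cong_sets[OF refl sets_type_ref, of "PiM (- {i}) (type_ref G)" j]
    by (simp add: rival_ref_def)
  have "(\<lambda>\<xi>. ((\<lambda>j. f j (\<xi> j))(i := a)) j) \<in> borel_measurable ?R" for j
  proof (cases "j = i")
    case False
    then have "(\<lambda>\<xi>. f j (\<xi> j)) \<in> ?R \<rightarrow>\<^sub>M restrict_space borel (act_set G j)"
      using f by (intro measurable_compose[OF comp]) (auto simp: strategies_def)
    then show ?thesis using False by (simp add: measurable_restrict_space2_iff)
  qed simp
  then have 1: "(\<lambda>\<xi>. (\<lambda>j. f j (\<xi> j))(i := a)) \<in> borel_measurable ?R"
    by (rule measurable_coordinatewise_then_product)
  have "(\<lambda>\<xi>. (\<xi>(i := x)) j) \<in> borel_measurable ?R" for j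
    using comp[of j] by (cases "j = i") (auto simp: measurable_restrict_space2_iff)
  then have 2: "(\<lambda>\<xi>. \<xi>(i := x)) \<in> borel_measurable ?R"
    by (rule measurable_coordinatewise_then_product)
  have "(\<lambda>\<xi>. ((\<lambda>j. f j (\<xi> j))(i := a), \<xi>(i := x))) \<in> ?R \<rightarrow>\<^sub>M restrict_space borel ?S"
    using measurable_Pair[OF 1 2] strategy_profile[OF f a] rival_update[OF x]
    by (intro measurable_restrict_space2) (auto simp: borel_prod)
  from measurable_compose[OF this borel_measurable_continuous_on_restrict[OF cost_continuous]]
  show ?thesis by (simp add: game_loss_def[abs_def])
qed

lemma game_loss_bounded:
  obtains B where "\<And>f x a \<xi>. f \<in> strategies G \<Longrightarrow> x \<in> type_set G i \<Longrightarrow> a \<in> act_set G i \<Longrightarrow>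
    \<xi> \<in> space (rival_ref G i) \<Longrightarrow> \<bar>game_loss G i f x a \<xi>\<bar> \<le> B"
  using cost_bounded[of i] strategy_profile rival_update unfolding game_loss_def by metis

lemma game_loss_has_grad:
  assumes "f \<in> strategies G" "x \<in> type_set G i" "a \<in> act_set G i" "\<xi> \<in> space (rival_ref G i)"
  shows "has_grad_on (act_set G i) (\<lambda>y. game_loss G i f x y \<xi>)
    (own_grad G i ((\<lambda>j. f j (\<xi> j))(i := a)) (\<xi>(i := x))) a"
proof -
  have "\<exists>g. has_grad_on (act_set G i) (\<lambda>y. game_loss G i f x y \<xi>) g a"
    using cost_has_grad[OF strategy_profile[OF assms(1,3,4)] rival_update[OF assms(2,4)], of i]
    by (simp add: game_loss_def)
  from has_grad_on_grad_on[OF act_set(3) assms(3) this] show ?thesis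
    by (simp add: game_loss_def own_grad_def)
qed

text \<open>Links the gradient of the loss to \<open>own_grad\<close>, for which the bound
  \<open>gbar\<close> and the Lipschitz constants are stated.\<close>

lemma grad_on_game_loss:
  assumes "f \<in> strategies G" "x \<in> type_set G i" "a \<in> act_set G i" "\<xi> \<in> space (rival_ref G i)"
  shows "grad_on (act_set G i) (\<lambda>y. game_loss G i f x y \<xi>) a
    = own_grad G i ((\<lambda>j. f j (\<xi> j))(i := a)) (\<xi>(i := x))"
  using game_loss_has_grad[OF assms] by (rule grad_on_eq[OF act_set(3) assms(3)])

lemma grad_on_game_loss_measurable:
  assumes "f \<in> strategies G" "x \<in> type_set G i" "a \<in> act_set G i"
  shows "(\<lambda>\<xi>. grad_on (act_set G i) (\<lambda>y. game_loss G i f x y \<xi>) a) \<in> borel_measurable (rival_ref G i)"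
  using assms game_loss_has_grad
  by (intro measurable_grad_on act_set game_loss_measurable) blast+

end

section \<open>Conditional distributions of a joint density\<close>

lemma prob_space_conditional:
  assumes int: "integrable (rival_ref G i) (\<lambda>\<xi>. q (\<xi>(i := x)))"
    and nonneg: "\<And>\<xi>. \<xi> \<in> space (rival_ref G i) \<Longrightarrow> 0 \<le> q (\<xi>(i := x))"
    and pos: "0 < marginal G i q x"
  shows "prob_space (conditional G i q x)"
proof
  have "emeasure (conditional G i q x) (space (conditional G i q x))
      = (\<integral>\<^sup>+\<xi>. ennreal (q (\<xi>(i := x)) / marginal G i q x) \<partial>rival_ref G i)"
    unfolding conditional_def using int
    by (subst emeasure_density) (auto intro!: nn_integral_cong)
  also have "\<dots> = ennreal (\<integral>\<xi>. q (\<xi>(i := x)) / marginal G i q x \<partial>rival_ref G i)"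
    using int nonneg pos by (intro nn_integral_eq_integral) auto
  also have "\<dots> = 1" using pos by (simp add: marginal_def)
  finally show "emeasure (conditional G i q x) (space (conditional G i q x)) = 1" .
qed

lemma sets_conditional [simp]: "sets (conditional G i q x) = sets (rival_ref G i)"
  and space_conditional [simp]: "space (conditional G i q x) = space (rival_ref G i)"
  by (simp_all add: conditional_def)

lemma integral_conditional:
  assumes int: "integrable (rival_ref G i) (\<lambda>\<xi>. q (\<xi>(i := x)))"
    and nonneg: "\<And>\<xi>. \<xi> \<in> space (rival_ref G i) \<Longrightarrow> 0 \<le> q (\<xi>(i := x))"
    and pos: "0 < marginal G i q x"
    and h: "h \<in> borel_measurable (rival_ref G i)"
  shows "(\<integral>\<xi>. h \<xi> \<partial>conditional G i q x)
    = (\<integral>\<xi>. h \<xi> * q (\<xi>(i := x)) \<partial>rival_ref G i) / marginal G i q x"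
proof -
  have "(\<integral>\<xi>. h \<xi> \<partial>conditional G i q x)
      = (\<integral>\<xi>. (q (\<xi>(i := x)) / marginal G i q x) *\<^sub>R h \<xi> \<partial>rival_ref G i)"
    unfolding conditional_def using int nonneg pos h
    by (intro integral_density) auto
  also have "\<dots> = (\<integral>\<xi>. h \<xi> * q (\<xi>(i := x)) / marginal G i q x \<partial>rival_ref G i)"
    by (simp add: mult.commute)
  finally show ?thesis by simp
qed


section \<open>Predictive distributions\<close>

context bayes_game
begin

lemma belief:
  assumes "is_belief G \<mu>"
  shows "prob_space \<mu>" "sets \<mu> = sets (par_ref G)" "space \<mu> = par_set G"
  using assms sets_eq_imp_space_eq[of \<mu> "par_ref G"] by (auto simp: is_belief_def space_par_ref)

lemma predictive_positiveD:
  assumes \<mu>: "is_belief G \<mu>" "predictive_positive G i \<mu>" and x: "x \<in> type_set G i"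
  shows "0 < (\<integral>\<zeta>. pmarg G i x \<zeta> \<partial>\<mu>)"
proof -
  have "bdd_below ((\<lambda>x. \<integral>\<zeta>. pmarg G i x \<zeta> \<partial>\<mu>) ` type_set G i)"
    using belief(3)[OF \<mu>(1)]
    by (intro bdd_belowI2[of _ 0]) (auto intro!: Bochner_Integration.integral_nonneg pmarg_nonneg)
  from cINF_lower[OF this x] show ?thesis using \<mu>(2) by (simp add: predictive_positive_def)
qed

text \<open>The Bochner integral of a non-integrable function is 0, so a positive value certifies
  integrability.\<close>

lemma integrable_pmarg:
  assumes "0 < (\<integral>\<zeta>. pmarg G i x \<zeta> \<partial>\<mu>)"
  shows "integrable \<mu> (\<lambda>\<zeta>. pmarg G i x \<zeta>)"
  using assms not_integrable_integral_eq by fastforce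

context
  fixes i x \<mu>
  assumes \<mu>: "is_belief G \<mu>" and x: "x \<in> type_set G i"
    and pos: "0 < (\<integral>\<zeta>. pmarg G i x \<zeta> \<partial>\<mu>)"
begin

lemma pair_sigma_finite_rival_belief: "pair_sigma_finite (rival_ref G i) \<mu>"
  using sigma_finite_rival_ref belief(1)[OF \<mu>]
  by (intro pair_sigma_finite.intro)
    (auto intro: prob_space.axioms(1) finite_measure.axioms(1))

text \<open>By Tonelli the rivals' types can be integrated out inside, which leaves
  \<open>pmarg\<close>; positivity of its mean makes that integrable under the belief.\<close>

lemma integrable_pdens_pair:
  "integrable (rival_ref G i \<Otimes>\<^sub>M \<mu>) (\<lambda>(\<xi>, \<zeta>). pdens G (\<xi>(i := x)) \<zeta>)"
  unfolding integrable_iff_bounded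
proof
  interpret pair_sigma_finite "rival_ref G i" \<mu> by (rule pair_sigma_finite_rival_belief)
  note meas = pdens_update_measurable[OF x belief(2)[OF \<mu>]]
  then show "(\<lambda>(\<xi>, \<zeta>). pdens G (\<xi>(i := x)) \<zeta>) \<in> borel_measurable (rival_ref G i \<Otimes>\<^sub>M \<mu>)" .
  have "(\<integral>\<^sup>+p. ennreal (norm (case p of (\<xi>, \<zeta>) \<Rightarrow> pdens G (\<xi>(i := x)) \<zeta>)) \<partial>(rival_ref G i \<Otimes>\<^sub>M \<mu>))
      = (\<integral>\<^sup>+\<zeta>. \<integral>\<^sup>+\<xi>. ennreal (norm (pdens G (\<xi>(i := x)) \<zeta>)) \<partial>rival_ref G i \<partial>\<mu>)"
    using meas by (subst nn_integral_snd[symmetric]) auto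
  also have "\<dots> = (\<integral>\<^sup>+\<zeta>. ennreal (pmarg G i x \<zeta>) \<partial>\<mu>)"
  proof (rule nn_integral_cong)
    fix \<zeta> assume "\<zeta> \<in> space \<mu>"
    then have \<zeta>: "\<zeta> \<in> par_set G" using belief(3)[OF \<mu>] by simp
    have "(\<integral>\<^sup>+\<xi>. ennreal (norm (pdens G (\<xi>(i := x)) \<zeta>)) \<partial>rival_ref G i)
        = (\<integral>\<^sup>+\<xi>. ennreal (pdens G (\<xi>(i := x)) \<zeta>) \<partial>rival_ref G i)"
      using \<zeta> by (intro nn_integral_cong) (simp add: pdens_nonneg rival_update[OF x])
    then show "(\<integral>\<^sup>+\<xi>. ennreal (norm (pdens G (\<xi>(i := x)) \<zeta>)) \<partial>rival_ref G i) = ennreal (pmarg G i x \<zeta>)"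
      using nn_integral_pdens[OF x \<zeta>] by simp
  qed
  also have "\<dots> = ennreal (\<integral>\<zeta>. pmarg G i x \<zeta> \<partial>\<mu>)"
    using belief(3)[OF \<mu>] by (intro nn_integral_eq_integral integrable_pmarg[OF pos])
      (auto simp: pmarg_nonneg[OF x])
  finally show "(\<integral>\<^sup>+p. ennreal (norm (case p of (\<xi>, \<zeta>) \<Rightarrow> pdens G (\<xi>(i := x)) \<zeta>))
      \<partial>(rival_ref G i \<Otimes>\<^sub>M \<mu>)) < \<infinity>" by simp
qed

text \<open>Fubini: testing the mixture against h amounts to testing each component and then mixing.
  With \<open>h = 1\<close> this gives the marginal of the predictive density.\<close>

lemma integral_predictive_density:
  assumes h: "h \<in> borel_measurable (rival_ref G i)" "\<And>\<xi>. \<xi> \<in> space (rival_ref G i) \<Longrightarrow> \<bar>h \<xi>\<bar> \<le> 1"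
  shows "(\<integral>\<xi>. h \<xi> * predictive_density G \<mu> (\<xi>(i := x)) \<partial>rival_ref G i)
      = (\<integral>\<zeta>. (\<integral>\<xi>. h \<xi> * pdens G (\<xi>(i := x)) \<zeta> \<partial>rival_ref G i) \<partial>\<mu>)" (is ?eq)
    and "integrable (rival_ref G i) (\<lambda>\<xi>. h \<xi> * predictive_density G \<mu> (\<xi>(i := x)))" (is ?int1)
    and "integrable \<mu> (\<lambda>\<zeta>. \<integral>\<xi>. h \<xi> * pdens G (\<xi>(i := x)) \<zeta> \<partial>rival_ref G i)" (is ?int2)
proof -
  interpret pair_sigma_finite "rival_ref G i" \<mu> by (rule pair_sigma_finite_rival_belief)
  have int: "integrable (rival_ref G i \<Otimes>\<^sub>M \<mu>) (\<lambda>(\<xi>, \<zeta>). h \<xi> * pdens G (\<xi>(i := x)) \<zeta>)"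
  proof (rule Bochner_Integration.integrable_bound[OF integrable_pdens_pair])
    have "(\<lambda>p. h (fst p) * (\<lambda>(\<xi>, \<zeta>). pdens G (\<xi>(i := x)) \<zeta>) p) \<in> borel_measurable (rival_ref G i \<Otimes>\<^sub>M \<mu>)"
      using h(1) pdens_update_measurable[OF x belief(2)[OF \<mu>]]
      by (intro borel_measurable_times) auto
    then show "(\<lambda>(\<xi>, \<zeta>). h \<xi> * pdens G (\<xi>(i := x)) \<zeta>) \<in> borel_measurable (rival_ref G i \<Otimes>\<^sub>M \<mu>)"
      by (simp add: case_prod_beta')
    show "AE p in rival_ref G i \<Otimes>\<^sub>M \<mu>. norm (case p of (\<xi>, \<zeta>) \<Rightarrow> h \<xi> * pdens G (\<xi>(i := x)) \<zeta>)
        \<le> norm (case p of (\<xi>, \<zeta>) \<Rightarrow> pdens G (\<xi>(i := x)) \<zeta>)"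
      using h(2) by (intro AE_I2) (auto simp: space_pair_measure abs_mult intro!: mult_left_le_one_le)
  qed
  have eq: "(\<lambda>\<xi>. h \<xi> * predictive_density G \<mu> (\<xi>(i := x)))
      = (\<lambda>\<xi>. \<integral>\<zeta>. h \<xi> * pdens G (\<xi>(i := x)) \<zeta> \<partial>\<mu>)"
    by (simp add: predictive_density_def)
  show ?eq unfolding eq by (rule Fubini_integral[OF int, symmetric])
  show ?int1 unfolding eq by (rule integrable_fst[OF int])
  show ?int2 by (rule integrable_snd[OF int])
qed

lemma integrable_predictive_density:
  "integrable (rival_ref G i) (\<lambda>\<xi>. predictive_density G \<mu> (\<xi>(i := x)))"
  using integral_predictive_density(2)[of "\<lambda>_. 1"] by simp

lemma marginal_predictive_density:
  "marginal G i (predictive_density G \<mu>) x = (\<integral>\<zeta>. pmarg G i x \<zeta> \<partial>\<mu>)"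
  using integral_predictive_density(1)[of "\<lambda>_. 1"] by (simp add: marginal_def pmarg_def)

lemma predictive_density_nonneg:
  "\<xi> \<in> space (rival_ref G i) \<Longrightarrow> 0 \<le> predictive_density G \<mu> (\<xi>(i := x))"
  unfolding predictive_density_def using belief(3)[OF \<mu>]
  by (auto intro!: Bochner_Integration.integral_nonneg pdens_nonneg rival_update[OF x])

lemma prob_space_nu_cond: "prob_space (nu_cond G i \<mu> x)"
  unfolding nu_cond_def using pos
  by (intro prob_space_conditional integrable_predictive_density predictive_density_nonneg)
    (simp_all add: marginal_predictive_density)

text \<open>In this mixture \<zeta> carries the weight \<open>pmarg G i x \<zeta>\<close>, its
  likelihood given the own type x: Bayes' rule applied to the own type.\<close>

lemma integral_nu_cond:
  assumes h: "h \<in> borel_measurable (rival_ref G i)" "\<And>\<xi>. \<xi> \<in> space (rival_ref G i) \<Longrightarrow> \<bar>h \<xi>\<bar> \<le> 1"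
  shows "(\<integral>\<xi>. h \<xi> \<partial>nu_cond G i \<mu> x)
    = (\<integral>\<zeta>. (\<integral>\<xi>. h \<xi> * pdens G (\<xi>(i := x)) \<zeta> \<partial>rival_ref G i) \<partial>\<mu>) / (\<integral>\<zeta>. pmarg G i x \<zeta> \<partial>\<mu>)"
  unfolding nu_cond_def using pos
  by (subst integral_conditional[OF integrable_predictive_density predictive_density_nonneg _ h(1)])
    (simp_all add: marginal_predictive_density integral_predictive_density(1)[OF h])

end

lemma sets_nu_cond [simp]: "sets (nu_cond G i \<mu> x) = sets (rival_ref G i)"
  and sets_eta_cond [simp]: "sets (eta_cond G i \<zeta> x) = sets (rival_ref G i)"
  by (simp_all add: nu_cond_def eta_cond_def)

lemma
  assumes "\<zeta> \<in> par_set G" "x \<in> type_set G i" "0 < pmarg G i x \<zeta>"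
  shows prob_space_eta_cond: "prob_space (eta_cond G i \<zeta> x)"
    and integral_eta_cond: "h \<in> borel_measurable (rival_ref G i) \<Longrightarrow> (\<integral>\<xi>. h \<xi> \<partial>eta_cond G i \<zeta> x)
      = (\<integral>\<xi>. h \<xi> * pdens G (\<xi>(i := x)) \<zeta> \<partial>rival_ref G i) / pmarg G i x \<zeta>"
  unfolding eta_cond_def pmarg_def using assms
  by (auto intro!: prob_space_conditional integral_conditional integrable_pdens pdens_nonneg rival_update
      simp: pmarg_def)

text \<open>Only the normalising integral can fail. If it were 0, division by zero would make the
  posterior the null measure, and all predictive marginals would vanish against
  \<open>predictive_positive\<close>.\<close>

lemma is_belief_posterior:
  assumes h: "h \<in> space (history_measure G t)" and pos: "predictive_positive G i (posterior G i t h)"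
  shows "is_belief G (posterior G i t h)"
proof -
  let ?N = "\<lambda>\<zeta>. (\<Prod>\<tau>\<in>{1..<t}. pdens G (h \<tau>) \<zeta>) * prior G i \<zeta>"
  let ?Z = "\<integral>\<zeta>. ?N \<zeta> \<partial>par_ref G"
  have prof: "h \<tau> \<in> type_profiles G" if "\<tau> \<in> {1..<t}" for \<tau>
    using h that by (auto simp: history_measure_def space_PiM eta_def PiE_def Pi_def
        type_profiles_def space_type_ref)
  have pm: "(\<lambda>\<zeta>. pdens G \<theta> \<zeta>) \<in> borel_measurable (par_ref G)" if "\<theta> \<in> type_profiles G" for \<theta>
    using measurable_compose[OF measurable_Pair1'[of \<theta> "PiM UNIV (type_ref G)"] pdens_measurable] that
    by (simp add: space_profiles)
  have meas: "?N \<in> borel_measurable (par_ref G)"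
    using prof by (intro borel_measurable_times borel_measurable_prod pm prior_measurable) auto
  have nonneg: "0 \<le> ?N \<zeta>" if "\<zeta> \<in> space (par_ref G)" for \<zeta>
    using that prof by (intro mult_nonneg_nonneg prod_nonneg prior_nonneg ballI pdens_nonneg)
      (auto simp: space_par_ref)
  have "?Z \<noteq> 0"
  proof
    assume "?Z = 0"
    then have "posterior G i t h = density (par_ref G) (\<lambda>_. 0)"
      by (simp add: posterior_def posterior_density_def[abs_def])
    then have "AE \<zeta> in posterior G i t h. pmarg G i x \<zeta> = 0" for x
      by (simp only: AE_density borel_measurable_const) simp
    then have "(\<integral>\<zeta>. pmarg G i x \<zeta> \<partial>posterior G i t h) = 0" for x
      by (rule integral_eq_zero_AE)
    then have "(INF x\<in>type_set G i. \<integral>\<zeta>. pmarg G i x \<zeta> \<partial>posterior G i t h) = 0"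
      using type_set(1) by simp
    then show False using pos by (simp add: predictive_positive_def)
  qed
  \<comment> \<open>A non-integrable likelihood would also have given \<open>?Z = 0\<close> by
    default, so this case is excluded as well.\<close>
  then have int: "integrable (par_ref G) ?N" using not_integrable_integral_eq by blast
  have "0 \<le> ?Z" by (rule Bochner_Integration.integral_nonneg) (rule nonneg)
  then have Z: "0 < ?Z" using \<open>?Z \<noteq> 0\<close> by linarith
  have "emeasure (posterior G i t h) (space (posterior G i t h))
      = (\<integral>\<^sup>+\<zeta>. ennreal (?N \<zeta> / ?Z) \<partial>par_ref G)"
    unfolding posterior_def posterior_density_def[abs_def] using meas
    by (subst emeasure_density) (auto intro!: nn_integral_cong)
  also have "\<dots> = ennreal (\<integral>\<zeta>. ?N \<zeta> / ?Z \<partial>par_ref G)"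
    using nonneg Z int by (intro nn_integral_eq_integral AE_I2 integrable_divide divide_nonneg_pos)
  also have "\<dots> = 1" using Z by simp
  finally show ?thesis
    by (auto simp: is_belief_def posterior_def intro!: prob_spaceI)
qed

end


section \<open>Gradients of the robust objective\<close>

locale bp_game = bayes_game G
  for G :: "('n::finite, 'a::euclidean_space, 'b::euclidean_space, 'z::euclidean_space) bgame" +
  fixes \<phi> :: "real measure \<Rightarrow> real"
    and W :: "'n \<Rightarrow> ('n \<Rightarrow> 'b) measure \<Rightarrow> ('a \<Rightarrow> ('n \<Rightarrow> 'b) \<Rightarrow> real) \<Rightarrow> 'a \<Rightarrow> ('n \<Rightarrow> 'b) \<Rightarrow> real"
    and M \<kappa>0 \<kappa>1 gbar :: "'n \<Rightarrow> real"
    and L0 L1 :: "'n \<Rightarrow> 'n \<Rightarrow> real"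
  assumes strongly_convex: "strongly_convex_loss G M"
    and lipschitz: "lipschitz_in_rivals G L0 L1"
    and convex_risk: "\<And>i. law_invariant_convex_risk (rival_ref G i) \<phi>"
    and \<kappa>_nonneg: "\<And>i. 0 \<le> \<kappa>0 i" "\<And>i. 0 \<le> \<kappa>1 i"
    and radius: "spectral_radius (Gamma_bp M L0 L1 \<kappa>0 \<kappa>1) < 1"
    and own_grad_le: "\<And>i a \<theta>. a \<in> act_profiles G \<Longrightarrow> \<theta> \<in> type_profiles G \<Longrightarrow>
          norm (own_grad G i a \<theta>) \<le> gbar i"
    and regular: "\<And>i. gradient_regular (act_set G i) (rival_ref G i) \<phi> (W i)"
begin

lemma M_pos: "0 < M i"
  using strongly_convex by (simp add: strongly_convex_loss_def)

lemma gbar_nonneg: "0 \<le> gbar i"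
proof -
  have "\<forall>j. \<exists>x. x \<in> act_set G j" "\<forall>j. \<exists>x. x \<in> type_set G j"
    using act_set(1) type_set(1) by auto
  then obtain a \<theta> where "\<forall>j. a j \<in> act_set G j" "\<forall>j. \<theta> j \<in> type_set G j"
    using choice[of "\<lambda>j x. x \<in> act_set G j"] choice[of "\<lambda>j x. x \<in> type_set G j"] by blast
  then have "norm (own_grad G i a \<theta>) \<le> gbar i"
    by (intro own_grad_le) (auto simp: act_profiles_def type_profiles_def)
  then show ?thesis using norm_ge_zero order_trans by blast
qed

context
  fixes i f x
  assumes f: "f \<in> strategies G" and x: "x \<in> type_set G i"
begin

lemma norm_grad_on_game_loss_le:
  assumes "a \<in> act_set G i" "\<xi> \<in> space (rival_ref G i)"
  shows "norm (grad_on (act_set G i) (\<lambda>y. game_loss G i f x y \<xi>) a) \<le> gbar i"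
  unfolding grad_on_game_loss[OF f x assms]
  by (intro own_grad_le strategy_profile[OF f assms] rival_update[OF x assms(2)])

lemma bounded_diff_game_loss: "bounded_diff_loss (act_set G i) (rival_ref G i) (game_loss G i f x)"
proof -
  obtain B where B: "\<And>a \<xi>. a \<in> act_set G i \<Longrightarrow> \<xi> \<in> space (rival_ref G i) \<Longrightarrow> \<bar>game_loss G i f x a \<xi>\<bar> \<le> B"
    using game_loss_bounded f x by metis
  have "\<exists>B. \<forall>a\<in>act_set G i. \<forall>\<xi>\<in>space (rival_ref G i). \<bar>game_loss G i f x a \<xi>\<bar> \<le> B \<and>
      norm (grad_on (act_set G i) (\<lambda>y. game_loss G i f x y \<xi>) a) \<le> B"
    using B norm_grad_on_game_loss_le by (intro exI[of _ "max B (gbar i)"]) (auto simp: le_max_iff_disj)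
  then show ?thesis
    using game_loss_measurable[OF f x] game_loss_has_grad[OF f x] unfolding bounded_diff_loss_def by blast
qed

context
  fixes P
  assumes P: "prob_space P" "sets P = sets (rival_ref G i)"
begin

lemma space_P: "space P = space (rival_ref G i)"
  using P(2) by (rule sets_eq_imp_space_eq)

abbreviation weight :: "'a \<Rightarrow> ('n \<Rightarrow> 'b) \<Rightarrow> real" where
  "weight \<equiv> W i P (game_loss G i f x)"

abbreviation loss_grad :: "'a \<Rightarrow> ('n \<Rightarrow> 'b) \<Rightarrow> 'a" where
  "loss_grad a \<xi> \<equiv> grad_on (act_set G i) (\<lambda>y. game_loss G i f x y \<xi>) a"

text \<open>The bound on the weights obtained here may depend on P and on the loss, and serves
  integrability alone. The uniform \<open>wbar\<close> comes from
  \<open>weights_controlled\<close>.\<close>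

lemma weight_regular:
  assumes a: "a \<in> act_set G i"
  shows weight_measurable: "weight a \<in> borel_measurable (rival_ref G i)"
    and weight_nonneg: "\<And>\<xi>. \<xi> \<in> space (rival_ref G i) \<Longrightarrow> 0 \<le> weight a \<xi>"
    and weight_bounded: "\<exists>wb. \<forall>\<xi>\<in>space (rival_ref G i). weight a \<xi> \<le> wb"
    and weight_integral: "(\<integral>\<xi>. weight a \<xi> \<partial>P) = 1"
    and weight_has_grad: "has_grad_on (act_set G i) (\<lambda>y. vbp G \<phi> i P y f x)
        (\<integral>\<xi>. weight a \<xi> *\<^sub>R loss_grad a \<xi> \<partial>P) a"
proof -
  note * = regular[of i, unfolded gradient_regular_def, rule_format,
      OF conjI[OF P(1) conjI[OF P(2) bounded_diff_game_loss]], folded vbp_def]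
  then obtain wb where R: "weight a \<in> borel_measurable (rival_ref G i) \<and>
      (\<forall>\<xi>\<in>space (rival_ref G i). 0 \<le> weight a \<xi> \<and> weight a \<xi> \<le> wb) \<and>
      (\<integral>\<xi>. weight a \<xi> \<partial>P) = 1 \<and>
      has_grad_on (act_set G i) (\<lambda>y. vbp G \<phi> i P y f x)
        (\<integral>\<xi>. weight a \<xi> *\<^sub>R loss_grad a \<xi> \<partial>P) a"
    by (elim exE conjE) (drule bspec[OF _ a], assumption)
  show "weight a \<in> borel_measurable (rival_ref G i)"
    "\<And>\<xi>. \<xi> \<in> space (rival_ref G i) \<Longrightarrow> 0 \<le> weight a \<xi>"
    "\<exists>wb. \<forall>\<xi>\<in>space (rival_ref G i). weight a \<xi> \<le> wb"
    "(\<integral>\<xi>. weight a \<xi> \<partial>P) = 1"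
    "has_grad_on (act_set G i) (\<lambda>y. vbp G \<phi> i P y f x) (\<integral>\<xi>. weight a \<xi> *\<^sub>R loss_grad a \<xi> \<partial>P) a"
    using R by auto
qed

lemma grad_vbp_eq:
  assumes "a \<in> act_set G i"
  shows "grad_vbp G \<phi> i P a f x = (\<integral>\<xi>. weight a \<xi> *\<^sub>R loss_grad a \<xi> \<partial>P)"
  unfolding grad_vbp_def by (rule grad_on_eq[OF act_set(3) assms weight_has_grad[OF assms]])

lemma has_grad_vbp:
  assumes "a \<in> act_set G i"
  shows "has_grad_on (act_set G i) (\<lambda>y. vbp G \<phi> i P y f x) (grad_vbp G \<phi> i P a f x) a"
  unfolding grad_vbp_eq[OF assms] by (rule weight_has_grad[OF assms])

lemma integrable_weight:
  assumes a: "a \<in> act_set G i" and Q: "prob_space Q" "sets Q = sets (rival_ref G i)"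
  shows "integrable Q (weight a)"
proof -
  interpret Q: prob_space Q by fact
  have "space Q = space (rival_ref G i)" using Q(2) by (rule sets_eq_imp_space_eq)
  moreover obtain wb where "\<forall>\<xi>\<in>space (rival_ref G i). weight a \<xi> \<le> wb"
    using weight_bounded[OF a] by (elim exE)
  ultimately show ?thesis
    using measurable_cong_sets[OF Q(2) refl] weight_measurable[OF a] weight_nonneg[OF a]
    by (intro Q.integrable_const_bound[of _ wb]) auto
qed

text \<open>The weights are nonnegative with mean 1, so the risk gradient is an average of loss
  gradients. This keeps suprema of gradient differences over types finite.\<close>

lemma norm_grad_vbp_le:
  assumes a: "a \<in> act_set G i"
  shows "norm (grad_vbp G \<phi> i P a f x) \<le> gbar i"
proof -
  have "norm (grad_vbp G \<phi> i P a f x) \<le> (\<integral>\<xi>. norm (weight a \<xi> *\<^sub>R loss_grad a \<xi>) \<partial>P)"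
    unfolding grad_vbp_eq[OF a] by (rule integral_norm_bound)
  also have "\<dots> \<le> (\<integral>\<xi>. weight a \<xi> * gbar i \<partial>P)"
    using integrable_weight[OF a P] weight_nonneg[OF a] norm_grad_on_game_loss_le[OF a] gbar_nonneg
    by (intro integral_mono_AE' AE_I2 integrable_mult_left) (auto simp: space_P intro: mult_left_mono)
  also have "\<dots> = gbar i" using weight_integral[OF a] by simp
  finally show ?thesis .
qed

text \<open>The quadratic gain c is the same for all \<xi>, so cash invariance takes it out of the
  risk unchanged and the modulus \<open>M i\<close> survives.\<close>

lemma vbp_strongly_convex:
  assumes u: "u \<in> act_set G i" and v: "v \<in> act_set G i" and s: "s \<in> {0..1}"
  shows "vbp G \<phi> i P (s *\<^sub>R u + (1 - s) *\<^sub>R v) f x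
    \<le> s * vbp G \<phi> i P u f x + (1 - s) * vbp G \<phi> i P v f x - M i / 2 * s * (1 - s) * (norm (u - v))\<^sup>2"
proof -
  let ?l = "game_loss G i f x" and ?r = "risk \<phi> P"
  define w c where "w = s *\<^sub>R u + (1 - s) *\<^sub>R v" and "c = M i / 2 * s * (1 - s) * (norm (u - v))\<^sup>2"
  have w: "w \<in> act_set G i" unfolding w_def using s u v act_set(3) by (auto intro!: convexD)
  obtain B where B: "\<And>a \<xi>. a \<in> act_set G i \<Longrightarrow> \<xi> \<in> space (rival_ref G i) \<Longrightarrow> \<bar>?l a \<xi>\<bar> \<le> B"
    using game_loss_bounded f x by metis
  have bl: "bounded_loss P (?l a)" if "a \<in> act_set G i" for a
    using game_loss_measurable[OF f x that] B[OF that] measurable_cong_sets[OF P(2) refl]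
    by (auto simp: bounded_loss_def bounded_iff space_P)
  have blc: "bounded_loss P (\<lambda>\<xi>. s * ?l u \<xi> + (1 - s) * ?l v \<xi>)"
    using bl[OF u] bl[OF v] bounded_plus_comp[of "\<lambda>\<xi>. s * ?l u \<xi>" "space P" "\<lambda>\<xi>. (1 - s) * ?l v \<xi>"]
      bounded_scaling[of "?l u ` space P" s] bounded_scaling[of "?l v ` space P" "1 - s"]
    by (auto simp: bounded_loss_def image_image)
  have "bounded ((\<lambda>\<xi>. - c) ` space P)" by (rule bounded_subset[of "{- c}"]) auto
  then have blc': "bounded_loss P (\<lambda>\<xi>. (s * ?l u \<xi> + (1 - s) * ?l v \<xi>) + - c)"
    using blc bounded_plus_comp[of "\<lambda>\<xi>. s * ?l u \<xi> + (1 - s) * ?l v \<xi>" "space P" "\<lambda>\<xi>. - c"]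
    unfolding bounded_loss_def by (intro conjI borel_measurable_add[OF _ borel_measurable_const]) blast+
  have "convex_risk_measure P ?r"
    using convex_risk[of i] P by (simp add: law_invariant_convex_risk_def)
  then have mono: "\<And>X Y. bounded_loss P X \<Longrightarrow> bounded_loss P Y \<Longrightarrow> (\<forall>w\<in>space P. X w \<le> Y w) \<Longrightarrow> ?r X \<le> ?r Y"
    and cash: "\<And>X m. bounded_loss P X \<Longrightarrow> ?r (\<lambda>w. X w + m) = ?r X + m"
    and conv: "\<And>X Y. bounded_loss P X \<Longrightarrow> bounded_loss P Y \<Longrightarrow>
      ?r (\<lambda>w. s * X w + (1 - s) * Y w) \<le> s * ?r X + (1 - s) * ?r Y"
    using s unfolding convex_risk_measure_def risk_measure_def by blast+
  have "?r (?l w) \<le> ?r (\<lambda>\<xi>. (s * ?l u \<xi> + (1 - s) * ?l v \<xi>) + - c)"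
  proof (intro mono bl w blc' ballI)
    fix \<xi> assume "\<xi> \<in> space P"
    then have \<xi>: "\<xi> \<in> space (rival_ref G i)" by (simp add: space_P)
    show "?l w \<xi> \<le> (s * ?l u \<xi> + (1 - s) * ?l v \<xi>) + - c"
      using strongly_convex strategy_profile[OF f u \<xi>] rival_update[OF x \<xi>] u v s
      unfolding strongly_convex_loss_def game_loss_def w_def c_def
      by (fastforce dest: spec[of _ i])
  qed
  also have "\<dots> = ?r (\<lambda>\<xi>. s * ?l u \<xi> + (1 - s) * ?l v \<xi>) + - c" by (rule cash[OF blc])
  also have "\<dots> \<le> s * ?r (?l u) + (1 - s) * ?r (?l v) + - c" using conv[OF bl[OF u] bl[OF v]] by simp
  finally show ?thesis by (simp add: vbp_def w_def c_def)
qed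

end

text \<open>\<open>E\<^sub>P[\<omega>\<^sub>P g] - E\<^sub>Q[\<omega>\<^sub>Q g] = (E\<^sub>P - E\<^sub>Q)[\<omega>\<^sub>P g] + E\<^sub>Q[(\<omega>\<^sub>P - \<omega>\<^sub>Q) g]\<close>\<close>

lemma grad_vbp_diff_le:
  assumes P: "prob_space P" "sets P = sets (rival_ref G i)"
    and Q: "prob_space Q" "sets Q = sets (rival_ref G i)"
    and a: "a \<in> act_set G i"
    and wb: "\<And>\<xi>. \<xi> \<in> space (rival_ref G i) \<Longrightarrow> W i P (game_loss G i f x) a \<xi> \<le> wb"
    and lam: "(\<integral>\<xi>. \<bar>W i P (game_loss G i f x) a \<xi> - W i Q (game_loss G i f x) a \<xi>\<bar> \<partial>Q) \<le> l * d_TV P Q"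
  shows "norm (grad_vbp G \<phi> i P a f x - grad_vbp G \<phi> i Q a f x) \<le> (2 * wb * gbar i + gbar i * l) * d_TV P Q"
proof -
  interpret Q: prob_space Q by fact
  let ?g = "loss_grad a" and ?wP = "weight P a" and ?wQ = "weight Q a"
  have sp: "space P = space (rival_ref G i)" "space Q = space (rival_ref G i)"
    using P(2) Q(2) by (simp_all add: space_P P Q)
  note wP = weight_measurable[OF P a] weight_nonneg[OF P a]
  note wQ = weight_measurable[OF Q a] weight_nonneg[OF Q a]
  have gm: "?g \<in> borel_measurable (rival_ref G i)"
    by (rule grad_on_game_loss_measurable[OF f x a])
  note g = norm_grad_on_game_loss_le[OF a]
  have int: "integrable Q (\<lambda>\<xi>. w \<xi> *\<^sub>R ?g \<xi>)" if "integrable Q w" for w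
  proof (rule Bochner_Integration.integrable_bound)
    show "integrable Q (\<lambda>\<xi>. w \<xi> * gbar i)" using that by simp
    show "(\<lambda>\<xi>. w \<xi> *\<^sub>R ?g \<xi>) \<in> borel_measurable Q"
      using borel_measurable_integrable[OF that] gm measurable_cong_sets[OF Q(2) refl]
      by (intro borel_measurable_scaleR) (simp_all only: measurable_cong_sets[OF Q(2) refl])
    show "AE \<xi> in Q. norm (w \<xi> *\<^sub>R ?g \<xi>) \<le> norm (w \<xi> * gbar i)"
      using g gbar_nonneg by (intro AE_I2) (auto simp: sp abs_mult intro!: mult_left_mono)
  qed
  \<comment> \<open>The weight belonging to P is integrated against Q, which is possible because it
    is bounded at every point of the space.\<close>
  have iP: "integrable Q ?wP" by (rule integrable_weight[OF P a Q])
  have iQ: "integrable Q ?wQ" by (rule integrable_weight[OF Q a Q])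
  have "grad_vbp G \<phi> i P a f x - grad_vbp G \<phi> i Q a f x
      = ((\<integral>\<xi>. ?wP \<xi> *\<^sub>R ?g \<xi> \<partial>P) - (\<integral>\<xi>. ?wP \<xi> *\<^sub>R ?g \<xi> \<partial>Q)) + (\<integral>\<xi>. (?wP \<xi> - ?wQ \<xi>) *\<^sub>R ?g \<xi> \<partial>Q)"
    using int[OF iP] int[OF iQ] by (simp add: grad_vbp_eq[OF P a] grad_vbp_eq[OF Q a] scaleR_left_diff_distrib)
  moreover have "norm ((\<integral>\<xi>. ?wP \<xi> *\<^sub>R ?g \<xi> \<partial>P) - (\<integral>\<xi>. ?wP \<xi> *\<^sub>R ?g \<xi> \<partial>Q)) \<le> 2 * (wb * gbar i) * d_TV P Q"
  proof (rule norm_integral_diff_le_d_TV[OF P(1) Q(1)])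
    show "sets P = sets Q" using P Q by simp
    show "(\<lambda>\<xi>. ?wP \<xi> *\<^sub>R ?g \<xi>) \<in> borel_measurable P"
      using wP(1) gm by (intro borel_measurable_scaleR) (simp_all add: measurable_cong_sets[OF P(2) refl])
    show "norm (?wP \<xi> *\<^sub>R ?g \<xi>) \<le> wb * gbar i" if "\<xi> \<in> space P" for \<xi>
      using wP(2)[of \<xi>] wb[of \<xi>] g[of \<xi>] that by (auto simp: sp intro!: mult_mono)
  qed
  moreover have "norm (\<integral>\<xi>. (?wP \<xi> - ?wQ \<xi>) *\<^sub>R ?g \<xi> \<partial>Q) \<le> gbar i * (l * d_TV P Q)"
  proof -
    have "norm (\<integral>\<xi>. (?wP \<xi> - ?wQ \<xi>) *\<^sub>R ?g \<xi> \<partial>Q) \<le> (\<integral>\<xi>. norm ((?wP \<xi> - ?wQ \<xi>) *\<^sub>R ?g \<xi>) \<partial>Q)"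
      by (rule integral_norm_bound)
    also have "\<dots> \<le> (\<integral>\<xi>. gbar i * \<bar>?wP \<xi> - ?wQ \<xi>\<bar> \<partial>Q)"
      using iP iQ g gbar_nonneg
      by (intro integral_mono_AE' AE_I2 integrable_mult_right integrable_abs Bochner_Integration.integrable_diff)
        (auto simp: sp mult.commute[of "gbar i"] intro: mult_left_mono)
    also have "\<dots> \<le> gbar i * (l * d_TV P Q)" using lam gbar_nonneg by (simp add: mult_left_mono)
    finally show ?thesis .
  qed
  ultimately show ?thesis by (smt (verit) norm_triangle_ineq distrib_right mult.assoc mult.commute)
qed

end


section \<open>Stability of equilibria\<close>

text \<open>Both actions satisfy the first-order condition of their own problem, and the second
  objective is strongly convex.\<close>

lemma best_response_dist_le:
  assumes f: "f \<in> strategies G" and f': "f' \<in> strategies G" and x: "x \<in> type_set G i"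
    and P: "prob_space P" "sets P = sets (rival_ref G i)"
    and P': "prob_space P'" "sets P' = sets (rival_ref G i)"
    and min: "is_arg_min (\<lambda>a. vbp G \<phi> i P a f x) (\<lambda>a. a \<in> act_set G i) a"
    and min': "is_arg_min (\<lambda>a. vbp G \<phi> i P' a f' x) (\<lambda>a. a \<in> act_set G i) a'"
  shows "M i * norm (a - a') \<le> norm (grad_vbp G \<phi> i P' a f' x - grad_vbp G \<phi> i P a f x)"
proof -
  have a: "a \<in> act_set G i" "a' \<in> act_set G i" using min min' by (auto simp: is_arg_min_def)
  note g = has_grad_vbp[OF f x P a(1)] and g' = has_grad_vbp[OF f' x P' a(1)]
    and g'' = has_grad_vbp[OF f' x P' a(2)]
  have "0 \<le> grad_vbp G \<phi> i P a f x \<bullet> (a' - a)"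
    by (rule grad_on_arg_min_ge_0[OF act_set(3) a g min])
  moreover have "0 \<le> grad_vbp G \<phi> i P' a' f' x \<bullet> (a - a')"
    by (rule grad_on_arg_min_ge_0[OF act_set(3) a(2,1) g'' min'])
  moreover have "M i * (norm (a - a'))\<^sup>2
      \<le> (grad_vbp G \<phi> i P' a f' x - grad_vbp G \<phi> i P' a' f' x) \<bullet> (a - a')"
    by (rule strongly_convex_imp_strongly_monotone[OF act_set(3) a g' g''])
      (rule vbp_strongly_convex[OF f' x P'])
  \<comment> \<open>The two variational inequalities trade the second problem's gradient at
    \<open>a'\<close> for the first problem's gradient at \<open>a\<close>, so that both gradients
    are now taken at one action.\<close>
  ultimately have "M i * (norm (a - a'))\<^sup>2
      \<le> (grad_vbp G \<phi> i P' a f' x - grad_vbp G \<phi> i P a f x) \<bullet> (a - a')"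
    by (simp add: inner_diff_left inner_diff_right)
  also have "\<dots> \<le> norm (grad_vbp G \<phi> i P' a f' x - grad_vbp G \<phi> i P a f x) * norm (a - a')"
    by (rule norm_cauchy_schwarz)
  finally show ?thesis
    by (cases "a = a'") (simp_all add: power2_eq_square flip: mult.assoc)
qed

text \<open>One entry per player, since the comparison with \<Gamma> is between vectors; the norm of
  the difference is the largest entry.\<close>

definition strategy_dist :: "('n \<Rightarrow> 'b \<Rightarrow> 'a) \<Rightarrow> ('n \<Rightarrow> 'b \<Rightarrow> 'a) \<Rightarrow> 'n \<Rightarrow> real" where
  "strategy_dist f f' i = (SUP x\<in>type_set G i. norm (f i x - f' i x))"

lemma strategy_dist_upper:
  assumes "f \<in> strategies G" "f' \<in> strategies G" "x \<in> type_set G i"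
  shows "norm (f i x - f' i x) \<le> strategy_dist f f' i"
proof -
  obtain R where R: "\<And>a. a \<in> act_set G i \<Longrightarrow> norm a \<le> R"
    using compact_imp_bounded[OF act_set(2)[of i]] by (auto simp: bounded_iff)
  have "norm (f i x - f' i x) \<le> R + R" if "x \<in> type_set G i" for x
    using R strategy_in_act_set assms(1,2) that by (intro norm_triangle_le_diff add_mono) blast+
  then have "bdd_above ((\<lambda>x. norm (f i x - f' i x)) ` type_set G i)" by (rule bdd_aboveI2)
  from cSUP_upper[OF assms(3) this] show ?thesis by (simp add: strategy_dist_def)
qed

text \<open>The loss and its gradient change by at most the weighted sup-distances at every \<xi>,
  hence also in the suprema. The resulting bound is \<open>M i\<close> times row i of \<Gamma>
  applied to the distances.\<close>

lemma grad_vbp_strategy_lipschitz: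
  assumes lip: "risk_gradient_lipschitz G \<phi> (\<kappa>0 i) (\<kappa>1 i) i \<mu>"
    and f: "f \<in> strategies G" and f': "f' \<in> strategies G"
    and a: "a \<in> act_set G i" and x: "x \<in> type_set G i"
  shows "norm (grad_vbp G \<phi> i (nu_cond G i \<mu> x) a f x - grad_vbp G \<phi> i (nu_cond G i \<mu> x) a f' x)
    \<le> (\<Sum>j\<in>- {i}. (\<kappa>1 i * L1 i j + \<kappa>0 i * L0 i j) * strategy_dist f f' j)"
proof -
  let ?e = "strategy_dist f f'"
  have L: "0 \<le> L0 i j" "0 \<le> L1 i j" if "j \<in> - {i}" for j
    using lipschitz that by (auto simp: lipschitz_in_rivals_def)
  have *: "\<bar>game_loss G i f x a \<xi> - game_loss G i f' x a \<xi>\<bar> \<le> (\<Sum>j\<in>- {i}. L0 i j * ?e j) \<and>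
      norm (loss_grad i f x a \<xi> - loss_grad i f' x a \<xi>) \<le> (\<Sum>j\<in>- {i}. L1 i j * ?e j)"
    if \<xi>: "\<xi> \<in> space (rival_ref G i)" for \<xi>
  proof -
    let ?a = "\<lambda>f. (\<lambda>j. f j (\<xi> j))(i := a)"
    have e: "norm (?a f j - ?a f' j) \<le> ?e j" if "j \<in> - {i}" for j
      using strategy_dist_upper[OF f f', of "\<xi> j" j] that \<xi> by (auto simp: space_rival_ref)
    \<comment> \<open>Both profiles carry the action a at i, so the Lipschitz condition for profiles
      agreeing at i applies.\<close>
    have "\<bar>game_loss G i f x a \<xi> - game_loss G i f' x a \<xi>\<bar> \<le> (\<Sum>j\<in>- {i}. L0 i j * norm (?a f j - ?a f' j))
        \<and> norm (loss_grad i f x a \<xi> - loss_grad i f' x a \<xi>) \<le> (\<Sum>j\<in>- {i}. L1 i j * norm (?a f j - ?a f' j))"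
      unfolding grad_on_game_loss[OF f x a \<xi>] grad_on_game_loss[OF f' x a \<xi>] unfolding game_loss_def
      using lipschitz[unfolded lipschitz_in_rivals_def, THEN spec[of _ i], THEN conjunct2, rule_format,
          OF strategy_profile[OF f' a \<xi>] strategy_profile[OF f a \<xi>] rival_update[OF x \<xi>]]
      by simp
    moreover have "(\<Sum>j\<in>- {i}. L0 i j * norm (?a f j - ?a f' j)) \<le> (\<Sum>j\<in>- {i}. L0 i j * ?e j)"
      "(\<Sum>j\<in>- {i}. L1 i j * norm (?a f j - ?a f' j)) \<le> (\<Sum>j\<in>- {i}. L1 i j * ?e j)"
      using L e by (intro sum_mono mult_left_mono; blast)+
    ultimately show ?thesis by linarith
  qed
  have "norm (grad_vbp G \<phi> i (nu_cond G i \<mu> x) a f x - grad_vbp G \<phi> i (nu_cond G i \<mu> x) a f' x)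
      \<le> \<kappa>1 i * (SUP \<xi>\<in>space (rival_ref G i). norm (loss_grad i f x a \<xi> - loss_grad i f' x a \<xi>))
        + \<kappa>0 i * (SUP \<xi>\<in>space (rival_ref G i). \<bar>game_loss G i f x a \<xi> - game_loss G i f' x a \<xi>\<bar>)"
    using lip f f' a x unfolding risk_gradient_lipschitz_def by blast
  also have "\<dots> \<le> \<kappa>1 i * (\<Sum>j\<in>- {i}. L1 i j * ?e j) + \<kappa>0 i * (\<Sum>j\<in>- {i}. L0 i j * ?e j)"
    using * rival_ref_nonempty by (intro add_mono mult_left_mono \<kappa>_nonneg cSUP_least) auto
  also have "\<dots> = (\<Sum>j\<in>- {i}. (\<kappa>1 i * L1 i j + \<kappa>0 i * L0 i j) * ?e j)"
    by (simp add: sum_distrib_left sum.distrib distrib_right mult.assoc)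
  finally show ?thesis .
qed

abbreviation \<Gamma> :: "real^'n^'n" where
  "\<Gamma> \<equiv> Gamma_bp M L0 L1 \<kappa>0 \<kappa>1"

lemma contraction_matrix_\<Gamma>: "contraction_matrix \<Gamma>"
proof
  show "0 \<le> \<Gamma> $ i $ j" for i j
    using lipschitz \<kappa>_nonneg M_pos[of i] by (simp add: Gamma_bp_def lipschitz_in_rivals_def)
qed (rule radius)

text \<open>The first equilibrium may use arbitrary conditionals \<open>P i x\<close>, so the true
  conditionals fit in without being written as \<open>nu_cond\<close> of a Dirac belief.\<close>

lemma strategy_dist_equilibria_le:
  assumes bne: "is_bne G \<phi> P f" and bne': "is_bne G \<phi> (\<lambda>i. nu_cond G i (\<mu> i)) f'"
    and P: "\<And>i x. x \<in> type_set G i \<Longrightarrow> prob_space (P i x)"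
      "\<And>i x. x \<in> type_set G i \<Longrightarrow> sets (P i x) = sets (rival_ref G i)"
    and \<mu>: "\<And>i. is_belief G (\<mu> i)" "\<And>i. predictive_positive G i (\<mu> i)"
      "\<And>i. risk_gradient_lipschitz G \<phi> (\<kappa>0 i) (\<kappa>1 i) i (\<mu> i)"
    and d: "\<And>i x. x \<in> type_set G i \<Longrightarrow>
      norm (grad_vbp G \<phi> i (nu_cond G i (\<mu> i) x) (f i x) f x - grad_vbp G \<phi> i (P i x) (f i x) f x) \<le> M i * d i"
  shows "strategy_dist f f' i \<le> (\<Sum>j\<in>UNIV. matrix_inv (mat 1 - \<Gamma>) $ i $ j * d j)"
proof -
  interpret contraction_matrix \<Gamma> by (rule contraction_matrix_\<Gamma>)
  let ?e = "strategy_dist f f'"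
  have f: "f \<in> strategies G" and f': "f' \<in> strategies G" using bne bne' by (auto simp: is_bne_def)
  have "?e i \<le> (\<Sum>j\<in>UNIV. \<Gamma> $ i $ j * ?e j) + d i" for i
    unfolding strategy_dist_def[of f f' i]
  proof (rule cSUP_least[OF type_set(1)])
    fix x assume x: "x \<in> type_set G i"
    let ?P' = "nu_cond G i (\<mu> i) x"
    have a: "f i x \<in> act_set G i" by (rule strategy_in_act_set[OF f x])
    have P': "prob_space ?P'"
      by (rule prob_space_nu_cond[OF \<mu>(1) x predictive_positiveD[OF \<mu>(1,2) x]])
    have "M i * norm (f i x - f' i x)
        \<le> norm (grad_vbp G \<phi> i ?P' (f i x) f' x - grad_vbp G \<phi> i (P i x) (f i x) f x)"
      using bne bne' x by (intro best_response_dist_le[OF f f' x P[OF x] P']) (auto simp: is_bne_def)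
    \<comment> \<open>Inserting the gradient under \<open>?P'\<close> at the rivals' strategies f
      separates the change of strategies, under one belief, from the change of belief, at one
      profile.\<close>
    also have "\<dots> \<le> norm (grad_vbp G \<phi> i ?P' (f i x) f x - grad_vbp G \<phi> i ?P' (f i x) f' x)
        + norm (grad_vbp G \<phi> i ?P' (f i x) f x - grad_vbp G \<phi> i (P i x) (f i x) f x)"
      using norm_triangle_ineq[of "grad_vbp G \<phi> i ?P' (f i x) f' x - grad_vbp G \<phi> i ?P' (f i x) f x"
          "grad_vbp G \<phi> i ?P' (f i x) f x - grad_vbp G \<phi> i (P i x) (f i x) f x"]
      by (simp add: norm_minus_commute)
    also have "\<dots> \<le> (\<Sum>j\<in>- {i}. (\<kappa>1 i * L1 i j + \<kappa>0 i * L0 i j) * ?e j) + M i * d i"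
      by (intro add_mono grad_vbp_strategy_lipschitz[OF \<mu>(3) f f' a x] d x)
    also have "(\<Sum>j\<in>- {i}. (\<kappa>1 i * L1 i j + \<kappa>0 i * L0 i j) * ?e j) = (\<Sum>j\<in>- {i}. M i * (\<Gamma> $ i $ j * ?e j))"
      using M_pos[of i] by (intro sum.cong refl) (simp add: Gamma_bp_def)
    also have "\<dots> = (\<Sum>j\<in>UNIV. M i * (\<Gamma> $ i $ j * ?e j))"
      by (rule sum.mono_neutral_left) (auto simp: Gamma_bp_def)
    finally have "M i * norm (f i x - f' i x) \<le> M i * ((\<Sum>j\<in>UNIV. \<Gamma> $ i $ j * ?e j) + d i)"
      by (simp add: sum_distrib_left distrib_left)
    then show "norm (f i x - f' i x) \<le> (\<Sum>j\<in>UNIV. \<Gamma> $ i $ j * ?e j) + d i"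
      using M_pos[of i] by simp
  qed
  then show ?thesis
    using le_matrix_inv_mult[of "\<chi> i. ?e i" "\<chi> i. d i" i] by (simp add: matrix_vector_mult_nth)
qed

end


section \<open>Rate of convergence of the predictive distribution\<close>

text \<open>A substitute for Jensen that is affine in u: for u above v,
  \<open>u powr q = u powr (q - 1) * u\<close> and the exponent \<open>q - 1\<close> is nonpositive.
  If u has mean at most v, the right-hand side has mean at most twice
  \<open>v powr q\<close>.\<close>

lemma powr_le_affine:
  fixes u v q :: real
  assumes "0 \<le> u" "0 < v" "0 \<le> q" "q \<le> 1"
  shows "u powr q \<le> v powr q + v powr (q - 1) * u"
proof (cases "u \<le> v")
  case True
  then have "u powr q \<le> v powr q" using assms by (intro powr_mono2) auto
  moreover have "0 \<le> v powr (q - 1) * u" using assms by simp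
  ultimately show ?thesis by linarith
next
  case False
  then have "u powr q = u powr (q - 1) * u" using assms by (simp add: powr_diff)
  also have "\<dots> \<le> v powr (q - 1) * u" using assms False by (intro mult_right_mono powr_mono2') auto
  finally show ?thesis using powr_ge_zero[of v q] by linarith
qed

context bayes_game
begin

lemma abs_integral_pdens_le:
  assumes x: "x \<in> type_set G i" and \<zeta>: "\<zeta> \<in> par_set G"
    and h: "h \<in> borel_measurable (rival_ref G i)" "\<And>\<xi>. \<xi> \<in> space (rival_ref G i) \<Longrightarrow> \<bar>h \<xi>\<bar> \<le> 1"
  shows "\<bar>\<integral>\<xi>. h \<xi> * pdens G (\<xi>(i := x)) \<zeta> \<partial>rival_ref G i\<bar> \<le> pmarg G i x \<zeta>"
proof -
  have "norm (\<integral>\<xi>. h \<xi> * pdens G (\<xi>(i := x)) \<zeta> \<partial>rival_ref G i)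
      \<le> (\<integral>\<xi>. norm (h \<xi> * pdens G (\<xi>(i := x)) \<zeta>) \<partial>rival_ref G i)"
    by (rule integral_norm_bound)
  also have "\<dots> \<le> (\<integral>\<xi>. pdens G (\<xi>(i := x)) \<zeta> \<partial>rival_ref G i)"
    using pdens_nonneg[OF \<zeta> rival_update[OF x]] h(2)
    by (intro integral_mono_AE' AE_I2 integrable_pdens \<zeta> x) (auto simp: abs_mult intro!: mult_left_le_one_le)
  finally show ?thesis by (simp add: pmarg_def marginal_def)
qed

text \<open>Pointwise in \<open>\<zeta>\<close> the deviation of \<open>\<eta>(\<cdot> | x; \<zeta>)\<close> from the truth is bounded by an affine function
  of \<open>\<parallel>\<zeta> - \<zeta>\<^sup>*\<parallel>\<^sup>2\<close>: near the truth through \<open>s\<^sup>r \<le> v\<^bsup>r/2\<^esup> + v\<^bsup>r/2-1\<^esup> s\<^sup>2\<close>, far from it because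
  \<open>1 \<le> s\<^sup>2/e\<^sup>2\<close>. Hence only the second moment of the belief enters.\<close>

lemma d_TV_nu_cond_eta_cond_le:
  assumes \<mu>: "is_belief G \<mu>" "predictive_positive G i \<mu>" and x: "x \<in> type_set G i"
    and lip: "conditional_lipschitz G L r e i"
    and log_lip: "marginal_log_lipschitz G Lp \<delta> lbar i"
    and v: "0 < v" "v \<le> \<delta>\<^sup>2 / 2"
    and moment: "(\<integral>\<^sup>+\<zeta>. ennreal ((norm (\<zeta> - truth G))\<^sup>2) \<partial>\<mu>) \<le> ennreal v"
  shows "d_TV (nu_cond G i \<mu> x) (eta_cond G i (truth G) x)
    \<le> exp (Lp * \<delta>) * lbar * (4 * L * v powr (r / 2) + 2 * v / e\<^sup>2)"
proof -
  interpret prob_space \<mu> by (rule belief(1)[OF \<mu>(1)])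
  note sp = belief(3)[OF \<mu>(1)] and pos = predictive_positiveD[OF \<mu> x]
  let ?R = "rival_ref G i" and ?s = "\<lambda>\<zeta>. norm (\<zeta> - truth G)" and ?pm = "pmarg G i x"
  let ?p = "?pm (truth G)" and ?m = "\<integral>\<zeta>. pmarg G i x \<zeta> \<partial>\<mu>"
  have s_dist: "?s \<zeta> = dist (truth G) \<zeta>" for \<zeta> by (simp add: dist_norm norm_minus_commute)
  have L: "0 < L" "0 < r" "r \<le> 2" "0 < e"
    using lip by (simp_all add: conditional_lipschitz_def)
  have lip': "d_TV (eta_cond G i \<zeta> x) (eta_cond G i (truth G) x) \<le> L * ?s \<zeta> powr r"
    if "\<zeta> \<in> par_set G" "?s \<zeta> < e" "0 < ?pm \<zeta>" for \<zeta>
    using lip x that unfolding conditional_lipschitz_def s_dist by simp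
  have Lp: "0 < Lp" "0 < \<delta>" and p: "0 < ?p"
    using log_lip x by (simp_all add: marginal_log_lipschitz_def)
  have near: "0 < ?pm \<zeta> \<and> \<bar>ln (?pm \<zeta>) - ln ?p\<bar> \<le> Lp * ?s \<zeta>"
    if "\<zeta> \<in> par_set G" "?s \<zeta> < \<delta>" for \<zeta>
    using log_lip x that unfolding marginal_log_lipschitz_def s_dist by simp
  have far: "?pm \<zeta> / ?p < lbar" if "\<zeta> \<in> par_set G" for \<zeta>
    using log_lip x that by (simp add: marginal_log_lipschitz_def)
  have lbar: "0 < lbar" using far[OF truth_par] p by simp
  have pm_le: "?pm \<zeta> \<le> lbar * ?p" if "\<zeta> \<in> par_set G" for \<zeta>
    using far[OF that] p by (simp add: pos_divide_less_eq)

  have "(\<lambda>\<zeta>. (?s \<zeta>)\<^sup>2) \<in> borel_measurable (par_ref G)"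
    unfolding par_ref_def by (intro measurable_restrict_space1) measurable
  then have s_meas: "(\<lambda>\<zeta>. (?s \<zeta>)\<^sup>2) \<in> borel_measurable \<mu>"
    by (simp only: measurable_cong_sets[OF belief(2)[OF \<mu>(1)] refl])
  have s_int: "integrable \<mu> (\<lambda>\<zeta>. (?s \<zeta>)\<^sup>2)"
    using s_meas moment by (intro integrableI_nonneg) (auto simp: less_top[symmetric] top_unique)
  define S where "S = (\<integral>\<zeta>. (?s \<zeta>)\<^sup>2 \<partial>\<mu>)"
  have "ennreal S \<le> ennreal v"
    using moment nn_integral_eq_integral[OF s_int] by (simp add: S_def)
  then have S: "S \<le> v" using v(1) by simp

  \<comment> \<open>Markov's inequality in integrated form: \<open>1 - s^2 / \<delta>^2\<close> lies
    below the indicator of the ball, on which \<open>pmarg\<close> is at least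
    \<open>exp (- (Lp * \<delta>))\<close> times its true value. As
    \<open>v \<le> \<delta>^2 / 2\<close>, at least half of this remains.\<close>
  have m_lower: "exp (- (Lp * \<delta>)) * ?p / 2 \<le> ?m"
  proof -
    have "exp (- (Lp * \<delta>)) * ?p * (1 - (?s \<zeta>)\<^sup>2 / \<delta>\<^sup>2) \<le> ?pm \<zeta>" if \<zeta>: "\<zeta> \<in> par_set G" for \<zeta>
    proof (cases "?s \<zeta> < \<delta>")
      case True
      have "ln ?p - Lp * \<delta> \<le> ln (?pm \<zeta>)"
        using near[OF \<zeta> True] mult_left_mono[OF less_imp_le[OF True] less_imp_le[OF Lp(1)]] by linarith
      then have "exp (ln ?p - Lp * \<delta>) \<le> exp (ln (?pm \<zeta>))" by simp
      then have "exp (- (Lp * \<delta>)) * ?p \<le> ?pm \<zeta>"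
        using near[OF \<zeta> True] p by (simp add: exp_diff exp_minus field_simps)
      moreover have "exp (- (Lp * \<delta>)) * ?p * (1 - (?s \<zeta>)\<^sup>2 / \<delta>\<^sup>2) \<le> exp (- (Lp * \<delta>)) * ?p * 1"
        using p by (intro mult_left_mono) auto
      ultimately show ?thesis by linarith
    next
      case False
      then have "1 \<le> (?s \<zeta>)\<^sup>2 / \<delta>\<^sup>2" using Lp(2) by (simp add: power_mono)
      then have "exp (- (Lp * \<delta>)) * ?p * (1 - (?s \<zeta>)\<^sup>2 / \<delta>\<^sup>2) \<le> 0"
        using p by (intro mult_nonneg_nonpos) auto
      then show ?thesis using pmarg_nonneg[OF x \<zeta>] by linarith
    qed
    then have "(\<integral>\<zeta>. exp (- (Lp * \<delta>)) * ?p * (1 - (?s \<zeta>)\<^sup>2 / \<delta>\<^sup>2) \<partial>\<mu>) \<le> ?m"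
      using s_int integrable_pmarg[OF pos] by (intro integral_mono) (auto simp: sp)
    moreover have "(\<integral>\<zeta>. exp (- (Lp * \<delta>)) * ?p * (1 - (?s \<zeta>)\<^sup>2 / \<delta>\<^sup>2) \<partial>\<mu>)
        = exp (- (Lp * \<delta>)) * ?p * (1 - S / \<delta>\<^sup>2)"
      using s_int by (simp add: S_def prob_space)
    moreover have "exp (- (Lp * \<delta>)) * ?p * (1 / 2) \<le> exp (- (Lp * \<delta>)) * ?p * (1 - S / \<delta>\<^sup>2)"
    proof (intro mult_left_mono)
      have "S / \<delta>\<^sup>2 \<le> 1 / 2" using S v(2) Lp(2) by (simp add: pos_divide_le_eq)
      then show "1 / 2 \<le> 1 - S / \<delta>\<^sup>2" by simp
    qed (use p in auto)
    ultimately show ?thesis by linarith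
  qed

  \<comment> \<open>The leading 2 is the factor between test functions and \<open>d_TV\<close>; in
    the last term it bounds the difference of two numbers in \<open>[-1, 1]\<close>, needed outside
    the ball of radius e.\<close>
  define b where "b \<zeta> = 2 * L * (v powr (r / 2) + v powr (r / 2 - 1) * (?s \<zeta>)\<^sup>2) + 2 * (?s \<zeta>)\<^sup>2 / e\<^sup>2" for \<zeta>
  have b_nonneg: "0 \<le> b \<zeta>" for \<zeta> using L by (simp add: b_def)
  have b_int: "integrable \<mu> b" unfolding b_def using s_int by simp
  have b_le: "(\<integral>\<zeta>. b \<zeta> \<partial>\<mu>) \<le> 4 * L * v powr (r / 2) + 2 * v / e\<^sup>2"
  proof -
    have "(\<integral>\<zeta>. b \<zeta> \<partial>\<mu>) = 2 * L * (v powr (r / 2) + v powr (r / 2 - 1) * S) + 2 * S / e\<^sup>2"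
      unfolding b_def using s_int by (simp add: S_def prob_space)
    also have "\<dots> \<le> 2 * L * (v powr (r / 2) + v powr (r / 2 - 1) * v) + 2 * v / e\<^sup>2"
      using S L by (intro add_mono mult_left_mono divide_right_mono) auto
    also have "v powr (r / 2 - 1) * v = v powr (r / 2)" using v(1) by (simp add: powr_diff)
    finally show ?thesis by simp
  qed

  have "d_TV (nu_cond G i \<mu> x) (eta_cond G i (truth G) x)
      \<le> (2 * (exp (Lp * \<delta>) * lbar * (4 * L * v powr (r / 2) + 2 * v / e\<^sup>2))) / 2"
  proof (rule d_TV_le)
    fix h :: "('n \<Rightarrow> 'b) \<Rightarrow> real"
    assume "h \<in> borel_measurable (nu_cond G i \<mu> x)"
      and "\<And>\<xi>. \<xi> \<in> space (nu_cond G i \<mu> x) \<Longrightarrow> \<bar>h \<xi>\<bar> \<le> 1"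
    then have h: "h \<in> borel_measurable ?R" "\<And>\<xi>. \<xi> \<in> space ?R \<Longrightarrow> \<bar>h \<xi>\<bar> \<le> 1"
      by (simp_all add: measurable_cong_sets[OF sets_nu_cond refl] sets_eq_imp_space_eq[OF sets_nu_cond])
    define J where "J \<zeta> = (\<integral>\<xi>. h \<xi> * pdens G (\<xi>(i := x)) \<zeta> \<partial>?R)" for \<zeta>
    define E where "E = (\<integral>\<xi>. h \<xi> \<partial>eta_cond G i (truth G) x)"
    have J_int: "integrable \<mu> J"
      unfolding J_def by (rule integral_predictive_density(3)[OF \<mu>(1) x pos h])
    have J_le: "\<bar>J \<zeta>\<bar> \<le> ?pm \<zeta>" if "\<zeta> \<in> par_set G" for \<zeta>
      unfolding J_def by (rule abs_integral_pdens_le[OF x that h])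
    have E: "E = J (truth G) / ?p" unfolding E_def J_def by (rule integral_eta_cond[OF truth_par x p h(1)])
    have E1: "\<bar>E\<bar> \<le> 1" using J_le[OF truth_par] p by (simp add: E)
    \<comment> \<open>\<open>J \<zeta> / pmarg\<close> is the mean of h under the conditional for
      \<zeta>. Where the marginal vanishes that is no probability measure, but then
      \<open>J \<zeta>\<close> vanishes too.\<close>
    have dev: "\<bar>J \<zeta> - ?pm \<zeta> * E\<bar> \<le> ?pm \<zeta> * b \<zeta>" if \<zeta>: "\<zeta> \<in> par_set G" for \<zeta>
    proof (cases "?pm \<zeta> = 0")
      case True
      then show ?thesis using J_le[OF \<zeta>] by simp
    next
      case False
      then have pm: "0 < ?pm \<zeta>" using pmarg_nonneg[OF x \<zeta>] by linarith
      have "\<bar>J \<zeta> / ?pm \<zeta> - E\<bar> \<le> b \<zeta>"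
      proof (cases "?s \<zeta> < e")
        case True
        have "\<bar>J \<zeta> / ?pm \<zeta> - E\<bar> \<le> 2 * 1 * d_TV (eta_cond G i \<zeta> x) (eta_cond G i (truth G) x)"
          unfolding E_def J_def integral_eta_cond[OF \<zeta> x pm h(1), symmetric]
          using h by (intro abs_integral_diff_le_d_TV prob_space_eta_cond \<zeta> x pm truth_par p)
            (simp_all add: measurable_cong_sets[OF sets_eta_cond refl] sets_eq_imp_space_eq[OF sets_eta_cond])
        also have "\<dots> \<le> 2 * L * ?s \<zeta> powr r" using lip'[OF \<zeta> True pm] by simp
        also have "?s \<zeta> powr r = (?s \<zeta>)\<^sup>2 powr (r / 2)"
          by (simp add: powr_powr flip: powr_numeral)
        also have "2 * L * (?s \<zeta>)\<^sup>2 powr (r / 2)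
            \<le> 2 * L * (v powr (r / 2) + v powr (r / 2 - 1) * (?s \<zeta>)\<^sup>2)"
          using L v by (intro mult_left_mono powr_le_affine) auto
        also have "\<dots> \<le> b \<zeta>" by (simp add: b_def)
        finally show ?thesis .
      next
        case False
        then have "1 \<le> (?s \<zeta>)\<^sup>2 / e\<^sup>2" using L(4) by (simp add: power_mono)
        moreover have "\<bar>J \<zeta> / ?pm \<zeta>\<bar> \<le> 1" using J_le[OF \<zeta>] pm by simp
        moreover have "0 \<le> 2 * L * (v powr (r / 2) + v powr (r / 2 - 1) * (?s \<zeta>)\<^sup>2)" using L by simp
        ultimately show ?thesis using E1 unfolding b_def by linarith
      qed
      then have "?pm \<zeta> * \<bar>J \<zeta> / ?pm \<zeta> - E\<bar> \<le> ?pm \<zeta> * b \<zeta>" using pm by simp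
      moreover have "?pm \<zeta> * \<bar>J \<zeta> / ?pm \<zeta> - E\<bar> = \<bar>?pm \<zeta> * (J \<zeta> / ?pm \<zeta> - E)\<bar>" using pm by (simp add: abs_mult)
      ultimately show ?thesis using pm by (simp add: right_diff_distrib)
    qed
    have "(\<integral>\<xi>. h \<xi> \<partial>nu_cond G i \<mu> x) - E = (\<integral>\<zeta>. J \<zeta> \<partial>\<mu>) / ?m - E"
      using integral_nu_cond[OF \<mu>(1) x pos h] by (simp add: J_def)
    \<comment> \<open>The constant E is written as its own mixture with the weights
      \<open>pmarg\<close>, so that only deviations from the truth remain in the numerator.\<close>
    also have "\<dots> = (\<integral>\<zeta>. J \<zeta> - ?pm \<zeta> * E \<partial>\<mu>) / ?m"
      using J_int integrable_pmarg[OF pos] pos by (simp add: field_simps)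
    finally have "\<bar>(\<integral>\<xi>. h \<xi> \<partial>nu_cond G i \<mu> x) - E\<bar> = \<bar>\<integral>\<zeta>. J \<zeta> - ?pm \<zeta> * E \<partial>\<mu>\<bar> / ?m"
      using pos by simp
    also have "\<dots> \<le> (lbar * ?p * (4 * L * v powr (r / 2) + 2 * v / e\<^sup>2)) / ?m"
    proof (rule divide_right_mono)
      have "norm (\<integral>\<zeta>. J \<zeta> - ?pm \<zeta> * E \<partial>\<mu>) \<le> (\<integral>\<zeta>. norm (J \<zeta> - ?pm \<zeta> * E) \<partial>\<mu>)"
        by (rule integral_norm_bound)
      also have "\<dots> \<le> (\<integral>\<zeta>. lbar * ?p * b \<zeta> \<partial>\<mu>)"
      proof (rule integral_mono)
        show "norm (J \<zeta> - ?pm \<zeta> * E) \<le> lbar * ?p * b \<zeta>" if "\<zeta> \<in> space \<mu>" for \<zeta>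
          using dev[of \<zeta>] mult_right_mono[OF pm_le b_nonneg, of \<zeta> \<zeta>] that by (simp add: sp)
      qed (use J_int integrable_pmarg[OF pos] b_int in auto)
      also have "\<dots> \<le> lbar * ?p * (4 * L * v powr (r / 2) + 2 * v / e\<^sup>2)"
        using b_le lbar p by (simp add: mult_left_mono)
      finally show "\<bar>\<integral>\<zeta>. J \<zeta> - ?pm \<zeta> * E \<partial>\<mu>\<bar> \<le> lbar * ?p * (4 * L * v powr (r / 2) + 2 * v / e\<^sup>2)"
        by simp
    qed (use pos in simp)
    \<comment> \<open>The numerator and the lower bound of \<open>?m\<close> both contain the true
      marginal \<open>?p\<close>; it cancels, and the estimate becomes uniform in x.\<close>
    also have "\<dots> \<le> (lbar * ?p * (4 * L * v powr (r / 2) + 2 * v / e\<^sup>2)) / (exp (- (Lp * \<delta>)) * ?p / 2)"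
      using m_lower pos p lbar L v
      by (intro divide_left_mono mult_nonneg_nonneg mult_pos_pos add_nonneg_nonneg) auto
    also have "\<dots> = 2 * (exp (Lp * \<delta>) * lbar * (4 * L * v powr (r / 2) + 2 * v / e\<^sup>2))"
      using p by (simp add: exp_minus field_simps)
    finally show "\<bar>(\<integral>\<xi>. h \<xi> \<partial>nu_cond G i \<mu> x) - (\<integral>\<xi>. h \<xi> \<partial>eta_cond G i (truth G) x)\<bar>
        \<le> 2 * (exp (Lp * \<delta>) * lbar * (4 * L * v powr (r / 2) + 2 * v / e\<^sup>2))"
      by (simp add: E_def)
  qed
  then show ?thesis by simp
qed

section \<open>Histories and finitely many simultaneous events\<close>

lemma prob_space_history_measure: "prob_space (history_measure G t)"
proof -
  have "prob_space (eta G (truth G))"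
  proof
    have "(\<lambda>\<theta>. pdens G \<theta> (truth G)) \<in> borel_measurable (PiM UNIV (type_ref G))"
      using measurable_compose[OF measurable_Pair2'[of "truth G" "par_ref G"] pdens_measurable] truth_par
      by (simp add: space_par_ref)
    then show "emeasure (eta G (truth G)) (space (eta G (truth G))) = 1"
      using pdens_total[OF truth_par] unfolding eta_def
      by (subst emeasure_density) (auto intro!: nn_integral_cong simp: cong: nn_integral_cong)
  qed
  then show ?thesis unfolding history_measure_def by (intro prob_space_PiM)
qed

end

text \<open>A union bound over the complements of measurable inner sets, each of probability at most
  \<open>\<epsilon> / n\<close>. A null set containing the failures of R is removed at no cost; S
  itself may be non-measurable.\<close>

lemma prob_at_least_finite_Inter:
  fixes Q :: "'i::finite \<Rightarrow> 'w \<Rightarrow> bool"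
  assumes P: "prob_space P"
    and Q: "\<And>i. prob_at_least P (Q i) (1 - \<epsilon> / real CARD('i))"
    and ae: "AE w in P. R w"
    and concl: "\<And>w. w \<in> space P \<Longrightarrow> (\<And>i. Q i w) \<Longrightarrow> R w \<Longrightarrow> S w"
  shows "prob_at_least P S (1 - \<epsilon>)"
proof -
  interpret prob_space P by fact
  have "\<forall>i. \<exists>E. E \<in> sets P \<and> (\<forall>w\<in>E. Q i w) \<and> 1 - \<epsilon> / real CARD('i) \<le> prob E"
    using Q by (auto simp: prob_at_least_def)
  then obtain E where E: "\<And>i. E i \<in> sets P" "\<And>i w. w \<in> E i \<Longrightarrow> Q i w"
      "\<And>i. 1 - \<epsilon> / real CARD('i) \<le> prob (E i)"
    using choice[of "\<lambda>i E. E \<in> sets P \<and> (\<forall>w\<in>E. Q i w) \<and> 1 - \<epsilon> / real CARD('i) \<le> prob E"] by blast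
  obtain N where N: "{w \<in> space P. \<not> R w} \<subseteq> N" "emeasure P N = 0" "N \<in> sets P"
    using ae by (rule AE_E)
  let ?I = "\<Inter>i. E i"
  have I: "?I \<in> sets P" using E(1) by (intro sets.finite_INT) auto
  have "prob (space P - ?I) \<le> prob (\<Union>i. space P - E i)"
    using E(1) by (intro finite_measure_mono) auto
  also have "\<dots> \<le> (\<Sum>i\<in>UNIV. prob (space P - E i))"
    using E(1) by (intro finite_measure_subadditive_finite) auto
  also have "\<dots> \<le> (\<Sum>i\<in>(UNIV :: 'i set). \<epsilon> / real CARD('i))"
    using E(1,3) by (intro sum_mono) (simp add: prob_compl algebra_simps)
  also have "\<dots> = \<epsilon>" by simp
  finally have "1 - \<epsilon> \<le> prob ?I" using I by (simp add: prob_compl)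
  also have "\<dots> = prob (?I - N)"
    using I N by (intro measure_Diff_null_set[symmetric]) (auto simp: null_sets_def)
  finally have "1 - \<epsilon> \<le> prob (?I - N)" .
  moreover have "\<forall>w\<in>?I - N. S w"
  proof
    fix w assume w: "w \<in> ?I - N"
    then have "w \<in> space P" using I sets.sets_into_space by blast
    with w N(1) E(2) show "S w" by (intro concl) auto
  qed
  ultimately show ?thesis using I N(3) by (auto simp: prob_at_least_def)
qed

lemma Max_range_mono:
  fixes f g :: "'i::finite \<Rightarrow> 'c::linorder"
  assumes "\<And>i. f i \<le> g i"
  shows "Max (range f) \<le> Max (range g)"
proof (rule Max.boundedI)
  fix y assume "y \<in> range f"
  then obtain i where "y \<le> g i" using assms by blast
  also have "g i \<le> Max (range g)" by simp
  finally show "y \<le> Max (range g)" .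
qed simp_all

lemma eventually_powr_le:
  fixes a b c :: real
  assumes "0 < a" "0 < b"
  shows "eventually (\<lambda>t. c * (real t - 1) powr (- a) \<le> b) sequentially"
proof -
  have "filterlim (\<lambda>t. real t - 1) at_top sequentially"
    using filterlim_tendsto_add_at_top[OF tendsto_const[of "-1"] filterlim_real_sequentially] by simp
  then have "(\<lambda>t. (real t - 1) powr (- a)) \<longlonglongrightarrow> 0" using assms(1) by (intro tendsto_neg_powr) auto
  then have "(\<lambda>t. c * (real t - 1) powr (- a)) \<longlonglongrightarrow> c * 0" by (intro tendsto_intros)
  then have "eventually (\<lambda>t. c * (real t - 1) powr (- a) < b) sequentially"
    using assms(2) by (intro order_tendstoD) auto
  then show ?thesis by eventually_elim simp
qed

section \<open>Gradient error, equilibrium distance and rate\<close>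

context bp_game
begin

lemma grad_vbp_nu_cond_diff_le:
  assumes \<mu>: "is_belief G \<mu>" "predictive_positive G i \<mu>" "weights_controlled G (W i) wb l i \<mu>"
    and x: "x \<in> type_set G i" and pos: "0 < pmarg G i x (truth G)"
    and a: "a \<in> act_set G i" and f: "f \<in> strategies G"
  shows "norm (grad_vbp G \<phi> i (nu_cond G i \<mu> x) a f x - grad_vbp G \<phi> i (eta_cond G i (truth G) x) a f x)
    \<le> (2 * wb * gbar i + gbar i * l) * d_TV (nu_cond G i \<mu> x) (eta_cond G i (truth G) x)"
  using \<mu>(3) f a x pos unfolding weights_controlled_def
  by (intro grad_vbp_diff_le prob_space_nu_cond[OF \<mu>(1) x] predictive_positiveD[OF \<mu>(1,2)]
      prob_space_eta_cond truth_par) auto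

lemma equilibrium_distance_bounds:
  assumes \<mu>: "\<And>i. is_belief G (\<mu> i)" "\<And>i. predictive_positive G i (\<mu> i)"
    and \<mu>': "\<And>i. is_belief G (\<mu>' i)" "\<And>i. predictive_positive G i (\<mu>' i)"
      "\<And>i. risk_gradient_lipschitz G \<phi> (\<kappa>0 i) (\<kappa>1 i) i (\<mu>' i)"
    and bne: "is_bne G \<phi> (\<lambda>i. nu_cond G i (\<mu> i)) f" "is_bne G \<phi> (\<lambda>i. nu_cond G i (\<mu>' i)) f'"
  shows "strat_norm G (\<lambda>i x. f i x - f' i x)
    \<le> (MAX i. \<Sum>j\<in>UNIV. matrix_inv (mat 1 - \<Gamma>) $ i $ j *
         (1 / M j * (SUP x\<in>type_set G j.
            norm (grad_vbp G \<phi> j (nu_cond G j (\<mu> j) x) (f j x) f x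
                  - grad_vbp G \<phi> j (nu_cond G j (\<mu>' j) x) (f j x) f x))))"
proof -
  let ?\<Delta> = "\<lambda>j x. norm (grad_vbp G \<phi> j (nu_cond G j (\<mu> j) x) (f j x) f x
      - grad_vbp G \<phi> j (nu_cond G j (\<mu>' j) x) (f j x) f x)"
  let ?d = "\<lambda>j. 1 / M j * (SUP x\<in>type_set G j. ?\<Delta> j x)"
  let ?b = "\<lambda>i. \<Sum>j\<in>UNIV. matrix_inv (mat 1 - \<Gamma>) $ i $ j * ?d j"
  have f: "f \<in> strategies G" using bne by (simp add: is_bne_def)
  have prob: "prob_space (nu_cond G i (\<mu> i) x)" "prob_space (nu_cond G i (\<mu>' i) x)"
    if "x \<in> type_set G i" for i x
    using that \<mu> \<mu>' by (auto intro!: prob_space_nu_cond predictive_positiveD)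
  have le: "strategy_dist f f' i \<le> ?b i" for i
  proof (rule strategy_dist_equilibria_le[OF bne prob(1) _ \<mu>'])
    fix i x assume x: "x \<in> type_set G i"
    note a = strategy_in_act_set[OF f]
    \<comment> \<open>Without this bound the supremum in the conclusion need not dominate the
      individual gradient differences.\<close>
    have "bdd_above (?\<Delta> i ` type_set G i)"
      using norm_grad_vbp_le[OF f _ prob(1) sets_nu_cond a] norm_grad_vbp_le[OF f _ prob(2) sets_nu_cond a]
      by (intro bdd_aboveI2[of _ _ "gbar i + gbar i"] norm_triangle_le_diff add_mono) blast+
    from cSUP_upper[OF x this] M_pos[of i]
    show "norm (grad_vbp G \<phi> i (nu_cond G i (\<mu>' i) x) (f i x) f x
        - grad_vbp G \<phi> i (nu_cond G i (\<mu> i) x) (f i x) f x) \<le> M i * ?d i"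
      by (simp add: norm_minus_commute)
  qed simp_all
  have "strat_norm G (\<lambda>i x. f i x - f' i x) = (MAX i. strategy_dist f f' i)"
    by (simp add: strat_norm_def strategy_dist_def)
  also have "\<dots> \<le> (MAX i. ?b i)"
    by (rule Max_range_mono) (rule le)
  finally show ?thesis .
qed

lemma equilibrium_rate:
  assumes ae: "\<And>t. 1 \<le> t \<Longrightarrow> AE h in history_measure G t.
      (\<forall>i. regular_belief G \<phi> (W i) (\<kappa>0 i) (\<kappa>1 i) (wbar i) (lam i) i (posterior G i t h)) \<and>
      is_bne G \<phi> (\<lambda>i. nu_cond G i (posterior G i t h)) (ft t h)"
    and bne: "is_bne G \<phi> (\<lambda>i. eta_cond G i (truth G)) fstar"
    and contracts: "\<And>i. posterior_contracts G i"
    and lip: "\<And>i. conditional_lipschitz G (L\<^sub>\<eta> i) (r i) (\<epsilon>\<^sub>B i) i"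
    and log_lip: "\<And>i. marginal_log_lipschitz G (L\<^sub>p i) \<delta> lbar i"
    and wbar: "\<And>i. 0 < wbar i" and lam: "\<And>i. 0 \<le> lam i"
    and \<epsilon>: "\<epsilon> \<in> {0<..<1}"
  shows "\<exists>c1>0. \<exists>c2>0. \<exists>T\<ge>2. \<exists>T'\<ge>2. \<forall>t>max T T'.
    prob_at_least (history_measure G t)
      (\<lambda>h. strat_norm G (\<lambda>i x. ft t h i x - fstar i x)
         \<le> (MAX i. \<Sum>j\<in>UNIV. matrix_inv (mat 1 - \<Gamma>) $ i $ j *
              (2 / M j * (wbar j + lam j) * gbar j * exp (L\<^sub>p j * \<delta>) *
                (L\<^sub>\<eta> j * exp (L\<^sub>p j * \<delta>) + 2 * (lbar / \<delta>\<^sup>2)) * c2))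
           * (real t - 1) powr (- ((MIN i. r i) * c1 / 2))) (1 - \<epsilon>)"
proof -
  let ?n = "real CARD('n)"
  have L: "0 < L\<^sub>\<eta> i" "0 < r i" "r i \<le> 2" "0 < \<epsilon>\<^sub>B i" for i
    using lip[of i] by (auto simp: conditional_lipschitz_def)
  have \<delta>: "0 < \<delta>" and pm: "\<And>i x. x \<in> type_set G i \<Longrightarrow> 0 < pmarg G i x (truth G)"
    using log_lip by (auto simp: marginal_log_lipschitz_def)
  have lbar: "0 < lbar"
  proof -
    obtain i :: 'n and x where x: "x \<in> type_set G i" using type_set(1) by blast
    then have "pmarg G i x (truth G) / pmarg G i x (truth G) < lbar"
      using log_lip[of i] truth_par unfolding marginal_log_lipschitz_def by blast
    then show ?thesis using pm[OF x] by simp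
  qed

  define moment where "moment i t h c1 c2 \<longleftrightarrow>
      (\<integral>\<^sup>+\<zeta>. ennreal ((norm (\<zeta> - truth G))\<^sup>2) \<partial>posterior G i t h) \<le> ennreal (c2 * (real t - 1) powr (- c1))"
    for i t h c1 c2
  have n: "1 \<le> ?n" by (simp add: Suc_le_eq card_gt_0_iff)
  then have "\<epsilon> < ?n" using \<epsilon> less_le_trans[of \<epsilon> 1 ?n] by simp
  \<comment> \<open>The admissible failure probability is shared equally among the players.\<close>
  then have "\<epsilon> / ?n \<in> {0<..<1}" using \<epsilon> by (auto simp: divide_less_eq)
  then have "\<forall>i. \<exists>c1 c2 T. 0 < c1 \<and> 0 < c2 \<and>
      (\<forall>t>T. prob_at_least (history_measure G t) (\<lambda>h. moment i t h c1 c2) (1 - \<epsilon> / ?n))"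
    using contracts unfolding posterior_contracts_def moment_def by blast
  then obtain c1 c2 T where c: "\<And>i. 0 < c1 i" "\<And>i. 0 < c2 i"
    and conc: "\<And>i t. T i < t \<Longrightarrow>
      prob_at_least (history_measure G t) (\<lambda>h. moment i t h (c1 i) (c2 i)) (1 - \<epsilon> / ?n)"
    by metis

  \<comment> \<open>One power must serve all players: since \<open>t - 1 \<ge> 1\<close>, the
    product of the two minima gives the slowest decay.\<close>
  define C where "C = (MIN i. c1 i)"
  define \<rho> where "\<rho> = (MIN i. r i)"
  have C: "0 < C" "\<And>i. C \<le> c1 i" using c by (auto simp: C_def)
  have \<rho>: "0 < \<rho>" "\<And>i. \<rho> \<le> r i" using L by (auto simp: \<rho>_def)
  \<comment> \<open>\<open>F\<close> is the part of the claimed constant that must dominate total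
    variation, up to \<open>c2\<close>; \<open>K\<close> is the constant that the total variation
    estimate actually yields.\<close>
  define F where "F i = exp (L\<^sub>p i * \<delta>) * (L\<^sub>\<eta> i * exp (L\<^sub>p i * \<delta>) + 2 * (lbar / \<delta>\<^sup>2))" for i
  define K where "K i = exp (L\<^sub>p i * \<delta>) * lbar * (4 * L\<^sub>\<eta> i * c2 i powr (r i / 2) + 2 * c2 i / (\<epsilon>\<^sub>B i)\<^sup>2)" for i
  have F: "0 < F i" for i using L lbar \<delta> by (auto simp: F_def intro!: mult_pos_pos add_pos_pos)
  have K: "0 \<le> K i" for i
    using L[of i] lbar c[of i] by (auto simp: K_def intro!: mult_nonneg_nonneg add_nonneg_nonneg)
  \<comment> \<open>The sum dominates each ratio \<open>K i / F i\<close>, and the 1 ensures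
    positivity.\<close>
  define c2' where "c2' = 1 + (\<Sum>i\<in>UNIV. K i / F i)"
  have c2': "0 < c2'" using K F by (auto simp: c2'_def intro!: add_pos_nonneg sum_nonneg divide_nonneg_pos)
  have KF: "K i \<le> F i * c2'" for i
  proof -
    have "K i / F i \<le> (\<Sum>i\<in>UNIV. K i / F i)"
      using K F by (intro member_le_sum) (auto intro: divide_nonneg_pos)
    then show ?thesis using F[of i] by (simp add: c2'_def pos_divide_le_eq algebra_simps)
  qed
  define D where "D j = 2 / M j * (wbar j + lam j) * gbar j * exp (L\<^sub>p j * \<delta>) *
      (L\<^sub>\<eta> j * exp (L\<^sub>p j * \<delta>) + 2 * (lbar / \<delta>\<^sup>2)) * c2'" for j

  \<comment> \<open>This gives the second threshold: from there on the moment bound meets the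
    requirement \<open>v \<le> \<delta>^2 / 2\<close> of the total variation estimate.\<close>
  have "eventually (\<lambda>t. \<forall>i. c2 i * (real t - 1) powr (- c1 i) \<le> \<delta>\<^sup>2 / 2) sequentially"
    using c \<delta> by (intro eventually_all_finite eventually_powr_le) auto
  then obtain T' where T': "\<And>t i. T' \<le> t \<Longrightarrow> c2 i * (real t - 1) powr (- c1 i) \<le> \<delta>\<^sup>2 / 2"
    unfolding eventually_sequentially by blast

  have main: "strat_norm G (\<lambda>i x. ft t h i x - fstar i x)
      \<le> (MAX i. \<Sum>j\<in>UNIV. matrix_inv (mat 1 - \<Gamma>) $ i $ j * D j) * (real t - 1) powr (- (\<rho> * C / 2))"
    if t: "2 \<le> t" "T' \<le> t" and h: "h \<in> space (history_measure G t)"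
      and mom: "\<And>i. moment i t h (c1 i) (c2 i)"
      and reg: "\<And>i. regular_belief G \<phi> (W i) (\<kappa>0 i) (\<kappa>1 i) (wbar i) (lam i) i (posterior G i t h)"
      and bnet: "is_bne G \<phi> (\<lambda>i. nu_cond G i (posterior G i t h)) (ft t h)" for t h
  proof -
    let ?\<tau> = "real t - 1" and ?\<mu> = "\<lambda>i. posterior G i t h"
    let ?q = "?\<tau> powr (- (\<rho> * C / 2))"
    let ?b = "\<lambda>i. \<Sum>j\<in>UNIV. matrix_inv (mat 1 - \<Gamma>) $ i $ j * D j"
    have \<tau>: "1 \<le> ?\<tau>" using t by simp
    have \<mu>: "is_belief G (?\<mu> i)" "predictive_positive G i (?\<mu> i)"
      "risk_gradient_lipschitz G \<phi> (\<kappa>0 i) (\<kappa>1 i) i (?\<mu> i)"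
      "weights_controlled G (W i) (wbar i) (lam i) i (?\<mu> i)" for i
      using reg[of i] is_belief_posterior[OF h] by (auto simp: regular_belief_def)
    have f: "fstar \<in> strategies G" using bne by (simp add: is_bne_def)
    have tv: "d_TV (nu_cond G i (?\<mu> i) x) (eta_cond G i (truth G) x) \<le> F i * c2' * ?q"
      if x: "x \<in> type_set G i" for i x
    proof -
      define v where "v = c2 i * ?\<tau> powr (- c1 i)"
      have v: "0 < v" "v \<le> \<delta>\<^sup>2 / 2" using c[of i] \<tau> T'[OF t(2), of i] by (auto simp: v_def)
      \<comment> \<open>\<open>\<rho> * C \<le> c1 i * r i\<close> controls the term
        \<open>v powr (r i / 2)\<close>; with \<open>r i \<le> 2\<close> it also gives
        \<open>\<rho> * C \<le> 2 * c1 i\<close>, which controls the term linear in v.\<close>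
      have prod: "\<rho> * C \<le> c1 i * r i"
        using mult_mono[OF \<rho>(2)[of i] C(2)[of i]] C(1) L(2)[of i] by (simp add: mult.commute)
      also have "\<dots> \<le> c1 i * 2" using c(1)[of i] L(3)[of i] by simp
      finally have prod2: "\<rho> * C \<le> c1 i * 2" .
      have "v powr (r i / 2) = c2 i powr (r i / 2) * ?\<tau> powr (- (c1 i * r i / 2))"
        using c(2)[of i] by (simp add: v_def powr_mult powr_powr)
      also have "\<dots> \<le> c2 i powr (r i / 2) * ?q"
        using prod \<tau> by (intro mult_left_mono powr_mono) auto
      finally have v1: "v powr (r i / 2) \<le> c2 i powr (r i / 2) * ?q" .
      have v2: "v \<le> c2 i * ?q"
        unfolding v_def using prod2 \<tau> c(2)[of i] by (intro mult_left_mono powr_mono) auto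
      have "d_TV (nu_cond G i (?\<mu> i) x) (eta_cond G i (truth G) x)
          \<le> exp (L\<^sub>p i * \<delta>) * lbar * (4 * L\<^sub>\<eta> i * v powr (r i / 2) + 2 * v / (\<epsilon>\<^sub>B i)\<^sup>2)"
        using mom[of i] unfolding moment_def v_def[symmetric]
        by (rule d_TV_nu_cond_eta_cond_le[OF \<mu>(1,2) x lip log_lip v])
      also have "\<dots> \<le> exp (L\<^sub>p i * \<delta>) * lbar *
          (4 * L\<^sub>\<eta> i * (c2 i powr (r i / 2) * ?q) + 2 * (c2 i * ?q) / (\<epsilon>\<^sub>B i)\<^sup>2)"
        using v1 v2 L[of i] lbar by (intro mult_left_mono add_mono divide_right_mono) auto
      also have "\<dots> = K i * ?q" by (simp add: K_def algebra_simps)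
      also have "\<dots> \<le> F i * c2' * ?q" using KF[of i] by (intro mult_right_mono) auto
      finally show ?thesis .
    qed
    \<comment> \<open>The truth takes the first place: gradients are compared along
      \<open>fstar\<close>, and the Lipschitz condition is required of the posterior.\<close>
    have le: "strategy_dist fstar (ft t h) i \<le> (\<Sum>j\<in>UNIV. matrix_inv (mat 1 - \<Gamma>) $ i $ j * (D j * ?q))" for i
    proof (rule strategy_dist_equilibria_le[OF bne bnet prob_space_eta_cond[OF truth_par _ pm] _ \<mu>(1-3)])
      fix i x assume x: "x \<in> type_set G i"
      have "norm (grad_vbp G \<phi> i (nu_cond G i (?\<mu> i) x) (fstar i x) fstar x
            - grad_vbp G \<phi> i (eta_cond G i (truth G) x) (fstar i x) fstar x)
          \<le> (2 * wbar i * gbar i + gbar i * lam i) * d_TV (nu_cond G i (?\<mu> i) x) (eta_cond G i (truth G) x)"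
        by (rule grad_vbp_nu_cond_diff_le[OF \<mu>(1,2,4) x pm[OF x] strategy_in_act_set[OF f x] f])
      \<comment> \<open>The claimed coefficient leaves room: it contains \<open>2 * lam i\<close>
        where the gradient estimate has \<open>lam i\<close>.\<close>
      also have "\<dots> \<le> (2 * (wbar i + lam i) * gbar i) * (F i * c2' * ?q)"
      proof (rule mult_mono[OF _ tv[OF x]])
        show "2 * wbar i * gbar i + gbar i * lam i \<le> 2 * (wbar i + lam i) * gbar i"
          using mult_nonneg_nonneg[OF gbar_nonneg[of i] lam[of i]] by (simp add: algebra_simps)
        show "0 \<le> 2 * (wbar i + lam i) * gbar i" using gbar_nonneg[of i] wbar[of i] lam[of i] by simp
        show "0 \<le> d_TV (nu_cond G i (?\<mu> i) x) (eta_cond G i (truth G) x)"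
          by (intro d_TV_nonneg prob_space_nu_cond[OF \<mu>(1) x predictive_positiveD[OF \<mu>(1,2) x]]
              prob_space_eta_cond truth_par x pm) simp
      qed
      also have "\<dots> = M i * (D i * ?q)" using M_pos[of i] by (simp add: D_def F_def)
      finally show "norm (grad_vbp G \<phi> i (nu_cond G i (?\<mu> i) x) (fstar i x) fstar x
          - grad_vbp G \<phi> i (eta_cond G i (truth G) x) (fstar i x) fstar x) \<le> M i * (D i * ?q)" .
    qed simp_all
    have "strat_norm G (\<lambda>i x. ft t h i x - fstar i x) = (MAX i. strategy_dist fstar (ft t h) i)"
      by (simp add: strat_norm_def strategy_dist_def norm_minus_commute)
    also have "\<dots> \<le> (MAX i. ?b i) * ?q"
    proof (rule Max.boundedI)
      fix y assume "y \<in> range (strategy_dist fstar (ft t h))"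
      then obtain i where "y = strategy_dist fstar (ft t h) i" by blast
      then have "y \<le> ?b i * ?q" using le[of i] by (simp add: sum_distrib_right mult.assoc)
      also have "\<dots> \<le> (MAX i. ?b i) * ?q" by (intro mult_right_mono Max_ge) auto
      finally show "y \<le> (MAX i. ?b i) * ?q" .
    qed simp_all
    finally show ?thesis .
  qed

  define T0 where "T0 = max 2 (Max (range T))"
  show ?thesis
  proof (rule exI[of _ C], rule conjI[OF C(1)], rule exI[of _ c2'], rule conjI[OF c2'], rule exI[of _ T0],
      rule conjI, simp add: T0_def, rule exI[of _ "max 2 T'"], rule conjI, simp, intro allI impI)
    fix t assume t: "max T0 (max 2 T') < t"
    have T: "T i < t" for i
      using t Max_ge[of "range T" "T i"] by (auto simp: T0_def)
    show "prob_at_least (history_measure G t)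
        (\<lambda>h. strat_norm G (\<lambda>i x. ft t h i x - fstar i x)
           \<le> (MAX i. \<Sum>j\<in>UNIV. matrix_inv (mat 1 - \<Gamma>) $ i $ j *
                (2 / M j * (wbar j + lam j) * gbar j * exp (L\<^sub>p j * \<delta>) *
                  (L\<^sub>\<eta> j * exp (L\<^sub>p j * \<delta>) + 2 * (lbar / \<delta>\<^sup>2)) * c2'))
             * (real t - 1) powr (- ((MIN i. r i) * C / 2))) (1 - \<epsilon>)"
      using t unfolding D_def[symmetric] \<rho>_def[symmetric]
      by (intro prob_at_least_finite_Inter[OF prob_space_history_measure conc[OF T] ae] main) auto
  qed
qed

end

theorem theorem6p2:
  fixes G :: "('n::finite, 'a::euclidean_space, 'b::euclidean_space, 'z::euclidean_space) bgame"
    and \<phi> :: "real measure \<Rightarrow> real"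
    and W :: "'n \<Rightarrow> ('n \<Rightarrow> 'b) measure \<Rightarrow> ('a \<Rightarrow> ('n \<Rightarrow> 'b) \<Rightarrow> real) \<Rightarrow> 'a \<Rightarrow> ('n \<Rightarrow> 'b) \<Rightarrow> real"
    and M \<kappa>0 \<kappa>1 gbar wbar lam :: "'n \<Rightarrow> real"
    and L0 L1 :: "'n \<Rightarrow> 'n \<Rightarrow> real"
  assumes game: "bayesian_game G"
    and M: "strongly_convex_loss G M"
    and L: "lipschitz_in_rivals G L0 L1"
    and A1_marginal: "\<And>i \<zeta>. \<zeta> \<in> par_set G \<Longrightarrow>
          (\<forall>x\<in>type_set G i. integrable (rival_ref G i) (\<lambda>\<xi>. pdens G (\<xi>(i := x)) \<zeta>)) \<and>
          continuous_on (type_set G i) (\<lambda>x. pmarg G i x \<zeta>)"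
    and A1_risk: "\<And>i. law_invariant_convex_risk (rival_ref G i) \<phi>" "tv_continuous \<phi>"
    and A2_const: "\<And>i. 0 \<le> \<kappa>0 i" "\<And>i. 0 \<le> \<kappa>1 i"
    and A2_radius: "spectral_radius (Gamma_bp M L0 L1 \<kappa>0 \<kappa>1) < 1"
    and A3: "\<And>i a \<theta>. a \<in> act_profiles G \<Longrightarrow> \<theta> \<in> type_profiles G \<Longrightarrow>
          norm (own_grad G i a \<theta>) \<le> gbar i"
    and A4_regular: "\<And>i. gradient_regular (act_set G i) (rival_ref G i) \<phi> (W i)"
    and A4_const: "\<And>i. 0 < wbar i" "\<And>i. 0 \<le> lam i"
  shows
    "(\<forall>t h. 1 \<le> t \<and> h \<in> space (history_measure G t) \<and>
        (\<forall>i. regular_belief G \<phi> (W i) (\<kappa>0 i) (\<kappa>1 i) (wbar i) (lam i) i (posterior G i t h)) \<longrightarrow>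
        (\<forall>i. \<forall>x\<in>type_set G i. \<forall>a\<in>act_set G i. \<forall>f\<in>strategies G. 0 < pmarg G i x (truth G) \<longrightarrow>
           norm (grad_vbp G \<phi> i (nu_cond G i (posterior G i t h) x) a f x
                 - grad_vbp G \<phi> i (eta_cond G i (truth G) x) a f x)
           \<le> (2 * wbar i * gbar i + gbar i * lam i)
              * d_TV (nu_cond G i (posterior G i t h) x) (eta_cond G i (truth G) x)))
     \<and>
     (\<forall>\<mu> \<mu>' f f'.
        (\<forall>i. is_belief G (\<mu> i) \<and> predictive_positive G i (\<mu> i) \<and>
             risk_gradient_lipschitz G \<phi> (\<kappa>0 i) (\<kappa>1 i) i (\<mu> i)) \<and>
        (\<forall>i. is_belief G (\<mu>' i) \<and> predictive_positive G i (\<mu>' i) \<and>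
             risk_gradient_lipschitz G \<phi> (\<kappa>0 i) (\<kappa>1 i) i (\<mu>' i)) \<and>
        is_bne G \<phi> (\<lambda>i. nu_cond G i (\<mu> i)) f \<and>
        is_bne G \<phi> (\<lambda>i. nu_cond G i (\<mu>' i)) f' \<longrightarrow>
        strat_norm G (\<lambda>i x. f i x - f' i x)
          \<le> (MAX i. \<Sum>j\<in>UNIV. matrix_inv (mat 1 - Gamma_bp M L0 L1 \<kappa>0 \<kappa>1) $ i $ j *
               (1 / M j * (SUP x\<in>type_set G j.
                  norm (grad_vbp G \<phi> j (nu_cond G j (\<mu> j) x) (f j x) f x
                        - grad_vbp G \<phi> j (nu_cond G j (\<mu>' j) x) (f j x) f x)))))
     \<and>
     (\<forall>ft fstar r L\<^sub>\<eta> \<epsilon>\<^sub>B L\<^sub>p \<delta> lbar.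
        (\<forall>t\<ge>1. AE h in history_measure G t.
           (\<forall>i. regular_belief G \<phi> (W i) (\<kappa>0 i) (\<kappa>1 i) (wbar i) (lam i) i (posterior G i t h)) \<and>
           is_bne G \<phi> (\<lambda>i. nu_cond G i (posterior G i t h)) (ft t h)) \<and>
        is_bne G \<phi> (\<lambda>i. eta_cond G i (truth G)) fstar \<and>
        (\<forall>i. posterior_contracts G i) \<and>
        (\<forall>i. conditional_lipschitz G (L\<^sub>\<eta> i) (r i) (\<epsilon>\<^sub>B i) i) \<and>
        (\<forall>i. marginal_log_lipschitz G (L\<^sub>p i) \<delta> lbar i) \<longrightarrow>
        (\<forall>\<epsilon>\<in>{0<..<1}. \<exists>c1>0. \<exists>c2>0. \<exists>T\<ge>2. \<exists>T'\<ge>2. \<forall>t>max T T'.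
           prob_at_least (history_measure G t)
             (\<lambda>h. strat_norm G (\<lambda>i x. ft t h i x - fstar i x)
                \<le> (MAX i. \<Sum>j\<in>UNIV. matrix_inv (mat 1 - Gamma_bp M L0 L1 \<kappa>0 \<kappa>1) $ i $ j *
                     (2 / M j * (wbar j + lam j) * gbar j * exp (L\<^sub>p j * \<delta>) *
                       (L\<^sub>\<eta> j * exp (L\<^sub>p j * \<delta>) + 2 * (lbar / \<delta>\<^sup>2)) * c2))
                  * (real t - 1) powr (- ((MIN i. r i) * c1 / 2))) (1 - \<epsilon>)))" (is "?part1 \<and> ?part2 \<and> ?part3")
proof -
  interpret bp_game G \<phi> W M \<kappa>0 \<kappa>1 gbar L0 L1
    using game M L A1_marginal A1_risk(1) A2_const A2_radius A3 A4_regular by unfold_locales auto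
  show ?thesis
  proof (intro conjI)
    show ?part1
      using is_belief_posterior by (auto simp: regular_belief_def intro: grad_vbp_nu_cond_diff_le)
    show ?part2
      by (intro allI impI equilibrium_distance_bounds) auto
    show ?part3
      using A4_const by (intro allI impI ballI equilibrium_rate) auto
  qed
qed

end
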